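(* Let $L,T>0$, $\Omega=(0,L)\times(0,T)$, let $v_c$ be a given finite bound and $\mathcal{V}_{ad}=\{v\in L^2(0,L):\|v\|_{L^2(0,L)}\le v_c\}$, and let $v\in\mathcal{V}_{ad}$. Suppose that (a) $k\in L^\infty(0,L)$ is positive and finite-valued, (b) $w\in H^2(0,L)$, and (c) $F\in L^2(\Omega)$. (i) (Existence and uniqueness) There exists a weak solution $u$ of the beam problem with data $(w,v,F)$, and this weak solution is unique. (ii) (Energy estimate) The weak solution satisfies $$\|u\|_{H^{2,1}(\Omega)}\le C_0\Big(\|w''\|_{L^2(0,L)}+\|v\|_{L^2(0,L)}+\|F\|_{L^2(\Omega)}\Big),$$ where $C_0$ is a constant independent of $w$, $v$ and $F$.
   Context: All functions are real-valued. $H^{2,1}(\Omega)$ is the space of all $f\in L^2(\Omega)$ with weak derivatives $f_t,f_x,f_{xx}\in L^2(\Omega)$, with norm $\|f\|_{H^{2,1}(\Omega)}=\big(\int_0^T\int_0^L[f^2+f_t^2+f_x^2+f_{xx}^2]\,dx\,dt\big)^{1/2}$. $\hat H^{2,1}(\Omega)$ is the subset of those $f\in H^{2,1}(\Omega)$ with $f(0,t)=f(L,t)=0$ for all $t\in[0,T]$, with the same norm. The beam problem with data $(w,v,F)$ is: $u_{tt}+(k(x)u_{xx})_{xx}=F(x,t)$ in $\Omega$; $u(x,0)=w(x)$, $u_t(x,0)=v(x)$ for $x\in(0,L)$; $u(0,t)=u(L,t)=u_{xx}(0,t)=u_{xx}(L,t)=0$ for $t\in(0,T)$. A weak solution is a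 function $u\in\hat H^{2,1}(\Omega)$ with $u(x,0)=w(x)$ for $x\in(0,L)$ such that $$\int_0^T\int_0^L(-u_t\eta_t+k(x)u_{xx}\eta_{xx})\,dx\,dt=\int_0^T\int_0^L\eta F\,dx\,dt+\int_0^L v(x)\eta(x,0)\,dx$$ for all $\eta\in\hat H^{2,1}(\Omega)$ with $\eta(x,T)=0$ for all $x\in(0,L)$.
   Formalization: "k positive" is read as k ≥ k0 > 0 a.e. for a constant k0 (with mere pointwise positivity the claim fails, e.g. k=|x−L/2|^{1/2}), and existence additionally assumes w(0)=w(L)=0, which the boundary conditions force (w=1 has no weak solution). *)

theory Defs
  imports "HOL-Analysis.Analysis"
begin

text \<open>Differentiable everywhere, with all directional derivatives along basis vectors again
  in the class: by coinduction this is \<open>C\<^sup>\<infinity>\<close> on the whole space.\<close>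

coinductive smooth :: "('a::euclidean_space \<Rightarrow> real) \<Rightarrow> bool" where
  "\<lbrakk>\<And>p. f differentiable (at p);
    \<And>b. b \<in> Basis \<Longrightarrow> smooth (\<lambda>p. frechet_derivative f (at p) b)\<rbrakk> \<Longrightarrow> smooth f"

definition test_fun :: "'a::euclidean_space set \<Rightarrow> ('a \<Rightarrow> real) \<Rightarrow> bool" where
  "test_fun S \<phi> \<longleftrightarrow> smooth \<phi> \<and> (\<exists>K. compact K \<and> K \<subseteq> S \<and> (\<forall>p. p \<notin> K \<longrightarrow> \<phi> p = 0))"

definition L2 :: "'a::euclidean_space set \<Rightarrow> ('a \<Rightarrow> real) set" where
  "L2 S = {f. f \<in> borel_measurable (lebesgue_on S) \<and> integrable (lebesgue_on S) (\<lambda>p. (f p)\<^sup>2)}"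

definition L2_norm :: "'a::euclidean_space set \<Rightarrow> ('a \<Rightarrow> real) \<Rightarrow> real" where
  "L2_norm S f = sqrt (LINT p|lebesgue_on S. (f p)\<^sup>2)"

definition Linf :: "'a::euclidean_space set \<Rightarrow> ('a \<Rightarrow> real) set" where
  "Linf S = {f. f \<in> borel_measurable (lebesgue_on S) \<and>
                (\<exists>C. AE p in lebesgue_on S. \<bar>f p\<bar> \<le> C)}"

definition has_weak_deriv ::
    "'a::euclidean_space set \<Rightarrow> 'a \<Rightarrow> ('a \<Rightarrow> real) \<Rightarrow> ('a \<Rightarrow> real) \<Rightarrow> bool" where
  "has_weak_deriv S b f g \<longleftrightarrow>
     (\<forall>\<phi>. test_fun S \<phi> \<longrightarrow>
        (LINT p|lebesgue_on S. f p * frechet_derivative \<phi> (at p) b)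
          = - (LINT p|lebesgue_on S. g p * \<phi> p))"

text \<open>The square-integrable weak derivative in direction \<open>b\<close>. It is unique up to null sets and
  only used where it exists; all uses below are insensitive to changes on null sets.\<close>

definition weak_deriv :: "'a::euclidean_space set \<Rightarrow> 'a \<Rightarrow> ('a \<Rightarrow> real) \<Rightarrow> 'a \<Rightarrow> real" where
  "weak_deriv S b f = (SOME g. g \<in> L2 S \<and> has_weak_deriv S b f g)"

text \<open>Elements of \<open>H\<^sup>2(0,L)\<close> are given by their continuous representative on \<open>[0,L]\<close>, so that
  point values make sense.\<close>

definition H2 :: "real \<Rightarrow> (real \<Rightarrow> real) set" where
  "H2 L = {w. continuous_on {0..L} w \<and> w \<in> L2 {0<..<L} \<and>
     (\<exists>w1 \<in> L2 {0<..<L}. \<exists>w2 \<in> L2 {0<..<L}.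
        has_weak_deriv {0<..<L} 1 w w1 \<and> has_weak_deriv {0<..<L} 1 w1 w2)}"

definition dd :: "real \<Rightarrow> (real \<Rightarrow> real) \<Rightarrow> real \<Rightarrow> real" where
  "dd L w = weak_deriv {0<..<L} 1 (weak_deriv {0<..<L} 1 w)"

definition Vad :: "real \<Rightarrow> real \<Rightarrow> (real \<Rightarrow> real) set" where
  "Vad L vc = {v \<in> L2 {0<..<L}. L2_norm {0<..<L} v \<le> vc}"

text \<open>Points are pairs \<open>(x, t)\<close>; the directions \<open>(1,0)\<close> and \<open>(0,1)\<close> give \<open>\<partial>/\<partial>x\<close> and \<open>\<partial>/\<partial>t\<close>.\<close>

definition Omega :: "real \<Rightarrow> real \<Rightarrow> (real \<times> real) set" where
  "Omega L T = {0<..<L} \<times> {0<..<T}"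

definition H21 :: "real \<Rightarrow> real \<Rightarrow> (real \<times> real \<Rightarrow> real) set" where
  "H21 L T = {f \<in> L2 (Omega L T).
     (\<exists>ft \<in> L2 (Omega L T). has_weak_deriv (Omega L T) (0,1) f ft) \<and>
     (\<exists>fx \<in> L2 (Omega L T). \<exists>fxx \<in> L2 (Omega L T).
        has_weak_deriv (Omega L T) (1,0) f fx \<and> has_weak_deriv (Omega L T) (1,0) fx fxx)}"

definition Dt :: "real \<Rightarrow> real \<Rightarrow> (real \<times> real \<Rightarrow> real) \<Rightarrow> real \<times> real \<Rightarrow> real" where
  "Dt L T f = weak_deriv (Omega L T) (0,1) f"

definition Dx :: "real \<Rightarrow> real \<Rightarrow> (real \<times> real \<Rightarrow> real) \<Rightarrow> real \<times> real \<Rightarrow> real" where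
  "Dx L T f = weak_deriv (Omega L T) (1,0) f"

definition Dxx :: "real \<Rightarrow> real \<Rightarrow> (real \<times> real \<Rightarrow> real) \<Rightarrow> real \<times> real \<Rightarrow> real" where
  "Dxx L T f = Dx L T (Dx L T f)"

definition H21_norm :: "real \<Rightarrow> real \<Rightarrow> (real \<times> real \<Rightarrow> real) \<Rightarrow> real" where
  "H21_norm L T f = sqrt (LINT p|lebesgue_on (Omega L T).
     (f p)\<^sup>2 + (Dt L T f p)\<^sup>2 + (Dx L T f p)\<^sup>2 + (Dxx L T f p)\<^sup>2)"

text \<open>Every class in \<open>H\<^sup>2\<^sup>,\<^sup>1\<close> has exactly one representative that is continuous on the closed
  rectangle. The members of the subspace below are these representatives, which gives the
  pointwise boundary, initial and terminal conditions their meaning.\<close>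

definition H21hat :: "real \<Rightarrow> real \<Rightarrow> (real \<times> real \<Rightarrow> real) set" where
  "H21hat L T = {f \<in> H21 L T. continuous_on ({0..L} \<times> {0..T}) f \<and>
     (\<forall>t \<in> {0..T}. f (0, t) = 0 \<and> f (L, t) = 0)}"

definition weak_solution ::
    "real \<Rightarrow> real \<Rightarrow> (real \<Rightarrow> real) \<Rightarrow> (real \<Rightarrow> real) \<Rightarrow> (real \<Rightarrow> real) \<Rightarrow>
     (real \<times> real \<Rightarrow> real) \<Rightarrow> (real \<times> real \<Rightarrow> real) \<Rightarrow> bool" where
  "weak_solution L T k w v F u \<longleftrightarrow>
     u \<in> H21hat L T \<and> (\<forall>x \<in> {0<..<L}. u (x, 0) = w x) \<and>
     (\<forall>\<eta> \<in> H21hat L T. (\<forall>x \<in> {0<..<L}. \<eta> (x, T) = 0) \<longrightarrow>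
        (LINT p|lebesgue_on (Omega L T).
           - (Dt L T u p * Dt L T \<eta> p) + k (fst p) * Dxx L T u p * Dxx L T \<eta> p)
        = (LINT p|lebesgue_on (Omega L T). \<eta> p * F p)
          + (LINT x|lebesgue_on {0<..<L}. v x * \<eta> (x, 0)))"

end

theory Submission
  imports Defs "HOL-Real_Asymp.Real_Asymp"
begin

text \<open>With \<open>p = u\<^sub>t\<close> and \<open>q = u\<^sub>x\<^sub>x\<close> the beam equation becomes the first-order system
  \<open>p\<^sub>t + (k q)\<^sub>x\<^sub>x = F\<close>, \<open>q\<^sub>t = p\<^sub>x\<^sub>x\<close>. Its formal adjoint is coercive on \<open>C\<^sup>2\<close> test pairs
  \<open>(\<phi>, \<psi>)\<close> vanishing at time \<open>T\<close>: pairing it with \<open>(1 + t) (\<phi>, \<psi> / k)\<close> bounds the pair and its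
  initial values by the adjoint. The Riesz representation theorem therefore gives
  a square-integrable solution \<open>(p, q)\<close> of the weak system together with the energy bound.
  Expanding \<open>p\<close> and \<open>q - w''\<close> in the products of \<open>sin ((n+1) \<pi> x / L)\<close> with
  \<open>cos ((m+1/2) \<pi> t / T)\<close> and \<open>sin ((m+1/2) \<pi> t / T)\<close>, the second equation of the system becomes a
  relation between coefficients that says that \<open>(p, q - w'')\<close> are the derivatives of one function;
  its partial sums converge uniformly by the interpolation inequality
  \<open>sup \<bar>u\<bar>\<^sup>2 \<le> 2 L (\<parallel>u\<^sub>t\<parallel>\<^sup>2 + \<parallel>u\<^sub>x\<^sub>x\<parallel>\<^sup>2)\<close>. The same expansions carry the weak equation from
  smooth to arbitrary test functions. Uniqueness follows from existence, because
  the weak form is symmetric under exchanging solution and time-reversed test function.\<close>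

section \<open>Square-integrable functions\<close>

text \<open>The coefficient \<open>k\<close> is merely measurable and must never be differentiated:
  passing to the adjoint moves both space derivatives of \<open>k q\<close> onto the smooth test
  function, and the multiplier \<open>\<psi> / k\<close> cancels the \<open>k\<close> in front of
  \<open>\<phi>\<^sub>x\<^sub>x\<close>. The weight \<open>1 + t\<close> is chosen because its time
  derivative produces the squares integrated over the whole rectangle, while its value 1 at time 0
  keeps control of the initial values, which carry \<open>v\<close> and \<open>w''\<close>.
  Half-integer time frequencies make the cosines vanish at \<open>T\<close>, like admissible test
  functions, and the sines at 0, like \<open>u - w\<close>; time differentiation exchanges the two
  families. The remaining obstacle is that \<open>Dt\<close> and \<open>Dxx\<close> are determined
  only up to null sets, whereas boundary, initial and terminal values are pointwise. A mean-square
  limit carries no such values, so limits have to be uniform. The interpolation inequality provides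
  this because the time derivative of the slice integral of \<open>u\<^sub>x\<^sup>2\<close> is
  \<open>-2\<close> times that of \<open>u\<^sub>x\<^sub>x u\<^sub>t\<close>.\<close>

definition sqi :: "'a measure \<Rightarrow> ('a \<Rightarrow> 'b::euclidean_space) \<Rightarrow> bool" where
  "sqi M f \<longleftrightarrow> f \<in> borel_measurable M \<and> integrable M (\<lambda>x. f x \<bullet> f x)"

text \<open>Values in a Euclidean space let one theory serve scalar functions and the pairs
  \<open>(p, q)\<close> of the first-order system. Functions are not identified modulo null sets, so
  the form is only semidefinite and limits are unique almost everywhere.\<close>

definition ip :: "'a measure \<Rightarrow> ('a \<Rightarrow> 'b::euclidean_space) \<Rightarrow> ('a \<Rightarrow> 'b) \<Rightarrow> real" where
  "ip M f g = (LINT x|M. f x \<bullet> g x)"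

definition nsq :: "'a measure \<Rightarrow> ('a \<Rightarrow> 'b::euclidean_space) \<Rightarrow> real" where
  "nsq M f = ip M f f"

definition L2conv :: "'a measure \<Rightarrow> (nat \<Rightarrow> 'a \<Rightarrow> 'b::euclidean_space) \<Rightarrow> ('a \<Rightarrow> 'b) \<Rightarrow> bool" where
  "L2conv M f g \<longleftrightarrow> (\<lambda>n. nsq M (\<lambda>x. f n x - g x)) \<longlonglongrightarrow> 0"

lemma sqi_measurable: "sqi M f \<Longrightarrow> f \<in> borel_measurable M"
  by (simp add: sqi_def)

lemma sqi_inner_integrable:
  assumes "sqi M f" "sqi M g"
  shows "integrable M (\<lambda>x. f x \<bullet> g x)"
proof (rule Bochner_Integration.integrable_bound)
  show "integrable M (\<lambda>x. f x \<bullet> f x + g x \<bullet> g x)"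
    using assms by (auto simp: sqi_def)
  show "(\<lambda>x. f x \<bullet> g x) \<in> borel_measurable M"
    using assms by (auto simp: sqi_def)
  have "\<bar>u \<bullet> v\<bar> \<le> u \<bullet> u + v \<bullet> v" for u v :: 'b
  proof -
    have "0 \<le> (u + v) \<bullet> (u + v)" "0 \<le> (u - v) \<bullet> (u - v)" "0 \<le> u \<bullet> u" "0 \<le> v \<bullet> v" by auto
    then show ?thesis by (simp add: inner_add inner_diff inner_commute abs_le_iff)
  qed
  then show "AE x in M. norm (f x \<bullet> g x) \<le> norm (f x \<bullet> f x + g x \<bullet> g x)" by simp
qed

lemma sqi_scaleR: "sqi M f \<Longrightarrow> sqi M (\<lambda>x. c *\<^sub>R f x)"
  by (auto simp: sqi_def)

lemma sqi_add:
  assumes "sqi M f" "sqi M g" shows "sqi M (\<lambda>x. f x + g x)"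
  using assms sqi_inner_integrable[OF assms] sqi_inner_integrable[OF assms(2,1)]
  by (auto simp: sqi_def inner_add)

lemma sqi_diff: "sqi M f \<Longrightarrow> sqi M g \<Longrightarrow> sqi M (\<lambda>x. f x - g x)"
  using sqi_add[of M f "\<lambda>x. (-1) *\<^sub>R g x"] sqi_scaleR[of M g "-1"] by simp

lemma sqi_minus: "sqi M f \<Longrightarrow> sqi M (\<lambda>x. - f x)"
  using sqi_scaleR[of M f "-1"] by simp

lemma sqi_zero: "sqi M (\<lambda>x. 0)"
  by (simp add: sqi_def)

lemma sqi_cmult: "sqi M (f :: 'a \<Rightarrow> real) \<Longrightarrow> sqi M (\<lambda>x. c * f x)"
  using sqi_scaleR[of M f c] by simp

lemma sqi_sum: "(\<And>i. i \<in> A \<Longrightarrow> sqi M (f i)) \<Longrightarrow> sqi M (\<lambda>x. \<Sum>i\<in>A. f i x)"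
  by (induction A rule: infinite_finite_induct) (auto simp: sqi_zero intro!: sqi_add)

lemma ip_commute: "ip M f g = ip M g f"
  by (simp add: ip_def inner_commute)

lemma ip_add_left: "sqi M f \<Longrightarrow> sqi M g \<Longrightarrow> sqi M h \<Longrightarrow>
    ip M (\<lambda>x. f x + g x) h = ip M f h + ip M g h"
  by (simp add: ip_def inner_add_left sqi_inner_integrable)

lemma ip_diff_left: "sqi M f \<Longrightarrow> sqi M g \<Longrightarrow> sqi M h \<Longrightarrow>
    ip M (\<lambda>x. f x - g x) h = ip M f h - ip M g h"
  by (simp add: ip_def inner_diff_left sqi_inner_integrable)

lemma ip_scaleR_left: "ip M (\<lambda>x. c *\<^sub>R f x) h = c * ip M f h"
  by (simp add: ip_def)

lemma ip_cmult_left: "ip M (\<lambda>x. c * f x) h = c * ip M f h"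
  using ip_scaleR_left[of M c f h] by simp

lemma ip_cmult_right: "ip M h (\<lambda>x. c * f x) = c * ip M h f"
  using ip_cmult_left[of M c f h] by (simp add: ip_commute)

lemma ip_minus_left: "ip M (\<lambda>x. - f x) h = - ip M f h"
  using ip_scaleR_left[of M "-1" f h] by simp

lemma ip_add_right: "sqi M f \<Longrightarrow> sqi M g \<Longrightarrow> sqi M h \<Longrightarrow>
    ip M h (\<lambda>x. f x + g x) = ip M h f + ip M h g"
  using ip_add_left[of M f g h] by (simp add: ip_commute)

lemma ip_diff_right: "sqi M f \<Longrightarrow> sqi M g \<Longrightarrow> sqi M h \<Longrightarrow>
    ip M h (\<lambda>x. f x - g x) = ip M h f - ip M h g"
  using ip_diff_left[of M f g h] by (simp add: ip_commute)

lemma ip_scaleR_right: "ip M h (\<lambda>x. c *\<^sub>R f x) = c * ip M h f"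
  by (simp add: ip_def)

lemma ip_sum_left:
  "(\<And>i. i \<in> A \<Longrightarrow> sqi M (f i)) \<Longrightarrow> sqi M h \<Longrightarrow> ip M (\<lambda>x. \<Sum>i\<in>A. f i x) h = (\<Sum>i\<in>A. ip M (f i) h)"
proof (induction A rule: infinite_finite_induct)
  case (insert i A)
  then show ?case
    by (simp add: sqi_sum ip_add_left)
qed (auto simp: ip_def)

lemma nsq_nonneg: "0 \<le> nsq M f"
  by (simp add: nsq_def ip_def)

lemma nsq_scaleR: "nsq M (\<lambda>x. c *\<^sub>R f x) = c\<^sup>2 * nsq M f"
  by (simp add: nsq_def ip_def power2_eq_square mult.assoc)

lemma nsq_add:
  assumes "sqi M f" "sqi M g"
  shows "nsq M (\<lambda>x. f x + g x) = nsq M f + 2 * ip M f g + nsq M g"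
  using assms by (simp add: nsq_def ip_add_left ip_add_right sqi_add ip_commute)

lemma nsq_diff:
  assumes "sqi M f" "sqi M g"
  shows "nsq M (\<lambda>x. f x - g x) = nsq M f - 2 * ip M f g + nsq M g"
  using assms by (simp add: nsq_def ip_diff_left ip_diff_right sqi_diff ip_commute)

lemma nsq_diff_commute: "nsq M (\<lambda>x. f x - g x) = nsq M (\<lambda>x. g x - f x)"
  by (simp add: nsq_def ip_def inner_diff algebra_simps)

text \<open>The squared norm of \<open>f - s g\<close> is a quadratic in \<open>s\<close> without
  negative values. If \<open>nsq M g = 0\<close> it is affine, which forces
  \<open>ip M f g = 0\<close>; otherwise its minimum gives the claim.\<close>

lemma ip_Cauchy_Schwarz:
  assumes "sqi M f" "sqi M g"
  shows "(ip M f g)\<^sup>2 \<le> nsq M f * nsq M g"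
proof -
  have *: "0 \<le> nsq M f - 2 * s * ip M f g + s\<^sup>2 * nsq M g" for s
    using nsq_nonneg[of M "\<lambda>x. f x - s *\<^sub>R g x"] nsq_diff[OF assms(1) sqi_scaleR[OF assms(2)]]
    by (simp add: nsq_scaleR ip_scaleR_right)
  show ?thesis
  proof (cases "nsq M g = 0")
    case True
    have "ip M f g = 0"
    proof (rule ccontr)
      assume "ip M f g \<noteq> 0"
      \<comment> \<open>At this \<open>s\<close> the affine function takes the value -1.\<close>
      then show False
        using *[of "(nsq M f + 1) / (2 * ip M f g)"] True by simp
    qed
    then show ?thesis using True by simp
  next
    case False
    then have pos: "nsq M g > 0" using nsq_nonneg[of M g] by simp
    have "0 \<le> nsq M g * (nsq M f - 2 * (ip M f g / nsq M g) * ip M f g + (ip M f g / nsq M g)\<^sup>2 * nsq M g)"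
      using *[of "ip M f g / nsq M g"] pos by (intro mult_nonneg_nonneg) auto
    also have "\<dots> = nsq M f * nsq M g - (ip M f g)\<^sup>2"
      using pos by (simp add: field_simps power2_eq_square)
    finally show ?thesis by simp
  qed
qed

lemma ip_abs_le:
  assumes "sqi M f" "sqi M g"
  shows "\<bar>ip M f g\<bar> \<le> sqrt (nsq M f) * sqrt (nsq M g)"
  using ip_Cauchy_Schwarz[OF assms] real_le_rsqrt by (fastforce simp: real_sqrt_mult[symmetric])

lemma nsq_add_le:
  assumes "sqi M f" "sqi M g"
  shows "nsq M (\<lambda>x. f x + g x) \<le> 2 * nsq M f + 2 * nsq M g"
  using nsq_add[OF assms] nsq_diff[OF assms] nsq_nonneg[of M "\<lambda>x. f x - g x"] by simp

lemma nsq_triangle: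
  assumes "sqi M f" "sqi M g" "sqi M h"
  shows "nsq M (\<lambda>x. f x - h x) \<le> 2 * nsq M (\<lambda>x. f x - g x) + 2 * nsq M (\<lambda>x. g x - h x)"
  using nsq_add_le[OF sqi_diff[OF assms(1,2)] sqi_diff[OF assms(2,3)]] by simp

section \<open>Convergence in mean square\<close>

lemma L2conv_ip:
  assumes "L2conv M f g" "\<And>n. sqi M (f n)" "sqi M g" "sqi M h"
  shows "(\<lambda>n. ip M (f n) h) \<longlonglongrightarrow> ip M g h"
proof -
  have "(\<lambda>n. ip M (f n) h - ip M g h) \<longlonglongrightarrow> 0"
  proof (rule Lim_null_comparison)
    show "\<forall>\<^sub>F n in sequentially. norm (ip M (f n) h - ip M g h)
        \<le> sqrt (nsq M (\<lambda>x. f n x - g x)) * sqrt (nsq M h)"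
      using ip_abs_le[OF sqi_diff[OF assms(2,3)] assms(4)] assms by (simp add: ip_diff_left)
    have "(\<lambda>n. sqrt (nsq M (\<lambda>x. f n x - g x)) * sqrt (nsq M h)) \<longlonglongrightarrow> sqrt 0 * sqrt (nsq M h)"
      using assms(1) unfolding L2conv_def by (intro tendsto_intros)
    then show "(\<lambda>n. sqrt (nsq M (\<lambda>x. f n x - g x)) * sqrt (nsq M h)) \<longlonglongrightarrow> 0" by simp
  qed
  then show ?thesis by (simp add: LIM_zero_iff)
qed

lemma L2conv_nsq:
  assumes "L2conv M f g" "\<And>n. sqi M (f n)" "sqi M g"
  shows "(\<lambda>n. nsq M (f n)) \<longlonglongrightarrow> nsq M g"
proof -
  have "nsq M (f n) = nsq M (\<lambda>x. f n x - g x) + 2 * ip M (f n) g - nsq M g" for n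
    using nsq_diff[OF assms(2,3)] by simp
  moreover have "(\<lambda>n. nsq M (\<lambda>x. f n x - g x) + 2 * ip M (f n) g - nsq M g)
      \<longlonglongrightarrow> 0 + 2 * ip M g g - nsq M g"
    using assms(1) L2conv_ip[OF assms assms(3)] unfolding L2conv_def by (intro tendsto_intros)
  ultimately show ?thesis by (simp add: nsq_def)
qed

lemma L2conv_Cauchy:
  assumes "L2conv M f g" "\<And>n. sqi M (f n)" "sqi M g" "e > 0"
  shows "\<exists>N. \<forall>i\<ge>N. \<forall>j\<ge>N. nsq M (\<lambda>x. f i x - f j x) < e"
proof -
  obtain N where N: "\<And>n. n \<ge> N \<Longrightarrow> nsq M (\<lambda>x. f n x - g x) < e / 4"
    using order_tendstoD(2)[OF assms(1)[unfolded L2conv_def], of "e / 4"] assms(4)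
    by (auto simp: eventually_sequentially)
  show ?thesis
  proof (intro exI[of _ N] allI impI)
    fix i j assume "N \<le> i" "N \<le> j"
    have "nsq M (\<lambda>x. f i x - f j x) \<le> 2 * nsq M (\<lambda>x. f i x - g x) + 2 * nsq M (\<lambda>x. g x - f j x)"
      using nsq_triangle assms by blast
    also have "\<dots> < e"
      using N[OF \<open>N \<le> i\<close>] N[OF \<open>N \<le> j\<close>] nsq_diff_commute[of M g "f j"] by simp
    finally show "nsq M (\<lambda>x. f i x - f j x) < e" .
  qed
qed

lemma nsq_eq_0_AE:
  assumes "sqi M f" "nsq M f = 0"
  shows "AE x in M. f x = 0"
  using assms integral_nonneg_eq_0_iff_AE[of M "\<lambda>x. f x \<bullet> f x"]
  by (simp add: sqi_def nsq_def ip_def)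

lemma ip_cong_AE:
  assumes "AE x in M. f x = f' x" "AE x in M. g x = g' x"
    and "f \<in> borel_measurable M" "f' \<in> borel_measurable M"
    and "g \<in> borel_measurable M" "g' \<in> borel_measurable M"
  shows "ip M f g = ip M f' g'"
  unfolding ip_def
proof (rule integral_cong_AE)
  show "AE x in M. f x \<bullet> g x = f' x \<bullet> g' x" using assms(1,2) by eventually_elim simp
qed (use assms in measurable)

section \<open>Completeness, representation and orthogonal series over a finite measure\<close>

lemma sqi_integrable:
  assumes "finite_measure M" "sqi M (f :: _ \<Rightarrow> real)"
  shows "integrable M f"
proof -
  interpret finite_measure M by fact
  have "sqi M (\<lambda>_. 1::real)" by (simp add: sqi_def)
  from sqi_inner_integrable[OF assms(2) this] show ?thesis by simp
qed

text \<open>Cauchy-Schwarz against the constant 1. It turns mean-square Cauchy sequences into Cauchy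
  sequences in mean, for which almost everywhere convergent subsequences exist.\<close>

lemma integral_norm_le_nsq:
  assumes "finite_measure M" "sqi M f"
  shows "(LINT x|M. norm (f x))\<^sup>2 \<le> nsq M f * measure M (space M)"
proof -
  interpret finite_measure M by fact
  have 1: "sqi M (\<lambda>_. 1::real)" by (simp add: sqi_def)
  have 2: "sqi M (\<lambda>x. norm (f x))"
    using assms(2) by (auto simp: sqi_def power2_norm_eq_inner power2_eq_square[symmetric])
  show ?thesis
    using ip_Cauchy_Schwarz[OF 2 1]
    by (simp add: ip_def nsq_def power2_norm_eq_inner power2_eq_square[symmetric])
qed

text \<open>Riesz-Fischer: the sequence is Cauchy in mean, hence converges almost everywhere along a
  subsequence, and Fatou's lemma makes the pointwise limit a mean-square limit of the whole
  sequence.\<close>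

theorem L2_complete:
  fixes f :: "nat \<Rightarrow> 'a \<Rightarrow> 'b::euclidean_space"
  assumes fin: "finite_measure M" and f: "\<And>n. sqi M (f n)"
    and C: "\<And>e. e > 0 \<Longrightarrow> \<exists>N. \<forall>i\<ge>N. \<forall>j\<ge>N. nsq M (\<lambda>x. f i x - f j x) < e"
  obtains g where "sqi M g" "L2conv M f g"
proof -
  interpret finite_measure M by fact
  \<comment> \<open>The summand 1 keeps the division by \<open>m\<close> legitimate when the measure
    is zero.\<close>
  define m where "m = measure M (space M) + 1"
  have m: "m > 0" by (simp add: m_def add_pos_nonneg add.commute)
  have meas[measurable]: "f n \<in> borel_measurable M" for n using f sqi_measurable by blast
  have int: "integrable M (f n)" for n
  proof (rule integrable_norm_cancel)
    have "sqi M (\<lambda>x. norm (f n x))"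
      using f[of n] by (auto simp: sqi_def power2_norm_eq_inner power2_eq_square[symmetric])
    then show "integrable M (\<lambda>x. norm (f n x))" using fin sqi_integrable by blast
  qed (use meas in auto)
  have L1: "\<exists>N. \<forall>i\<ge>N. \<forall>j\<ge>N. (LINT x|M. norm (f i x - f j x)) < e" if "e > 0" for e
  proof -
    have "e\<^sup>2 / m > 0" using that m by simp
    from C[OF this] obtain N where
      N: "\<And>i j. i \<ge> N \<Longrightarrow> j \<ge> N \<Longrightarrow> nsq M (\<lambda>x. f i x - f j x) < e\<^sup>2 / m"
      by blast
    have "(LINT x|M. norm (f i x - f j x)) < e" if "i \<ge> N" "j \<ge> N" for i j
    proof (rule power2_less_imp_less)
      have "(LINT x|M. norm (f i x - f j x))\<^sup>2 \<le> nsq M (\<lambda>x. f i x - f j x) * measure M (space M)"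
        by (rule integral_norm_le_nsq[OF fin sqi_diff[OF f f]])
      also have "\<dots> \<le> nsq M (\<lambda>x. f i x - f j x) * m"
        by (intro mult_left_mono nsq_nonneg) (simp add: m_def)
      also have "\<dots> < e\<^sup>2" using N[OF that] m by (simp add: pos_less_divide_eq)
      finally show "(LINT x|M. norm (f i x - f j x))\<^sup>2 < e\<^sup>2" .
    qed (use \<open>e > 0\<close> in simp)
    then show ?thesis by blast
  qed
  obtain r where r: "strict_mono r" and AEC: "AE x in M. Cauchy (\<lambda>i. f (r i) x)"
    using cauchy_L1_AE_cauchy_subseq[OF int L1] by blast
  define g where "g x = lim (\<lambda>i. f (r i) x)" for x
  have gm[measurable]: "g \<in> borel_measurable M"
    unfolding g_def by measurable
  have lim: "AE x in M. (\<lambda>i. f (r i) x) \<longlonglongrightarrow> g x"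
    using AEC by eventually_elim (simp add: g_def Cauchy_convergent_iff convergent_LIMSEQ_iff)
  \<comment> \<open>Fatou along the subsequence: \<open>i\<close> stays fixed while the second index
    of the Cauchy condition goes to infinity. Finiteness of the integral also shows that
    \<open>f i - g\<close> is square-integrable.\<close>
  have key: "sqi M (\<lambda>x. f i x - g x) \<and> nsq M (\<lambda>x. f i x - g x) \<le> e"
    if e: "e > 0" and N: "\<And>i j. i \<ge> N \<Longrightarrow> j \<ge> N \<Longrightarrow> nsq M (\<lambda>x. f i x - f j x) < e" and i: "i \<ge> N" for e N i
  proof -
    let ?q = "\<lambda>v::'b. ennreal (v \<bullet> v)"
    have "(\<integral>\<^sup>+x. ?q (f i x - g x) \<partial>M) = (\<integral>\<^sup>+x. liminf (\<lambda>k. ?q (f i x - f (r k) x)) \<partial>M)"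
    proof (rule nn_integral_cong_AE)
      show "AE x in M. ?q (f i x - g x) = liminf (\<lambda>k. ?q (f i x - f (r k) x))"
        using lim
      proof eventually_elim
        case (elim x)
        then have "(\<lambda>k. ?q (f i x - f (r k) x)) \<longlonglongrightarrow> ?q (f i x - g x)"
          by (intro tendsto_ennrealI tendsto_intros)
        from lim_imp_Liminf[OF _ this] show ?case by simp
      qed
    qed
    also have "\<dots> \<le> liminf (\<lambda>k. \<integral>\<^sup>+x. ?q (f i x - f (r k) x) \<partial>M)"
      by (intro nn_integral_liminf) measurable
    also have "\<dots> \<le> limsup (\<lambda>k. \<integral>\<^sup>+x. ?q (f i x - f (r k) x) \<partial>M)"
      by (intro Liminf_le_Limsup) simp
    also have "\<dots> \<le> ennreal e"
    proof (rule Limsup_bounded)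
      show "\<forall>\<^sub>F k in sequentially. (\<integral>\<^sup>+x. ?q (f i x - f (r k) x) \<partial>M) \<le> ennreal e"
        using eventually_ge_at_top[of N]
      proof eventually_elim
        case (elim k)
        then have "r k \<ge> N" using seq_suble[OF r, of k] by simp
        have "(\<integral>\<^sup>+x. ?q (f i x - f (r k) x) \<partial>M) = ennreal (nsq M (\<lambda>x. f i x - f (r k) x))"
          unfolding nsq_def ip_def using sqi_diff[OF f[of i] f[of "r k"]]
          by (intro nn_integral_eq_integral) (auto simp: sqi_def)
        also have "\<dots> \<le> ennreal e" using N[OF i \<open>r k \<ge> N\<close>] by (intro ennreal_leI) simp
        finally show ?case .
      qed
    qed
    finally have le: "(\<integral>\<^sup>+x. ?q (f i x - g x) \<partial>M) \<le> ennreal e" .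
    have I: "integrable M (\<lambda>x. (f i x - g x) \<bullet> (f i x - g x))"
      by (rule integrableI_bounded) (use le in \<open>auto simp: top.not_eq_extremum[symmetric] top_unique\<close>)
    then have "ennreal (nsq M (\<lambda>x. f i x - g x)) \<le> ennreal e"
      using le unfolding nsq_def ip_def by (subst (asm) nn_integral_eq_integral) auto
    then show ?thesis using I e by (auto simp: sqi_def ennreal_le_iff)
  qed
  obtain N1 where "\<And>i j. i \<ge> N1 \<Longrightarrow> j \<ge> N1 \<Longrightarrow> nsq M (\<lambda>x. f i x - f j x) < 1" using C[of 1] by auto
  then have "sqi M (\<lambda>x. f N1 x - g x)" using key[of 1 N1 N1] by simp
  from sqi_diff[OF f[of N1] this] have "sqi M g" by simp
  moreover have "L2conv M f g"
    unfolding L2conv_def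
  proof (rule LIMSEQ_I)
    fix e :: real assume "e > 0"
    then obtain N where N: "\<And>i j. i \<ge> N \<Longrightarrow> j \<ge> N \<Longrightarrow> nsq M (\<lambda>x. f i x - f j x) < e / 2"
      using C[of "e / 2"] by auto
    have "norm (nsq M (\<lambda>x. f i x - g x) - 0) < e" if "i \<ge> N" for i
      using key[OF _ N that] \<open>e > 0\<close> nsq_nonneg[of M "\<lambda>x. f i x - g x"] by simp
    then show "\<exists>N. \<forall>i\<ge>N. norm (nsq M (\<lambda>x. f i x - g x) - 0) < e" by blast
  qed
  ultimately show ?thesis using that by blast
qed

text \<open>The functional is given by its graph \<open>R\<close>: the bound makes it single-valued, so it need not
  be presented as a function.\<close>

theorem L2_Riesz:
  fixes R :: "(('a \<Rightarrow> 'b::euclidean_space) \<times> real) set"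
  assumes fin: "finite_measure M"
    and sq: "\<And>f a. (f, a) \<in> R \<Longrightarrow> sqi M f"
    and ne: "R \<noteq> {}"
    and lin: "\<And>f a g b c. (f, a) \<in> R \<Longrightarrow> (g, b) \<in> R \<Longrightarrow> ((\<lambda>x. f x + c *\<^sub>R g x), a + c * b) \<in> R"
    and bnd: "\<And>f a. (f, a) \<in> R \<Longrightarrow> \<bar>a\<bar> \<le> C * sqrt (nsq M f)" and C: "C \<ge> 0"
  obtains u where "sqi M u" "\<And>f a. (f, a) \<in> R \<Longrightarrow> ip M u f = a" "nsq M u \<le> C\<^sup>2"
proof -
  \<comment> \<open>Dirichlet principle: half the squared norm minus the functional is bounded below
    on the graph by completing the square, and the limit of a minimising sequence represents the
    functional.\<close>
  define J where "J z = nsq M (fst z) / 2 - snd z" for z :: "('a \<Rightarrow> 'b) \<times> real"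
  have Jge: "J z \<ge> - (C\<^sup>2 / 2)" if "z \<in> R" for z
  proof -
    obtain f a where z: "z = (f, a)" by (cases z)
    have "0 \<le> (sqrt (nsq M f) - C)\<^sup>2" by simp
    then have "C * sqrt (nsq M f) \<le> nsq M f / 2 + C\<^sup>2 / 2"
      by (simp add: power2_diff nsq_nonneg algebra_simps)
    then show ?thesis using bnd[of f a] that z by (simp add: J_def abs_le_iff)
  qed
  define d where "d n = 1 / real (Suc n)" for n
  have d: "d n > 0" for n by (simp add: d_def)
  have inv0: "d \<longlonglongrightarrow> 0" unfolding d_def by (rule LIMSEQ_Suc[OF lim_1_over_n])
  define I where "I = Inf (J ` R)"
  have bdd: "bdd_below (J ` R)" using Jge by (auto intro!: bdd_belowI)
  have I: "I \<le> J z" if "z \<in> R" for z unfolding I_def using bdd that by (simp add: cINF_lower)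
  have "\<exists>z\<in>R. J z < I + d n" for n
  proof -
    have "Inf (J ` R) < I + d n" using d by (simp add: I_def)
    then show ?thesis using cInf_lessD[of "J ` R"] ne by auto
  qed
  then obtain z where zR: "\<And>n. z n \<in> R" and zJ: "\<And>n. J (z n) < I + d n" by metis
  define f where "f n = fst (z n)" for n
  define a where "a n = snd (z n)" for n
  have fa: "(f n, a n) \<in> R" for n using zR by (simp add: f_def a_def)
  have J: "nsq M (f n) / 2 - a n < I + d n" for n using zJ[of n] by (simp add: J_def f_def a_def)
  have sf: "sqi M (f n)" for n using sq fa by blast
  \<comment> \<open>Moving a near-minimiser in direction \<open>g\<close> lowers \<open>J\<close> by
    at most \<open>d n\<close>. In the limit this is a nonnegative quadratic in \<open>s\<close>
    without constant term, so its linear coefficient must vanish.\<close>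
  have var: "s * (ip M (f n) g - b) + s\<^sup>2 / 2 * nsq M g \<ge> - d n" if "(g, b) \<in> R" for n g b s
  proof -
    have "I \<le> nsq M (\<lambda>x. f n x + s *\<^sub>R g x) / 2 - (a n + s * b)"
      using I[OF lin[OF fa that]] by (simp add: J_def)
    then show ?thesis using J[of n] nsq_add[OF sf sqi_scaleR[OF sq[OF that]], of n s]
      by (simp add: nsq_scaleR ip_scaleR_right algebra_simps)
  qed
  have Cau: "nsq M (\<lambda>x. f i x - f j x) \<le> 4 * (d i + d j)" for i j
  proof -
    have "((\<lambda>x. f i x + 1 *\<^sub>R f j x), a i + 1 * a j) \<in> R" by (rule lin[OF fa fa])
    \<comment> \<open>\<open>lin\<close> only offers \<open>f + c g\<close>, so the midpoint is
      obtained as the sum minus half of itself.\<close>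
    from lin[OF this this, of "-1/2"]
    have "((\<lambda>x. (1/2) *\<^sub>R (f i x + f j x)), (a i + a j) / 2) \<in> R"
    proof -
      have "v + (-1/2) *\<^sub>R v = (1/2) *\<^sub>R v" for v :: 'b
        using scaleR_left_distrib[of 1 "-1/2" v] by simp
      then show "(\<lambda>x. f i x + 1 *\<^sub>R f j x + (-1/2) *\<^sub>R (f i x + 1 *\<^sub>R f j x), a i + 1 * a j + (-1/2) * (a i + 1 * a j)) \<in> R
        \<Longrightarrow> ?thesis"
        by (simp only: scaleR_one) (simp add: field_simps)
    qed
    from I[OF this] have I8: "I \<le> nsq M (\<lambda>x. f i x + f j x) / 8 - (a i + a j) / 2"
      by (simp add: J_def nsq_scaleR power2_eq_square)
    \<comment> \<open>Parallelogram law: \<open>S + D\<close> is twice the sum of the squared norms,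
      and the value of \<open>J\<close> at the midpoint cannot fall below \<open>I\<close>.\<close>
    have H: "nsq M (f i) + nsq M (f j) + 2 * ip M (f i) (f j) = S \<Longrightarrow>
      nsq M (f i) + nsq M (f j) - 2 * ip M (f i) (f j) = D \<Longrightarrow> I \<le> S / 8 - (a i + a j) / 2 \<Longrightarrow>
      D \<le> 4 * (d i + d j)" for S D
      using J[of i] J[of j] by argo
    show ?thesis
      by (rule H[OF _ _ I8]) (simp_all add: nsq_add nsq_diff sf)
  qed

  obtain u where u: "sqi M u" "L2conv M f u"
  proof (rule L2_complete[OF fin sf])
    fix e :: real assume "e > 0"
    then obtain N where N: "\<And>n. n \<ge> N \<Longrightarrow> d n < e / 8"
      using order_tendstoD(2)[OF inv0, of "e / 8"] by (auto simp: eventually_sequentially)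
    have "nsq M (\<lambda>x. f i x - f j x) < e" if "i \<ge> N" "j \<ge> N" for i j
    proof -
      have "4 * (d i + d j) < e" using N[OF that(1)] N[OF that(2)] by argo
      with Cau[of i j] show ?thesis by (rule le_less_trans)
    qed
    then show "\<exists>N. \<forall>i\<ge>N. \<forall>j\<ge>N. nsq M (\<lambda>x. f i x - f j x) < e" by blast
  qed blast
  have eq: "ip M u g = b" if "(g, b) \<in> R" for g b
  proof -
    have lim: "s * (ip M u g - b) + s\<^sup>2 / 2 * nsq M g \<ge> 0" for s
    proof -
      have "(\<lambda>n. s * (ip M (f n) g - b) + s\<^sup>2 / 2 * nsq M g + d n)
        \<longlonglongrightarrow> s * (ip M u g - b) + s\<^sup>2 / 2 * nsq M g + 0"
        by (intro tendsto_intros L2conv_ip u sf sq[OF that] inv0)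
      moreover have "0 \<le> s * (ip M (f n) g - b) + s\<^sup>2 / 2 * nsq M g + d n" for n
        using var[OF that, where s=s and n=n] by linarith
      ultimately have "0 \<le> s * (ip M u g - b) + s\<^sup>2 / 2 * nsq M g + 0"
        by (intro LIMSEQ_le_const) auto
      then show ?thesis by simp
    qed
    define r where "r = ip M u g - b"
    define e where "e = nsq M g"
    have e: "e \<ge> 0" by (simp add: e_def nsq_nonneg)
    have "r = 0"
    proof (rule ccontr)
      assume r: "r \<noteq> 0"
      \<comment> \<open>The minimiser \<open>- r / e\<close> of the quadratic is replaced by
        \<open>- r / (e + 1)\<close>, which still gives a negative value and covers
        \<open>e = 0\<close>.\<close>
      define y where "y = 1 / (e + 1)"
      have "0 \<le> (- r * y) * r + (- r * y)\<^sup>2 / 2 * e" using lim unfolding r_def e_def by blast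
      also have "\<dots> = - (r\<^sup>2 * y * (1 - e * y / 2))"
        by (simp add: power2_eq_square algebra_simps)
      also have "\<dots> < 0"
      proof -
        have "r\<^sup>2 * y > 0" using r e by (simp add: y_def)
        moreover have "1 - e * y / 2 > 0" using e by (simp add: y_def field_simps)
        ultimately have "r\<^sup>2 * y * (1 - e * y / 2) > 0" by (rule mult_pos_pos)
        then show ?thesis by simp
      qed
      finally show False by simp
    qed
    then show ?thesis by (simp add: r_def)
  qed
  \<comment> \<open>The pairing of \<open>u\<close> with the minimising sequence is
    \<open>a n\<close>, at most \<open>C\<close> times the norm of \<open>f n\<close>; the bound on
    \<open>u\<close> is the limit of this.\<close>
  have "nsq M u \<le> C * sqrt (nsq M u)"
  proof (rule LIMSEQ_le)
    show "(\<lambda>n. ip M (f n) u) \<longlonglongrightarrow> nsq M u" using L2conv_ip[OF u(2) sf u(1) u(1)] by (simp add: nsq_def)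
    show "(\<lambda>n. C * sqrt (nsq M (f n))) \<longlonglongrightarrow> C * sqrt (nsq M u)"
      by (intro tendsto_intros L2conv_nsq u sf)
    show "\<exists>N. \<forall>n\<ge>N. ip M (f n) u \<le> C * sqrt (nsq M (f n))"
      using eq[OF fa] bnd[OF fa] by (metis abs_le_D1 ip_commute)
  qed
  then have "sqrt (nsq M u) * sqrt (nsq M u) \<le> C * sqrt (nsq M u)" by (simp add: nsq_nonneg)
  then have "sqrt (nsq M u) \<le> C"
    using C nsq_nonneg[of M u] by (metis mult_le_cancel_right order.trans not_less real_sqrt_ge_zero)
  then have "nsq M u \<le> C\<^sup>2"
    by (simp add: sqrt_le_D)
  then show ?thesis using that u eq by blast
qed

text \<open>Bessel's inequality bounds the sums of squared coefficients, so the partial sums are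
  Cauchy; their limit has the coefficients of \<open>f\<close> and equals it by completeness of the
  family. The index type is exhausted by finite sets because the families in use are indexed by
  pairs.\<close>

theorem L2_orthogonal_expansion:
  fixes e :: "'i \<Rightarrow> 'a \<Rightarrow> real"
  assumes fin: "finite_measure M" and e: "\<And>i. sqi M (e i)"
    and orth: "\<And>i j. ip M (e i) (e j) = (if i = j then h else 0)" and h: "h > 0"
    and compl: "\<And>g. sqi M g \<Longrightarrow> (\<And>i. ip M g (e i) = 0) \<Longrightarrow> AE x in M. g x = 0"
    and A: "\<And>N. finite (A N)" "\<And>N. A N \<subseteq> A (Suc N)" "(\<Union>N. A N) = UNIV"
    and f: "sqi M f"
  shows "L2conv M (\<lambda>N x. \<Sum>i\<in>A N. ip M f (e i) / h * e i x) f"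
proof -
  define c where "c i = ip M f (e i) / h" for i
  define s where "s N x = (\<Sum>i\<in>A N. c i * e i x)" for N x
  have Amono: "A m \<subseteq> A n" if "m \<le> n" for m n using A(2) that by (rule lift_Suc_mono_le)
  have sume: "sqi M (\<lambda>x. \<Sum>i\<in>B. c i * e i x)" for B by (intro sqi_sum sqi_cmult e)
  have ss: "sqi M (s N)" for N using sume by (simp add: s_def[abs_def])
  have ipj: "ip M (\<lambda>x. \<Sum>i\<in>B. c i * e i x) (e j) = (if j \<in> B then c j * h else 0)" if "finite B" for B j
    using that by (simp add: ip_sum_left sqi_cmult e ip_cmult_left orth if_distrib cong: if_cong)
  have nsqB: "nsq M (\<lambda>x. \<Sum>i\<in>B. c i * e i x) = h * (\<Sum>i\<in>B. (c i)\<^sup>2)" if "finite B" for B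
  proof -
    have "nsq M (\<lambda>x. \<Sum>i\<in>B. c i * e i x) = (\<Sum>j\<in>B. c j * ip M (\<lambda>x. \<Sum>i\<in>B. c i * e i x) (e j))"
      unfolding nsq_def by (subst ip_sum_left) (auto simp: sqi_cmult e sume ip_cmult_left ip_commute[of M "e _"])
    also have "\<dots> = (\<Sum>j\<in>B. h * (c j)\<^sup>2)" using that by (intro sum.cong) (auto simp: ipj power2_eq_square)
    finally show ?thesis by (simp add: sum_distrib_left)
  qed
  have bessel: "h * (\<Sum>i\<in>A N. (c i)\<^sup>2) \<le> nsq M f" for N
  proof -
    have "ip M f (s N) = (\<Sum>i\<in>A N. c i * ip M f (e i))"
      unfolding s_def by (subst ip_commute, subst ip_sum_left) (auto simp: sqi_cmult e f ip_cmult_left ip_commute)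
    also have "\<dots> = h * (\<Sum>i\<in>A N. (c i)\<^sup>2)"
      using h by (simp add: c_def sum_distrib_left power2_eq_square)
    finally have "ip M f (s N) = h * (\<Sum>i\<in>A N. (c i)\<^sup>2)" .
    moreover have "nsq M (s N) = h * (\<Sum>i\<in>A N. (c i)\<^sup>2)" unfolding s_def by (rule nsqB[OF A(1)])
    ultimately show ?thesis using nsq_diff[OF f ss[of N]] nsq_nonneg[of M "\<lambda>x. f x - s N x"] by simp
  qed
  define a where "a N = (\<Sum>i\<in>A N. (c i)\<^sup>2)" for N
  have "convergent a"
  proof (rule Bseq_mono_convergent)
    have "norm (a N) \<le> nsq M f / h" for N
      using bessel[of N] h by (simp add: a_def field_simps sum_nonneg)
    then show "Bseq a" by (rule BseqI')
    show "\<forall>m n. m \<le> n \<longrightarrow> a m \<le> a n" using A(1) Amono by (auto simp: a_def intro!: sum_mono2)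
  qed
  then have Ca: "Cauchy a" by (simp add: Cauchy_convergent_iff)
  have diff: "nsq M (\<lambda>x. s m x - s n x) = h * \<bar>a m - a n\<bar>" for m n
  proof -
    have *: "nsq M (\<lambda>x. s m x - s n x) = h * \<bar>a m - a n\<bar>" if "n \<le> m" for m n
    proof -
      have "s m x - s n x = (\<Sum>i\<in>A m - A n. c i * e i x)" for x
        using sum_diff[OF A(1) Amono[OF that], of "\<lambda>i. c i * e i x"] by (simp add: s_def)
      then have "nsq M (\<lambda>x. s m x - s n x) = h * (\<Sum>i\<in>A m - A n. (c i)\<^sup>2)" using A(1) by (simp add: nsqB)
      moreover have "(\<Sum>i\<in>A m - A n. (c i)\<^sup>2) = a m - a n"
        using sum_diff[OF A(1) Amono[OF that], of "\<lambda>i. (c i)\<^sup>2"] by (simp add: a_def)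
      moreover have "(\<Sum>i\<in>A m - A n. (c i)\<^sup>2) \<ge> 0" by (simp add: sum_nonneg)
      ultimately show ?thesis by simp
    qed
    show ?thesis using *[of n m] *[of m n] nsq_diff_commute[of M "s m" "s n"]
      by (cases "n \<le> m") (auto simp: abs_minus_commute)
  qed
  obtain g where g: "sqi M g" "L2conv M s g"
  proof (rule L2_complete[OF fin ss])
    fix r :: real assume "r > 0"
    then obtain N where "\<And>m n. m \<ge> N \<Longrightarrow> n \<ge> N \<Longrightarrow> norm (a m - a n) < r / h"
      using Ca h unfolding Cauchy_iff by (metis divide_pos_pos)
    then show "\<exists>N. \<forall>i\<ge>N. \<forall>j\<ge>N. nsq M (\<lambda>x. s i x - s j x) < r"
      using h by (auto simp: diff field_simps intro!: exI[of _ N])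
  qed blast
  have "ip M g (e j) = c j * h" for j
  proof -
    obtain N where N: "j \<in> A N" using A(3) by auto
    have "\<forall>\<^sub>F n in sequentially. ip M (s n) (e j) = c j * h"
      using eventually_ge_at_top[of N]
    proof eventually_elim
      case (elim n)
      then have "j \<in> A n" using Amono N by blast
      then show ?case unfolding s_def by (simp add: ipj A(1))
    qed
    then have "(\<lambda>n. ip M (s n) (e j)) \<longlonglongrightarrow> c j * h" by (rule tendsto_eventually)
    with L2conv_ip[OF g(2) ss g(1) e] show ?thesis using LIMSEQ_unique by blast
  qed
  then have "ip M (\<lambda>x. f x - g x) (e j) = 0" for j using h by (simp add: ip_diff_left f g(1) e c_def)
  from compl[OF sqi_diff[OF f g(1)] this] have AE: "AE x in M. f x = g x" by auto
  have "nsq M (\<lambda>x. s N x - f x) = nsq M (\<lambda>x. s N x - g x)" for N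
    unfolding nsq_def using AE sqi_diff[OF ss f, of N] sqi_diff[OF ss g(1), of N]
    by (intro ip_cong_AE) (auto simp: sqi_def)
  then have "L2conv M s f" using g(2) by (simp add: L2conv_def)
  then show ?thesis by (simp add: s_def[abs_def] c_def)
qed

section \<open>Smooth functions and cutoffs\<close>

text \<open>A stratification of the coinductive \<open>smooth\<close> by order. Closure under
  products becomes an induction on the order: the derivative of a product is a sum of products,
  which leaves the shape that a direct coinduction would have to preserve.\<close>

primrec Ck :: "nat \<Rightarrow> ('a::euclidean_space \<Rightarrow> real) \<Rightarrow> bool" where
  "Ck 0 f \<longleftrightarrow> True"
| "Ck (Suc n) f \<longleftrightarrow> (\<forall>p. f differentiable (at p)) \<and>
     (\<forall>b\<in>Basis. Ck n (\<lambda>p. frechet_derivative f (at p) b))"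

lemma smooth_iff_Ck: "smooth f \<longleftrightarrow> (\<forall>n. Ck n f)"
proof
  assume "smooth f"
  then have "Ck n f" for n
  proof (induction n arbitrary: f)
    case (Suc n)
    from Suc.prems show ?case by (cases rule: smooth.cases) (auto intro: Suc.IH)
  qed simp
  then show "\<forall>n. Ck n f" by blast
next
  assume "\<forall>n. Ck n f"
  then show "smooth f"
  proof (coinduction arbitrary: f rule: smooth.coinduct)
    case (smooth f)
    have "Ck (Suc n) f" for n using smooth by blast
    then show ?case by auto
  qed
qed

lemma Ck_SucI:
  assumes "\<And>p. (f has_derivative f' p) (at p)" "\<And>b. b \<in> Basis \<Longrightarrow> Ck n (\<lambda>p. f' p b)"
  shows "Ck (Suc n) f"
proof -
  have "frechet_derivative f (at p) = f' p" for p using frechet_derivative_at[OF assms(1)] by simp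
  then show ?thesis using assms by (auto simp: differentiable_def)
qed

lemma Ck_SucD: "Ck (Suc n) f \<Longrightarrow> (f has_derivative frechet_derivative f (at p)) (at p)"
  by (simp add: frechet_derivative_works)

lemma Ck_Suc_imp: "Ck (Suc n) f \<Longrightarrow> Ck n f"
  by (induction n arbitrary: f) auto

lemma Ck_const: "Ck n (\<lambda>_. c)"
proof (induction n arbitrary: c)
  case (Suc n)
  show ?case by (rule Ck_SucI[where f'="\<lambda>_ _. 0"]) (auto intro: Suc)
qed simp

lemma Ck_add: "Ck n f \<Longrightarrow> Ck n g \<Longrightarrow> Ck n (\<lambda>p. f p + g p)"
proof (induction n arbitrary: f g)
  case (Suc n)
  show ?case
    by (rule Ck_SucI[OF has_derivative_add[OF Ck_SucD[OF Suc.prems(1)] Ck_SucD[OF Suc.prems(2)]]])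
      (use Suc in auto)
qed simp

lemma Ck_mult: "Ck n f \<Longrightarrow> Ck n g \<Longrightarrow> Ck n (\<lambda>p. f p * g p)"
proof (induction n arbitrary: f g)
  case (Suc n)
  show ?case
    by (rule Ck_SucI[OF has_derivative_mult[OF Ck_SucD[OF Suc.prems(1)] Ck_SucD[OF Suc.prems(2)]]])
      (use Suc in \<open>auto intro!: Ck_add Suc.IH Ck_Suc_imp[OF Suc.prems(1)] Ck_Suc_imp[OF Suc.prems(2)]\<close>)
qed simp

lemma Ck_inner_comp: "Ck n a \<Longrightarrow> Ck n (\<lambda>p::'a::euclidean_space. a (p \<bullet> c))"
proof (induction n arbitrary: a)
  case (Suc n)
  define a' where "a' y = frechet_derivative a (at y) 1" for y
  have d: "(a has_derivative (\<lambda>h. h * a' y)) (at y)" for y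
  proof -
    have d: "(a has_derivative frechet_derivative a (at y)) (at y)" by (rule Ck_SucD[OF Suc.prems])
    have "frechet_derivative a (at y) h = h * a' y" for h
      using linear_scale[OF has_derivative_linear[OF d], of h 1] by (simp add: a'_def)
    then have "frechet_derivative a (at y) = (\<lambda>h. h * a' y)" by auto
    with d show ?thesis by simp
  qed
  have "((\<lambda>p::'a. a (p \<bullet> c)) has_derivative (\<lambda>h. (h \<bullet> c) * a' (p \<bullet> c))) (at p)" for p
    by (rule has_derivative_compose[OF bounded_linear_imp_has_derivative[OF bounded_linear_inner_left] d])
  then show ?case
  proof (rule Ck_SucI)
    have "Ck n a'" using Suc.prems by (simp add: a'_def[abs_def])
    then show "Ck n (\<lambda>p::'a. (b \<bullet> c) * a' (p \<bullet> c))" for b by (intro Ck_mult Ck_const Suc.IH)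
  qed
qed simp

lemma Ck_Suc_real:
  assumes "\<And>x. (f has_real_derivative f' x) (at x)" "Ck n f'"
  shows "Ck (Suc n) f"
  using assms(2) by (intro Ck_SucI[of f "\<lambda>x h. f' x * h"])
    (use assms(1) in \<open>auto simp: has_field_derivative_def\<close>)

lemma smooth_const: "smooth (\<lambda>_. c)"
  by (simp add: smooth_iff_Ck Ck_const)

lemma smooth_add: "smooth f \<Longrightarrow> smooth g \<Longrightarrow> smooth (\<lambda>p. f p + g p)"
  by (simp add: smooth_iff_Ck Ck_add)

lemma smooth_mult: "smooth f \<Longrightarrow> smooth g \<Longrightarrow> smooth (\<lambda>p. f p * g p)"
  by (simp add: smooth_iff_Ck Ck_mult)

lemma smooth_prod: "(\<And>i. i \<in> A \<Longrightarrow> smooth (f i)) \<Longrightarrow> smooth (\<lambda>p. \<Prod>i\<in>A. f i p)"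
  by (induction A rule: infinite_finite_induct) (auto intro: smooth_const smooth_mult)

lemma smooth_inner_comp: "smooth a \<Longrightarrow> smooth (\<lambda>p. a (p \<bullet> c))"
  by (simp add: smooth_iff_Ck Ck_inner_comp)

lemma smooth_has_derivative: "smooth f \<Longrightarrow> (f has_derivative frechet_derivative f (at p)) (at p)"
  by (erule smooth.cases) (simp add: frechet_derivative_works)

lemma smooth_deriv: "smooth f \<Longrightarrow> b \<in> Basis \<Longrightarrow> smooth (\<lambda>p. frechet_derivative f (at p) b)"
  by (erule smooth.cases) auto

lemma smooth_continuous_on: "smooth f \<Longrightarrow> continuous_on S f"
  by (meson smooth_has_derivative has_derivative_at_withinI has_derivative_continuous_on)

lemma frechet_derivative_mult_smooth:
  assumes "smooth f" "smooth g"
  shows "frechet_derivative (\<lambda>p. f p * g p) (at p) b =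
    f p * frechet_derivative g (at p) b + frechet_derivative f (at p) b * g p"
  using frechet_derivative_at[OF has_derivative_mult[OF smooth_has_derivative[OF assms(1), of p] smooth_has_derivative[OF assms(2), of p]], symmetric]
  by simp

lemma smooth_linear: "bounded_linear f \<Longrightarrow> smooth f"
  by (coinduction arbitrary: f rule: smooth.coinduct)
    (auto simp: linear_imp_differentiable bounded_linear.linear frechet_derivative_at[OF bounded_linear_imp_has_derivative, symmetric] intro: smooth_const)

lemma smooth_polynomial: "real_polynomial_function f \<Longrightarrow> smooth f"
  by (induction rule: real_polynomial_function.induct)
    (auto intro: smooth_linear smooth_const smooth_add smooth_mult)

text \<open>With both coefficients free the family is closed under differentiation, as the induction
  on the order requires.\<close>

lemma smooth_sin_cos: "smooth (\<lambda>x::real. A * sin (a * x) + B * cos (a * x))"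
proof -
  have "Ck n (\<lambda>x::real. A * sin (a * x) + B * cos (a * x))" for n
  proof (induction n arbitrary: A B)
    case (Suc n)
    show ?case
      by (rule Ck_Suc_real[OF _ Suc[of "- (B * a)" "A * a"]]) (auto intro!: derivative_eq_intros)
  qed simp
  then show ?thesis by (simp add: smooth_iff_Ck)
qed

text \<open>The classical \<open>exp (-1/x)\<close> extended by zero, with powers of
  \<open>1/x\<close> attached: differentiation sends \<open>flat k\<close> to
  \<open>flat (k + 2) - k flat (k + 1)\<close>, so smoothness of all members is a single
  induction.\<close>

definition flat :: "nat \<Rightarrow> real \<Rightarrow> real" where
  "flat k x = (if x > 0 then exp (- 1 / x) / x ^ k else 0)"

lemma flat_nonneg: "0 \<le> flat k x"
  by (simp add: flat_def)

text \<open>With \<open>y = 1 / x\<close> this bounds \<open>exp y\<close> from below by the single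
  term of degree \<open>k + j\<close> of its series. It gives vanishing of every order
  \<open>j\<close> at 0, and a uniform bound for \<open>j = 0\<close>.\<close>

lemma flat_le: "flat k x \<le> fact (k + j) * \<bar>x\<bar> ^ j"
proof (cases "x > 0")
  case True
  define y where "y = 1 / x"
  have y: "y > 0" using True by (simp add: y_def)
  have "(\<Sum>n\<in>{k + j}. y ^ n /\<^sub>R fact n) \<le> (\<Sum>n. y ^ n /\<^sub>R fact n)"
    using y by (intro sum_le_suminf) (auto simp: summable_exp)
  then have "y ^ (k + j) / fact (k + j) \<le> exp y"
    by (simp add: exp_def divide_inverse mult.commute)
  then have "y ^ (k + j) \<le> exp y * fact (k + j)" by (simp add: field_simps)
  then have "y ^ k * exp (- y) \<le> fact (k + j) * (1 / y) ^ j"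
    using y by (simp add: exp_minus field_simps power_add)
  then show ?thesis using True by (simp add: flat_def y_def field_simps exp_minus power_one_over)
next
  case False
  then show ?thesis by (simp add: flat_def)
qed

lemma flat_deriv: "(flat k has_real_derivative flat (k + 2) x - real k * flat (k + 1) x) (at x)"
proof -
  consider "x < 0" | "x > 0" | "x = 0" by linarith
  then show ?thesis
  proof cases
    case 1
    have "((\<lambda>_. 0) has_real_derivative 0) (at x)" by simp
    then have "(flat k has_real_derivative 0) (at x)"
      by (rule has_field_derivative_transform_within_open[where S="{..<0}"]) (use 1 in \<open>auto simp: flat_def\<close>)
    then show ?thesis using 1 by (simp add: flat_def)
  next
    case 2
    have "((\<lambda>x. exp (- 1 / x) / x ^ k) has_real_derivative
      (exp (- 1 / x) * (1 / x^2) * x ^ k - exp (- 1 / x) * (real k * x ^ (k - 1))) / (x ^ k * x ^ k)) (at x)"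
      using 2 by (auto intro!: derivative_eq_intros simp: power2_eq_square)
    also have "(exp (- 1 / x) * (1 / x^2) * x ^ k - exp (- 1 / x) * (real k * x ^ (k - 1))) / (x ^ k * x ^ k)
       = flat (k + 2) x - real k * flat (k + 1) x"
      using 2 by (cases k) (auto simp: flat_def field_simps power2_eq_square)
    finally show ?thesis
      by (rule has_field_derivative_transform_within_open[where S="{0<..}"]) (use 2 in \<open>auto simp: flat_def\<close>)
  next
    case 3
    \<comment> \<open>At the origin the bound of order 2 makes the difference quotient at most a
      constant times \<open>h\<close> in absolute value.\<close>
    have "((\<lambda>h. (flat k (0 + h) - flat k 0) / h) \<longlongrightarrow> 0) (at 0)"
    proof (rule Lim_null_comparison)
      show "\<forall>\<^sub>F h in at 0. norm ((flat k (0 + h) - flat k 0) / h) \<le> fact (k + 2) * \<bar>h\<bar>"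
      proof (rule eventually_at_topological[THEN iffD2], intro exI[of _ UNIV] conjI ballI impI)
        fix h :: real assume "h \<noteq> 0"
        then show "norm ((flat k (0 + h) - flat k 0) / h) \<le> fact (k + 2) * \<bar>h\<bar>"
          using flat_le[of k h 2] flat_nonneg[of k h]
          by (simp add: abs_divide flat_def[of k 0] pos_divide_le_eq mult.assoc power2_eq_square del: fact_Suc)
      qed auto
      have "((\<lambda>h::real. fact (k + 2) * \<bar>h\<bar>) \<longlongrightarrow> fact (k + 2) * \<bar>0\<bar>) (at 0)" by (intro tendsto_intros)
      then show "((\<lambda>h::real. fact (k + 2) * \<bar>h\<bar>) \<longlongrightarrow> 0) (at 0)" by simp
    qed
    then show ?thesis using 3 by (simp add: DERIV_def flat_def)
  qed
qed

lemma smooth_flat: "smooth (flat k)"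
proof -
  have "Ck n (flat k)" for n
  proof (induction n arbitrary: k)
    case (Suc n)
    have "Ck n (\<lambda>x. flat (k + 2) x + (- real k) * flat (k + 1) x)"
      by (intro Ck_add Ck_mult Ck_const Suc)
    then show ?case by (intro Ck_Suc_real[OF flat_deriv]) simp
  qed simp
  then show ?thesis by (simp add: smooth_iff_Ck)
qed

lemma smooth_affine_comp: "smooth a \<Longrightarrow> smooth (\<lambda>x::real. a (\<alpha> * x + \<beta>))"
proof -
  have "Ck n a \<Longrightarrow> Ck n (\<lambda>x::real. a (\<alpha> * x + \<beta>))" for n
  proof (induction n arbitrary: a)
    case (Suc n)
    define a' where "a' y = frechet_derivative a (at y) 1" for y
    have d: "(a has_real_derivative a' y) (at y)" for y
    proof -
      have d: "(a has_derivative frechet_derivative a (at y)) (at y)" by (rule Ck_SucD[OF Suc.prems])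
      have "frechet_derivative a (at y) h = a' y * h" for h
        using linear_scale[OF has_derivative_linear[OF d], of h 1] by (simp add: a'_def)
      then have "frechet_derivative a (at y) = (*) (a' y)" by auto
      with d show ?thesis by (simp add: has_field_derivative_def)
    qed
    show ?case
    proof (rule Ck_Suc_real)
      show "((\<lambda>x. a (\<alpha> * x + \<beta>)) has_real_derivative a' (\<alpha> * x + \<beta>) * \<alpha>) (at x)" for x
        by (rule DERIV_chain2[OF d]) (auto intro!: derivative_eq_intros)
      have "Ck n a'" using Suc.prems by (simp add: a'_def[abs_def])
      then show "Ck n (\<lambda>x. a' (\<alpha> * x + \<beta>) * \<alpha>)" by (intro Ck_mult Ck_const Suc.IH)
    qed
  qed simp
  then show "smooth a \<Longrightarrow> smooth (\<lambda>x::real. a (\<alpha> * x + \<beta>))" by (simp add: smooth_iff_Ck)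
qed

text \<open>Two smooth steps, zero within distance \<open>1 / N\<close> of the endpoints. The
  product never attains 1; the limits below use only that it stays in [0, 1] and converges to 1 at
  each interior point.\<close>

definition rho :: "nat \<Rightarrow> real \<Rightarrow> real \<Rightarrow> real" where
  "rho N L x = flat 0 (real N * x - 1) * flat 0 (real N * (L - x) - 1)"

definition rho' :: "nat \<Rightarrow> real \<Rightarrow> real \<Rightarrow> real" where
  "rho' N L x = real N * flat 2 (real N * x - 1) * flat 0 (real N * (L - x) - 1)
     - real N * flat 0 (real N * x - 1) * flat 2 (real N * (L - x) - 1)"

lemma flat0_le_1: "flat 0 x \<le> 1"
  by (simp add: flat_def)

lemma rho_bounds: "0 \<le> rho N L x" "rho N L x \<le> 1"
  by (auto simp: rho_def flat_nonneg intro!: mult_le_one flat0_le_1)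

lemma smooth_rho: "smooth (rho N L)"
proof -
  have "smooth (\<lambda>x. flat 0 (real N * x + - 1) * flat 0 (- real N * x + (real N * L - 1)))"
    by (intro smooth_mult smooth_affine_comp smooth_flat)
  then show ?thesis by (simp add: rho_def[abs_def] algebra_simps)
qed

lemma rho_deriv: "(rho N L has_real_derivative rho' N L x) (at x)"
  unfolding rho_def rho'_def
  by (auto intro!: derivative_eq_intros DERIV_chain2[OF flat_deriv] simp: algebra_simps numeral_2_eq_2)

lemma rho_eq_0: "N > 0 \<Longrightarrow> x < 1 / real N \<or> x > L - 1 / real N \<Longrightarrow> rho N L x = 0"
  by (auto simp: rho_def flat_def field_simps)

lemma rho'_abs_le: "\<bar>rho' N L x\<bar> \<le> real N * flat 2 (real N * x - 1) + real N * flat 2 (real N * (L - x) - 1)"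
proof -
  have "\<bar>rho' N L x\<bar> \<le> \<bar>real N * flat 2 (real N * x - 1) * flat 0 (real N * (L - x) - 1)\<bar>
     + \<bar>real N * flat 0 (real N * x - 1) * flat 2 (real N * (L - x) - 1)\<bar>"
    unfolding rho'_def by (rule abs_triangle_ineq4)
  also have "\<dots> \<le> real N * flat 2 (real N * x - 1) * 1 + real N * 1 * flat 2 (real N * (L - x) - 1)"
    unfolding abs_mult
    by (intro add_mono mult_mono mult_nonneg_nonneg) (auto simp: flat_nonneg flat0_le_1)
  finally show ?thesis by simp
qed

lemma tendsto_flat0: "x > 0 \<Longrightarrow> (\<lambda>N. flat 0 (real N * x - 1)) \<longlonglongrightarrow> 1"
proof -
  assume x: "x > 0"
  have l: "filterlim (\<lambda>N. real N * x - 1) at_top sequentially"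
    using x by real_asymp
  have "((\<lambda>y. exp (- 1 / y)) \<longlongrightarrow> 1) (at_top :: real filter)"
    by real_asymp
  then have "(flat 0 \<longlongrightarrow> 1) at_top"
    by (rule Lim_transform_eventually)
      (auto simp: flat_def eventually_at_top_linorder intro!: exI[of _ "1::real"])
  from filterlim_compose[OF this l] show ?thesis .
qed

lemma tendsto_rho: "0 < x \<Longrightarrow> x < L \<Longrightarrow> (\<lambda>N. rho N L x) \<longlonglongrightarrow> 1"
  unfolding rho_def using tendsto_mult[OF tendsto_flat0[of x] tendsto_flat0[of "L - x"]] by simp

text \<open>\<open>N x > 2\<close> gives \<open>N x - 1 \<ge> N x / 2\<close>, so at a fixed
  distance from the endpoint the derivative of the step decays like \<open>1 / N\<close>.\<close>

lemma mult_flat2_le: "x > 0 \<Longrightarrow> real N * x > 2 \<Longrightarrow> real N * flat 2 (real N * x - 1) \<le> 4 / (real N * x\<^sup>2)"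
proof -
  assume x: "x > 0" and N: "real N * x > 2"
  have "flat 2 (real N * x - 1) \<le> 1 / (real N * x - 1)\<^sup>2"
    using N by (auto simp: flat_def intro!: divide_right_mono)
  also have "\<dots> \<le> 1 / (real N * x / 2)\<^sup>2"
    using N by (intro divide_left_mono power_mono mult_pos_pos zero_less_power) (auto simp: mult.commute)
  finally have "real N * flat 2 (real N * x - 1) \<le> real N * (1 / (real N * x / 2)\<^sup>2)"
    by (rule mult_left_mono) simp
  also have "\<dots> = 4 / (real N * x\<^sup>2)"
    using N by (auto simp: power2_eq_square field_simps)
  finally show ?thesis .
qed

text \<open>In the variable \<open>y = N x - 1\<close> the product is
  \<open>(1 + y) flat 2 y = flat 2 y + flat 1 y\<close>, at most \<open>fact 2 + fact 1 = 3\<close>.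
  The bound is uniform in \<open>N\<close>, which is what dominated convergence asks for.\<close>

lemma abs_mult_flat2_le: "\<bar>x\<bar> * (real N * flat 2 (real N * x - 1)) \<le> 3"
proof (cases "real N * x - 1 > 0")
  case True
  then have "x > 0" by (smt (verit) mult_nonneg_nonpos of_nat_0_le_iff)
  define y where "y = real N * x - 1"
  have y: "y > 0" using True by (simp add: y_def)
  have "\<bar>x\<bar> * (real N * flat 2 y) = (1 + y) * flat 2 y" using \<open>x > 0\<close> by (simp add: y_def)
  also have "\<dots> = flat 2 y + flat 1 y" using y by (simp add: flat_def field_simps power2_eq_square)
  also have "\<dots> \<le> 3" using flat_le[of 2 y 0] flat_le[of 1 y 0] by (simp add: fact_numeral)
  finally show ?thesis by (simp add: y_def)
qed (simp add: flat_def)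

text \<open>A tensor product over the coordinates with \<open>c\<close> the far corner, so that one
  cutoff serves the interval and the rectangle.\<close>

definition kappa :: "nat \<Rightarrow> 'a::euclidean_space \<Rightarrow> 'a \<Rightarrow> real" where
  "kappa N c p = (\<Prod>b\<in>Basis. rho N (c \<bullet> b) (p \<bullet> b))"

lemma smooth_kappa: "smooth (kappa N c)"
  unfolding kappa_def by (intro smooth_prod smooth_inner_comp smooth_rho)

lemma kappa_bounds: "0 \<le> kappa N c p" "kappa N c p \<le> 1"
  by (auto simp: kappa_def rho_bounds intro!: prod_nonneg prod_le_1)

lemma tendsto_kappa:
  assumes "p \<in> box 0 c" shows "(\<lambda>N. kappa N c p) \<longlonglongrightarrow> 1"
proof -
  have "(\<lambda>N. kappa N c p) \<longlonglongrightarrow> (\<Prod>b\<in>(Basis::'a set). 1)"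
    unfolding kappa_def using assms by (intro tendsto_prod tendsto_rho) (auto simp: mem_box)
  then show ?thesis by simp
qed

lemma test_fun_mult_kappa:
  assumes "smooth g" "N > 0" shows "test_fun (box 0 c) (\<lambda>p. g p * kappa N c p)"
  unfolding test_fun_def
proof (intro conjI exI allI impI)
  let ?K = "cbox ((1 / real N) *\<^sub>R One) (c - (1 / real N) *\<^sub>R One)"
  show "smooth (\<lambda>p. g p * kappa N c p)" by (intro smooth_mult assms smooth_kappa)
  show "compact ?K" by simp
  have pos: "0 < 1 / real N" using assms by simp
  have le: "1 / real N \<le> p \<bullet> b \<and> p \<bullet> b \<le> c \<bullet> b - 1 / real N" if "p \<in> ?K" "b \<in> Basis" for p b
    using that by (auto simp: mem_box inner_diff_left)
  have "0 < p \<bullet> b \<and> p \<bullet> b < c \<bullet> b" if "p \<in> ?K" "b \<in> Basis" for p b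
    using le[OF that] pos by linarith
  then show "?K \<subseteq> box 0 c"
    by (intro subsetI) (simp add: mem_box(1))
  fix p assume "p \<notin> ?K"
  then obtain b where b: "b \<in> Basis" "p \<bullet> b < 1 / real N \<or> p \<bullet> b > c \<bullet> b - 1 / real N"
    by (auto simp: mem_box inner_diff_left not_le)
  then have "kappa N c p = 0"
    unfolding kappa_def using rho_eq_0[OF assms(2)] by (intro prod_zero) auto
  then show "g p * kappa N c p = 0" by simp
qed

section \<open>Uniqueness of weak derivatives\<close>

lemma L2_iff_sqi: "f \<in> L2 S \<longleftrightarrow> sqi (lebesgue_on S) f"
  by (simp add: L2_def sqi_def power2_eq_square)

lemma L2_norm_eq: "L2_norm S f = sqrt (nsq (lebesgue_on S) f)"
  by (simp add: L2_norm_def nsq_def ip_def power2_eq_square)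

lemma finite_measure_box: "finite_measure (lebesgue_on (box (a::'a::euclidean_space) b))"
  by (intro finite_measure_lebesgue_on) simp

lemma continuous_measurable_box:
  fixes f :: "'a::euclidean_space \<Rightarrow> real"
  assumes "continuous_on (cbox a b) f"
  shows "f \<in> borel_measurable (lebesgue_on (box a b))"
  by (rule continuous_imp_measurable_on_sets_lebesgue)
    (use assms box_subset_cbox continuous_on_subset in \<open>blast, simp\<close>)

lemma sqi_bounded:
  fixes f :: "'a \<Rightarrow> real"
  assumes "finite_measure M" "f \<in> borel_measurable M" "AE x in M. \<bar>f x\<bar> \<le> B"
  shows "sqi M f"
proof -
  interpret finite_measure M by fact
  have "AE x in M. norm (f x \<bullet> f x) \<le> B\<^sup>2"
    using assms(3) by eventually_elim (simp add: power2_eq_square[symmetric] abs_le_square_iff[symmetric])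
  then show ?thesis using assms(2) by (auto simp: sqi_def intro!: integrable_const_bound)
qed

lemma continuous_bounded_cbox:
  fixes f :: "'a::euclidean_space \<Rightarrow> real"
  assumes "continuous_on (cbox a b) f"
  obtains B where "B > 0" "\<And>x. x \<in> cbox a b \<Longrightarrow> \<bar>f x\<bar> \<le> B"
proof -
  have "bounded (f ` cbox a b)" using assms by (intro compact_imp_bounded compact_continuous_image) auto
  then show ?thesis using that by (auto simp: bounded_pos)
qed

lemma sqi_continuous:
  fixes f :: "'a::euclidean_space \<Rightarrow> real"
  assumes "continuous_on (cbox a b) f"
  shows "sqi (lebesgue_on (box a b)) f"
proof -
  obtain B where B: "\<And>x. x \<in> cbox a b \<Longrightarrow> \<bar>f x\<bar> \<le> B" using continuous_bounded_cbox[OF assms] by blast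
  show ?thesis
    using B box_subset_cbox[of a b]
    by (intro sqi_bounded[where B=B] finite_measure_box continuous_measurable_box assms AE_I2)
      (auto simp: space_restrict_space)
qed

lemma sqi_mult_bounded:
  fixes f g :: "'a \<Rightarrow> real"
  assumes "sqi M g" "h \<in> borel_measurable M" "AE x in M. \<bar>h x\<bar> \<le> B"
  shows "sqi M (\<lambda>x. h x * g x)"
  unfolding sqi_def
proof
  have g[measurable]: "g \<in> borel_measurable M" using assms(1) by (rule sqi_measurable)
  note assms(2)[measurable]
  show "(\<lambda>x. h x * g x) \<in> borel_measurable M" by measurable
  show "integrable M (\<lambda>x. (h x * g x) \<bullet> (h x * g x))"
  proof (rule Bochner_Integration.integrable_bound)
    show "integrable M (\<lambda>x. B\<^sup>2 * (g x \<bullet> g x))" using assms(1) by (auto simp: sqi_def)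
    show "AE x in M. norm ((h x * g x) \<bullet> (h x * g x)) \<le> norm (B\<^sup>2 * (g x \<bullet> g x))"
      using assms(3)
    proof eventually_elim
      case (elim x)
      then have "(h x)\<^sup>2 \<le> B\<^sup>2" by (simp add: abs_le_square_iff[symmetric])
      then have "(h x)\<^sup>2 * (g x)\<^sup>2 \<le> B\<^sup>2 * (g x)\<^sup>2" by (rule mult_right_mono) simp
      then show ?case by (simp add: power2_eq_square mult_ac abs_mult)
    qed
  qed measurable
qed

lemma nsq_mult_bounded:
  fixes f g :: "'a \<Rightarrow> real"
  assumes "sqi M g" "h \<in> borel_measurable M" "AE x in M. \<bar>h x\<bar> \<le> B"
  shows "nsq M (\<lambda>x. h x * g x) \<le> B\<^sup>2 * nsq M g"
proof -
  have "nsq M (\<lambda>x. h x * g x) \<le> (LINT x|M. B\<^sup>2 * (g x \<bullet> g x))"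
    unfolding nsq_def ip_def
  proof (rule integral_mono_AE)
    show "integrable M (\<lambda>x. (h x * g x) \<bullet> (h x * g x))" using sqi_mult_bounded[OF assms] by (simp add: sqi_def)
    show "integrable M (\<lambda>x. B\<^sup>2 * (g x \<bullet> g x))" using assms(1) by (auto simp: sqi_def)
    show "AE x in M. (h x * g x) \<bullet> (h x * g x) \<le> B\<^sup>2 * (g x \<bullet> g x)"
      using assms(3)
    proof eventually_elim
      case (elim x)
      then have "(h x)\<^sup>2 \<le> B\<^sup>2" by (simp add: abs_le_square_iff[symmetric])
      then have "(h x)\<^sup>2 * (g x)\<^sup>2 \<le> B\<^sup>2 * (g x)\<^sup>2" by (rule mult_right_mono) simp
      then show ?case by (simp add: power2_eq_square mult_ac)
    qed
  qed
  then show ?thesis by (simp add: nsq_def ip_def)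
qed

text \<open>The sign of \<open>g\<close> is almost everywhere a limit of continuous functions, which
  may be truncated to [-1, 1]; dominated convergence then makes the integral of the absolute value
  of \<open>g\<close> zero.\<close>

lemma AE_0_if_orthogonal_continuous:
  fixes g :: "'a::euclidean_space \<Rightarrow> real"
  assumes S: "S \<in> sets lebesgue" and g: "integrable (lebesgue_on S) g"
    and 0: "\<And>h. continuous_on UNIV h \<Longrightarrow> (\<And>x. \<bar>h x\<bar> \<le> 1) \<Longrightarrow> (LINT x|lebesgue_on S. g x * h x) = 0"
  shows "AE x in lebesgue_on S. g x = 0"
proof -
  have gm[measurable]: "g \<in> borel_measurable (lebesgue_on S)" using g by auto
  have "(\<lambda>x. sgn (g x)) \<in> borel_measurable (lebesgue_on S)" by measurable
  then have "(\<lambda>x. sgn (g x)) measurable_on S"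
    using S by (simp add: measurable_on_iff_borel_measurable)
  then obtain N h where N: "negligible N" and h: "\<And>n. continuous_on UNIV (h n)"
    and lim: "\<And>x. x \<notin> N \<Longrightarrow> (\<lambda>n. h n x) \<longlonglongrightarrow> (if x \<in> S then sgn (g x) else 0)"
    unfolding measurable_on_def by metis
  define H where "H n x = max (-1) (min 1 (h n x))" for n :: nat and x
  have Hc: "continuous_on UNIV (H n)" for n unfolding H_def by (intro continuous_intros h)
  have Hb: "\<bar>H n x\<bar> \<le> 1" for n x by (auto simp: H_def)
  have "AE x in lebesgue. x \<notin> N" using N by (simp add: negligible_iff_null_sets AE_not_in)
  then have AEN: "AE x in lebesgue_on S. x \<notin> N"
    using S by (auto simp: AE_restrict_space_iff elim!: eventually_mono)
  have "(\<lambda>n. LINT x|lebesgue_on S. g x * H n x) \<longlonglongrightarrow> (LINT x|lebesgue_on S. \<bar>g x\<bar>)"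
  proof (rule integral_dominated_convergence[where w="\<lambda>x. \<bar>g x\<bar>"])
    have [measurable]: "H n \<in> borel_measurable (lebesgue_on S)" for n
      using continuous_on_subset[OF Hc] S by (intro continuous_imp_measurable_on_sets_lebesgue) auto
    show "(\<lambda>x. g x * H n x) \<in> borel_measurable (lebesgue_on S)" for n by measurable
    show "AE x in lebesgue_on S. (\<lambda>n. g x * H n x) \<longlonglongrightarrow> \<bar>g x\<bar>"
      using AEN AE_space
    proof eventually_elim
      case (elim x)
      then have "x \<in> S" by (simp add: space_restrict_space)
      then have "(\<lambda>n. H n x) \<longlonglongrightarrow> max (-1) (min 1 (sgn (g x)))"
        unfolding H_def using lim[OF elim(1)] by (intro tendsto_intros) auto
      moreover have "max (-1) (min 1 (sgn (g x))) = sgn (g x)" by (simp add: sgn_if)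
      ultimately have "(\<lambda>n. g x * H n x) \<longlonglongrightarrow> g x * sgn (g x)" by (intro tendsto_intros) auto
      moreover have "g x * sgn (g x) = \<bar>g x\<bar>" by (simp add: sgn_if)
      ultimately show ?case by simp
    qed
    show "AE x in lebesgue_on S. norm (g x * H n x) \<le> \<bar>g x\<bar>" for n
      using Hb by (auto simp: abs_mult intro!: mult_left_le)
  qed (use g in auto)
  moreover have "(LINT x|lebesgue_on S. g x * H n x) = 0" for n using 0[OF Hc Hb] .
  ultimately have "(LINT x|lebesgue_on S. \<bar>g x\<bar>) = 0" by (simp add: LIMSEQ_const_iff)
  then show ?thesis using g integral_nonneg_eq_0_iff_AE[of "lebesgue_on S" "\<lambda>x. \<bar>g x\<bar>"] by simp
qed

text \<open>Uniform approximation extends orthogonality from \<open>P\<close> to all continuous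
  functions. The class is left open because two are used: the polynomials, and the multipliers of a
  trigonometric span.\<close>

lemma AE_0_if_orthogonal_dense:
  fixes g :: "'a::euclidean_space \<Rightarrow> real"
  assumes S: "S \<in> sets lebesgue" and g: "integrable (lebesgue_on S) g" and SK: "S \<subseteq> K"
    and dense: "\<And>h e. continuous_on K h \<Longrightarrow> e > 0 \<Longrightarrow> \<exists>p. P p \<and> (\<forall>x\<in>K. \<bar>h x - p x\<bar> < e)"
    and 0: "\<And>p. P p \<Longrightarrow> integrable (lebesgue_on S) (\<lambda>x. g x * p x) \<and> (LINT x|lebesgue_on S. g x * p x) = 0"
  shows "AE x in lebesgue_on S. g x = 0"
proof (rule AE_0_if_orthogonal_continuous[OF S g])
  fix h :: "'a \<Rightarrow> real" assume h: "continuous_on UNIV h" "\<And>x. \<bar>h x\<bar> \<le> 1"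
  let ?I = "LINT x|lebesgue_on S. \<bar>g x\<bar>"
  have gm[measurable]: "g \<in> borel_measurable (lebesgue_on S)" using g by auto
  have [measurable]: "h \<in> borel_measurable (lebesgue_on S)"
    using continuous_on_subset[OF h(1)] S by (intro continuous_imp_measurable_on_sets_lebesgue) auto
  have gh: "integrable (lebesgue_on S) (\<lambda>x. g x * h x)"
    by (rule Bochner_Integration.integrable_bound[OF g])
      (use h(2) in \<open>auto simp: abs_mult intro!: mult_left_le\<close>)
  have "\<bar>LINT x|lebesgue_on S. g x * h x\<bar> \<le> e * ?I" if e: "e > 0" for e
  proof -
    obtain p where p: "P p" "\<And>x. x \<in> K \<Longrightarrow> \<bar>h x - p x\<bar> < e"
      using dense[OF continuous_on_subset[OF h(1) subset_UNIV] e] by auto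
    have gp: "integrable (lebesgue_on S) (\<lambda>x. g x * p x)" "(LINT x|lebesgue_on S. g x * p x) = 0"
      using 0[OF p(1)] by auto
    have "(LINT x|lebesgue_on S. g x * h x) = (LINT x|lebesgue_on S. g x * h x - g x * p x)"
      using gh gp by simp
    also have "\<bar>\<dots>\<bar> \<le> (LINT x|lebesgue_on S. \<bar>g x * h x - g x * p x\<bar>)"
      by (rule integral_abs_bound)
    also have "\<dots> \<le> (LINT x|lebesgue_on S. e * \<bar>g x\<bar>)"
    proof (rule integral_mono)
      fix x assume "x \<in> space (lebesgue_on S)"
      then have "\<bar>h x - p x\<bar> \<le> e" using p(2)[of x] SK by (force simp: space_restrict_space)
      then have "\<bar>g x\<bar> * \<bar>h x - p x\<bar> \<le> \<bar>g x\<bar> * e" by (rule mult_left_mono) simp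
      then show "\<bar>g x * h x - g x * p x\<bar> \<le> e * \<bar>g x\<bar>"
        by (simp add: abs_mult[symmetric] right_diff_distrib mult.commute)
    qed (use g gh gp in auto)
    finally show ?thesis by simp
  qed
  note le = this
  define J where "J = ?I"
  have J: "0 \<le> J" by (simp add: J_def)
  have "\<bar>LINT x|lebesgue_on S. g x * h x\<bar> \<le> 0"
  proof (rule field_le_epsilon)
    fix e :: real assume "e > 0"
    \<comment> \<open>Accuracy \<open>e / (J + 1)\<close> rather than \<open>e / J\<close> covers
      \<open>J = 0\<close>.\<close>
    then have "\<bar>LINT x|lebesgue_on S. g x * h x\<bar> \<le> e / (J + 1) * J" using J unfolding J_def[symmetric] by (intro le[folded J_def]) auto
    also have "\<dots> \<le> e" using J \<open>e > 0\<close> by (simp add: divide_le_eq mult_left_mono)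
    finally show "\<bar>LINT x|lebesgue_on S. g x * h x\<bar> \<le> 0 + e" by simp
  qed
  then show "(LINT x|lebesgue_on S. g x * h x) = 0" by simp
qed

text \<open>The fundamental lemma of the calculus of variations: a polynomial times the cutoff is a
  test function, and the cutoff disappears in the limit by dominated convergence.\<close>

lemma AE_0_if_orthogonal_test_fun:
  fixes g :: "'a::euclidean_space \<Rightarrow> real"
  assumes g: "integrable (lebesgue_on (box 0 c)) g"
    and 0: "\<And>\<phi>. test_fun (box 0 c) \<phi> \<Longrightarrow> (LINT x|lebesgue_on (box 0 c). g x * \<phi> x) = 0"
  shows "AE x in lebesgue_on (box 0 c). g x = 0"
proof (rule AE_0_if_orthogonal_dense[where K="cbox 0 c" and P=real_polynomial_function])
  show "box 0 c \<in> sets lebesgue" by simp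
  show "integrable (lebesgue_on (box 0 c)) g" by fact
  show "box 0 c \<subseteq> cbox 0 c" by (rule box_subset_cbox)
  show "\<exists>p. real_polynomial_function p \<and> (\<forall>x\<in>cbox 0 c. \<bar>h x - p x\<bar> < e)"
    if "continuous_on (cbox 0 c) h" "e > 0" for h :: "'a \<Rightarrow> real" and e
    using Stone_Weierstrass_real_polynomial_function[OF compact_cbox that] by metis
  fix p :: "'a \<Rightarrow> real" assume "real_polynomial_function p"
  then have sp: "smooth p" by (rule smooth_polynomial)
  let ?M = "lebesgue_on (box 0 c)"
  have gm[measurable]: "g \<in> borel_measurable ?M" using g by auto
  have [measurable]: "p \<in> borel_measurable ?M" "kappa N c \<in> borel_measurable ?M" for N
    by (intro continuous_measurable_box smooth_continuous_on sp smooth_kappa)+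
  obtain B where B: "B > 0" "\<And>x. x \<in> cbox 0 c \<Longrightarrow> \<bar>p x\<bar> \<le> B"
    using continuous_bounded_cbox[OF smooth_continuous_on[OF sp]] by blast
  have Bb: "\<bar>p x\<bar> \<le> B" if "x \<in> space ?M" for x
    using that B(2) box_subset_cbox by (force simp: space_restrict_space)
  have gB: "\<bar>g x * p x\<bar> \<le> B * \<bar>g x\<bar>" if "x \<in> space ?M" for x
    using mult_right_mono[OF Bb[OF that], of "\<bar>g x\<bar>"] by (simp add: abs_mult mult.commute)
  have int: "integrable ?M (\<lambda>x. g x * p x)"
    by (rule Bochner_Integration.integrable_bound[of _ "\<lambda>x. B * \<bar>g x\<bar>"])
      (use g gB B in \<open>auto intro!: AE_I2 simp: abs_mult\<close>)
  have "(\<lambda>N. LINT x|?M. g x * (p x * kappa (Suc N) c x)) \<longlonglongrightarrow> (LINT x|?M. g x * p x)"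
  proof (rule integral_dominated_convergence[where w="\<lambda>x. B * \<bar>g x\<bar>"])
    show "integrable ?M (\<lambda>x. B * \<bar>g x\<bar>)" using g by simp
    show "AE x in ?M. (\<lambda>N. g x * (p x * kappa (Suc N) c x)) \<longlonglongrightarrow> g x * p x"
    proof (rule AE_I2)
      fix x assume "x \<in> space ?M"
      then have "(\<lambda>N. kappa (Suc N) c x) \<longlonglongrightarrow> 1"
        by (intro LIMSEQ_Suc tendsto_kappa) (simp add: space_restrict_space)
      then have "(\<lambda>N. g x * (p x * kappa (Suc N) c x)) \<longlonglongrightarrow> g x * (p x * 1)"
        by (intro tendsto_intros)
      then show "(\<lambda>N. g x * (p x * kappa (Suc N) c x)) \<longlonglongrightarrow> g x * p x" by simp
    qed
    show "AE x in ?M. norm (g x * (p x * kappa (Suc N) c x)) \<le> B * \<bar>g x\<bar>" for N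
    proof (rule AE_I2)
      fix x assume "x \<in> space ?M"
      have "\<bar>g x * (p x * kappa (Suc N) c x)\<bar> = \<bar>g x * p x\<bar> * kappa (Suc N) c x"
        by (simp add: abs_mult kappa_bounds)
      also have "\<dots> \<le> \<bar>g x * p x\<bar>" by (intro mult_left_le kappa_bounds) auto
      also note gB[OF \<open>x \<in> space ?M\<close>]
      finally show "norm (g x * (p x * kappa (Suc N) c x)) \<le> B * \<bar>g x\<bar>" by simp
    qed
  qed measurable
  moreover have "(LINT x|?M. g x * (p x * kappa (Suc N) c x)) = 0" for N
    using 0[OF test_fun_mult_kappa[OF sp, of "Suc N"]] by simp
  ultimately show "integrable ?M (\<lambda>x. g x * p x) \<and> (LINT x|?M. g x * p x) = 0"
    using int by (simp add: LIMSEQ_const_iff)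
qed

lemma test_fun_smooth: "test_fun S \<phi> \<Longrightarrow> smooth \<phi>"
  by (simp add: test_fun_def)

lemma test_fun_sqi: "test_fun (box 0 c) \<phi> \<Longrightarrow> sqi (lebesgue_on (box 0 c)) \<phi>"
  by (intro sqi_continuous smooth_continuous_on test_fun_smooth)

lemma test_fun_deriv_sqi:
  "test_fun (box 0 c) \<phi> \<Longrightarrow> b \<in> Basis \<Longrightarrow>
    sqi (lebesgue_on (box 0 c)) (\<lambda>p. frechet_derivative \<phi> (at p) b)"
  by (intro sqi_continuous smooth_continuous_on smooth_deriv test_fun_smooth)

lemma has_weak_deriv_ip:
  "has_weak_deriv S b f g \<longleftrightarrow> (\<forall>\<phi>. test_fun S \<phi> \<longrightarrow>
     ip (lebesgue_on S) f (\<lambda>p. frechet_derivative \<phi> (at p) b) = - ip (lebesgue_on S) g \<phi>)"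
  by (simp add: has_weak_deriv_def ip_def)

lemma weak_deriv_unique:
  assumes "has_weak_deriv (box 0 c) b f g" "has_weak_deriv (box 0 c) b f g'"
    and g: "sqi (lebesgue_on (box 0 c)) g" "sqi (lebesgue_on (box 0 c)) g'"
  shows "AE x in lebesgue_on (box 0 c). g x = g' x"
proof -
  have "AE x in lebesgue_on (box 0 c). g x - g' x = 0"
  proof (rule AE_0_if_orthogonal_test_fun)
    show "integrable (lebesgue_on (box 0 c)) (\<lambda>x. g x - g' x)"
      by (intro sqi_integrable finite_measure_box sqi_diff g)
    fix \<phi> assume t: "test_fun (box 0 c) \<phi>"
    then have "ip (lebesgue_on (box 0 c)) g \<phi> = ip (lebesgue_on (box 0 c)) g' \<phi>"
      using assms(1,2) by (force simp: has_weak_deriv_ip)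
    then have "ip (lebesgue_on (box 0 c)) (\<lambda>x. g x - g' x) \<phi> = 0"
      by (simp add: ip_diff_left g test_fun_sqi[OF t])
    then show "(LINT x|lebesgue_on (box 0 c). (g x - g' x) * \<phi> x) = 0" by (simp add: ip_def)
  qed
  then show ?thesis by auto
qed

lemma weak_deriv_works:
  assumes "sqi (lebesgue_on S) g" "has_weak_deriv S b f g"
  shows "sqi (lebesgue_on S) (weak_deriv S b f)" "has_weak_deriv S b f (weak_deriv S b f)"
  using someI[of "\<lambda>g. g \<in> L2 S \<and> has_weak_deriv S b f g" g] assms
  by (auto simp: weak_deriv_def L2_iff_sqi)

lemma has_weak_deriv_cong_AE:
  assumes "has_weak_deriv (box 0 c) b f g" "b \<in> Basis"
    and "AE x in lebesgue_on (box 0 c). f x = f' x" "AE x in lebesgue_on (box 0 c). g x = g' x"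
    and "sqi (lebesgue_on (box 0 c)) f" "sqi (lebesgue_on (box 0 c)) f'"
    and "sqi (lebesgue_on (box 0 c)) g" "sqi (lebesgue_on (box 0 c)) g'"
  shows "has_weak_deriv (box 0 c) b f' g'"
  unfolding has_weak_deriv_ip
proof (intro allI impI)
  let ?M = "lebesgue_on (box 0 c)"
  fix \<phi> assume t: "test_fun (box 0 c) \<phi>"
  have "ip ?M f' (\<lambda>p. frechet_derivative \<phi> (at p) b) = ip ?M f (\<lambda>p. frechet_derivative \<phi> (at p) b)"
    using assms test_fun_deriv_sqi[OF t assms(2)] by (intro ip_cong_AE) (auto simp: sqi_def)
  also have "\<dots> = - ip ?M g \<phi>" using assms(1) t by (simp add: has_weak_deriv_ip)
  also have "ip ?M g \<phi> = ip ?M g' \<phi>"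
    using assms test_fun_sqi[OF t] by (intro ip_cong_AE) (auto simp: sqi_def)
  finally show "ip ?M f' (\<lambda>p. frechet_derivative \<phi> (at p) b) = - ip ?M g' \<phi>" .
qed

text \<open>Weak differentiation is a closed operator: a test function and its derivative are fixed
  square-integrable functions, so both sides of the defining identity pass to the limit.\<close>

lemma has_weak_deriv_limit:
  assumes "\<And>n. has_weak_deriv (box 0 c) b (f n) (g n)" "b \<in> Basis"
    and "L2conv (lebesgue_on (box 0 c)) f f'" "L2conv (lebesgue_on (box 0 c)) g g'"
    and "\<And>n. sqi (lebesgue_on (box 0 c)) (f n)" "sqi (lebesgue_on (box 0 c)) f'"
    and "\<And>n. sqi (lebesgue_on (box 0 c)) (g n)" "sqi (lebesgue_on (box 0 c)) g'"
  shows "has_weak_deriv (box 0 c) b f' g'"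
  unfolding has_weak_deriv_ip
proof (intro allI impI)
  let ?M = "lebesgue_on (box 0 c)"
  fix \<phi> assume t: "test_fun (box 0 c) \<phi>"
  have "(\<lambda>n. ip ?M (f n) (\<lambda>p. frechet_derivative \<phi> (at p) b)) \<longlonglongrightarrow> ip ?M f' (\<lambda>p. frechet_derivative \<phi> (at p) b)"
    using assms test_fun_deriv_sqi[OF t assms(2)] by (intro L2conv_ip) auto
  moreover have "(\<lambda>n. - ip ?M (g n) \<phi>) \<longlonglongrightarrow> - ip ?M g' \<phi>"
    using assms test_fun_sqi[OF t] by (intro tendsto_minus L2conv_ip) auto
  ultimately show "ip ?M f' (\<lambda>p. frechet_derivative \<phi> (at p) b) = - ip ?M g' \<phi>"
    using assms(1) t LIMSEQ_unique by (force simp: has_weak_deriv_ip)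
qed

lemma has_weak_deriv_lincomb:
  assumes "has_weak_deriv (box 0 c) b f g" "has_weak_deriv (box 0 c) b f' g'" "b \<in> Basis"
    and "sqi (lebesgue_on (box 0 c)) f" "sqi (lebesgue_on (box 0 c)) f'"
    and "sqi (lebesgue_on (box 0 c)) g" "sqi (lebesgue_on (box 0 c)) g'"
  shows "has_weak_deriv (box 0 c) b (\<lambda>x. f x + r * f' x) (\<lambda>x. g x + r * g' x)"
  unfolding has_weak_deriv_ip
proof (intro allI impI)
  let ?M = "lebesgue_on (box 0 c)"
  fix \<phi> assume t: "test_fun (box 0 c) \<phi>"
  show "ip ?M (\<lambda>x. f x + r * f' x) (\<lambda>p. frechet_derivative \<phi> (at p) b) = - ip ?M (\<lambda>x. g x + r * g' x) \<phi>"
    using assms t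
    by (simp add: ip_add_left ip_cmult_left sqi_cmult test_fun_sqi test_fun_deriv_sqi has_weak_deriv_ip)
qed

lemma Omega_eq_box: "Omega L T = box 0 (L, T)"
  by (auto simp: Omega_def mem_box Basis_prod_def)

lemma interval_eq_box: "{0<..<L::real} = box 0 L"
  by simp

section \<open>Iterated integrals on the rectangle\<close>

text \<open>The exceptional set is enlarged to a Borel null set first, because the product structure
  is that of \<open>lborel\<close>, whose completion \<open>lebesgue\<close> is.\<close>

lemma AE_fst:
  assumes "AE x in lebesgue_on {0<..<L::real}. P x"
  shows "AE p in lebesgue_on (Omega L T). P (fst p)"
proof -
  have "AE x in lebesgue. x \<in> {0<..<L} \<longrightarrow> P x"
    using assms by (simp add: AE_restrict_space_iff)
  then have "AE x in lborel. x \<in> {0<..<L} \<longrightarrow> P x"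
    by (simp add: AE_completion_iff)
  then obtain N where N: "N \<in> null_sets lborel" "{x. \<not> (x \<in> {0<..<L} \<longrightarrow> P x)} \<subseteq> N"
    by (auto elim!: AE_E simp: null_sets_def)
  have "N \<times> (UNIV::real set) \<in> null_sets (lborel \<Otimes>\<^sub>M lborel)"
    using N(1) by (auto simp: null_sets_def lborel.emeasure_pair_measure_Times)
  then have "N \<times> (UNIV::real set) \<in> null_sets (lborel :: (real \<times> real) measure)"
    by (simp add: lborel_prod)
  then have "AE p in lborel. p \<notin> N \<times> (UNIV::real set)" by (rule AE_not_in)
  then have "AE p in lebesgue. p \<notin> N \<times> (UNIV::real set)" by (rule AE_completion)
  then have "AE p in lebesgue. p \<in> Omega L T \<longrightarrow> P (fst p)"
    using N(2) by (auto elim!: eventually_mono simp: Omega_def)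
  then show ?thesis by (subst AE_restrict_space_iff) (auto simp: Omega_eq_box)
qed

lemma lebesgue_on_lborel:
  fixes f :: "'a::euclidean_space \<Rightarrow> real"
  assumes "f \<in> borel_measurable borel" "S \<in> sets borel"
  shows "integrable (lebesgue_on S) f \<longleftrightarrow> integrable lborel (\<lambda>x. indicator S x * f x)"
    "(LINT x|lebesgue_on S. f x) = (LINT x|lborel. indicator S x * f x)"
proof -
  have S: "S \<in> sets lebesgue" using assms(2) by simp
  have m: "(\<lambda>x. indicator S x * f x) \<in> borel_measurable lborel" using assms by simp
  show "integrable (lebesgue_on S) f \<longleftrightarrow> integrable lborel (\<lambda>x. indicator S x * f x)"
    using S integrable_completion[OF m] by (simp add: integrable_restrict_space)
  show "(LINT x|lebesgue_on S. f x) = (LINT x|lborel. indicator S x * f x)"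
    using S integral_completion[OF m] by (simp add: integral_restrict_space)
qed

text \<open>All iterated integrals below have this shape: a rough factor depending on
  \<open>x\<close> alone, such as \<open>1 / k\<close> or \<open>w''\<close>, times a function
  continuous on the whole plane and therefore bounded on the rectangle.\<close>

lemma fubini_borel:
  fixes g :: "real \<Rightarrow> real" and h :: "real \<times> real \<Rightarrow> real"
  assumes g: "integrable (lebesgue_on {0<..<L}) g" "g \<in> borel_measurable borel" and h: "continuous_on UNIV h"
  shows "integrable (lebesgue_on (Omega L T)) (\<lambda>p. g (fst p) * h p)"
    "(LINT p|lebesgue_on (Omega L T). g (fst p) * h p) =
       (LINT x|lebesgue_on {0<..<L}. g x * (LINT t|lebesgue_on {0<..<T}. h (x, t)))"
    "(LINT p|lebesgue_on (Omega L T). g (fst p) * h p) =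
       (LINT t|lebesgue_on {0<..<T}. (LINT x|lebesgue_on {0<..<L}. g x * h (x, t)))"
    "integrable (lebesgue_on {0<..<T}) (\<lambda>t. (LINT x|lebesgue_on {0<..<L}. g x * h (x, t)))"
proof -
  note g(2)[measurable]
  have hm[measurable]: "h \<in> borel_measurable borel" using h by (rule borel_measurable_continuous_onI)
  have hm2[measurable]: "h \<in> borel_measurable (borel \<Otimes>\<^sub>M borel)" using hm by (simp add: borel_prod)
  define F where "F p = indicator {0<..<L} (fst p) * g (fst p) * (indicator {0<..<T} (snd p) * h p)" for p
  have Fm[measurable]: "F \<in> borel_measurable (lborel \<Otimes>\<^sub>M lborel)"
    unfolding F_def by measurable
  have FI: "indicator (Omega L T) p * (g (fst p) * h p) = F p" for p
    by (cases p) (auto simp: F_def Omega_def indicator_def)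
  obtain B where B: "B > 0" "\<And>p. p \<in> cbox (0,0) (L,T) \<Longrightarrow> \<bar>h p\<bar> \<le> B"
    using continuous_bounded_cbox[OF continuous_on_subset[OF h]] by blast
  have G: "integrable lborel (\<lambda>x. indicator {0<..<L} x * g x)"
    using g by (simp add: lebesgue_on_lborel)
  have bnd: "\<bar>F (x, t)\<bar> \<le> \<bar>indicator {0<..<L} x * g x\<bar> * (B * indicator {0<..<T} t)" for x t
    using B(2)[of "(x, t)"] by (auto simp: F_def indicator_def abs_mult cbox_Pair_eq intro!: mult_left_mono)
  have ind[simp]: "integrable lborel (indicat_real {0<..<T})"
    using emeasure_bounded_finite[of "{0<..<T}"]
    by (intro integrable_real_indicator) auto
  have Ht: "integrable lborel (\<lambda>t. indicator {0<..<T} t * c)" for c :: real by simp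
  have It: "integrable lborel (\<lambda>t. F (x, t))" for x
  proof (rule Bochner_Integration.integrable_bound)
    show "integrable lborel (\<lambda>t. indicator {0<..<T} t * (\<bar>indicator {0<..<L} x * g x\<bar> * B))" by (rule Ht)
    show "AE t in lborel. norm (F (x, t)) \<le> norm (indicator {0<..<T} t * (\<bar>indicator {0<..<L} x * g x\<bar> * B))"
      using bnd[of x] B(1) by (auto simp: abs_mult mult_ac)
  qed measurable
  have IF: "integrable (lborel \<Otimes>\<^sub>M lborel) F"
  proof (rule lborel_pair.Fubini_integrable)
    show "integrable lborel (\<lambda>x. LINT t|lborel. norm (F (x, t)))"
    proof (rule Bochner_Integration.integrable_bound)
      show "integrable lborel (\<lambda>x. \<bar>indicator {0<..<L} x * g x\<bar> * (LINT t|lborel. (B * indicator {0<..<T::real} t)))"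
        using G by simp
      have "(LINT t|lborel. norm (F (x, t))) \<le> (LINT t|lborel. \<bar>indicator {0<..<L} x * g x\<bar> * (B * indicator {0<..<T} t))" for x
        using bnd[of x] It[of x] by (intro integral_mono) auto
      then show "AE x in lborel. norm (LINT t|lborel. norm (F (x, t))) \<le>
         norm (\<bar>indicator {0<..<L} x * g x\<bar> * (LINT t|lborel. (B * indicator {0<..<T} t)))"
        using B(1) by (auto intro!: order.trans[OF _ abs_ge_self])
    qed measurable
  qed (use It in auto)
  have bm: "(\<lambda>p. g (fst p) * h p) \<in> borel_measurable borel"
    unfolding borel_prod[symmetric] by measurable
  have sO: "Omega L T \<in> sets borel" by (simp add: Omega_eq_box)
  show "integrable (lebesgue_on (Omega L T)) (\<lambda>p. g (fst p) * h p)"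
    using IF by (subst lebesgue_on_lborel(1)[OF bm sO]) (simp add: FI[abs_def] lborel_prod)
  have eq: "(LINT p|lebesgue_on (Omega L T). g (fst p) * h p) = integral\<^sup>L (lborel \<Otimes>\<^sub>M lborel) F"
    by (subst lebesgue_on_lborel(2)[OF bm sO]) (simp add: FI[abs_def] lborel_prod)
  have hx[measurable]: "(\<lambda>t. h (x, t)) \<in> borel_measurable borel" for x
    by (intro borel_measurable_continuous_onI continuous_on_compose2[OF h] continuous_intros) auto
  have ht[measurable]: "(\<lambda>x. h (x, t)) \<in> borel_measurable borel" for t
    by (intro borel_measurable_continuous_onI continuous_on_compose2[OF h] continuous_intros) auto
  have in1: "(LINT t|lebesgue_on {0<..<T}. h (x, t)) = (LINT t|lborel. indicator {0<..<T} t * h (x, t))" for x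
    by (rule lebesgue_on_lborel) auto
  have in2: "(LINT x|lebesgue_on {0<..<L}. g x * h (x, t)) = (LINT x|lborel. indicator {0<..<L} x * (g x * h (x, t)))" for t
    by (rule lebesgue_on_lborel) auto
  have "integral\<^sup>L (lborel \<Otimes>\<^sub>M lborel) F = (LINT x|lborel. LINT t|lborel. F (x, t))"
    by (rule lborel_pair.integral_fst'[OF IF, symmetric])
  also have "\<dots> = (LINT x|lborel. indicator {0<..<L} x * (g x * (LINT t|lebesgue_on {0<..<T}. h (x, t))))"
    by (simp add: F_def in1 mult.assoc)
  also have "\<dots> = (LINT x|lebesgue_on {0<..<L}. g x * (LINT t|lebesgue_on {0<..<T}. h (x, t)))"
    by (rule lebesgue_on_lborel(2)[symmetric]) (auto simp: in1)
  finally show "(LINT p|lebesgue_on (Omega L T). g (fst p) * h p) =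
       (LINT x|lebesgue_on {0<..<L}. g x * (LINT t|lebesgue_on {0<..<T}. h (x, t)))" using eq by simp
  have inF: "(LINT x|lborel. F (x, t)) = indicator {0<..<T} t * (LINT x|lebesgue_on {0<..<L}. g x * h (x, t))" for t
  proof -
    have "(LINT x|lborel. F (x, t)) = (LINT x|lborel. indicator {0<..<T} t * (indicator {0<..<L} x * (g x * h (x, t))))"
      by (intro Bochner_Integration.integral_cong) (auto simp: F_def)
    then show ?thesis by (simp add: in2)
  qed
  have m2: "(\<lambda>t. LINT x|lebesgue_on {0<..<L}. g x * h (x, t)) \<in> borel_measurable borel"
    unfolding in2 by measurable
  have IF': "integrable (lborel \<Otimes>\<^sub>M lborel) (\<lambda>(x, y). F (x, y))" using IF by simp
  have "integral\<^sup>L (lborel \<Otimes>\<^sub>M lborel) F = (LINT t|lborel. LINT x|lborel. F (x, t))"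
    using lborel_pair.integral_snd[OF IF'] by simp
  also have "\<dots> = (LINT t|lebesgue_on {0<..<T}. LINT x|lebesgue_on {0<..<L}. g x * h (x, t))"
    unfolding inF by (rule lebesgue_on_lborel(2)[OF m2, symmetric]) auto
  finally show "(LINT p|lebesgue_on (Omega L T). g (fst p) * h p) =
       (LINT t|lebesgue_on {0<..<T}. (LINT x|lebesgue_on {0<..<L}. g x * h (x, t)))" using eq by simp
  show "integrable (lebesgue_on {0<..<T}) (\<lambda>t. (LINT x|lebesgue_on {0<..<L}. g x * h (x, t)))"
    using lborel_pair.integrable_snd[OF IF']
    by (subst lebesgue_on_lborel(1)[OF m2]) (auto simp: inF)
qed

lemma lebesgue_on_borel_rep:
  fixes g :: "real \<Rightarrow> real"
  assumes "g \<in> borel_measurable (lebesgue_on {0<..<L})"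
  obtains g' where "g' \<in> borel_measurable borel" "AE x in lebesgue_on {0<..<L}. g x = g' x"
proof -
  have "(\<lambda>x. if x \<in> {0<..<L} then g x else 0) \<in> borel_measurable lebesgue"
    using assms by (subst borel_measurable_if) auto
  then obtain g' where g': "g' \<in> borel_measurable lborel"
    "AE x in lborel. (if x \<in> {0<..<L} then g x else 0) = g' x"
    using completion_ex_borel_measurable_real by blast
  then have "AE x in lebesgue. (if x \<in> {0<..<L} then g x else 0) = g' x" by (intro AE_completion) auto
  then have "AE x in lebesgue_on {0<..<L}. g x = g' x"
    by (auto simp: AE_restrict_space_iff elim!: eventually_mono)
  then show ?thesis using that g'(1) by simp
qed

lemma lebesgue_on_measurable_AE:
  fixes f g :: "'a::euclidean_space \<Rightarrow> real"
  assumes "S \<in> sets lebesgue" "f \<in> borel_measurable (lebesgue_on S)" "AE x in lebesgue_on S. f x = g x"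
  shows "g \<in> borel_measurable (lebesgue_on S)"
proof -
  have "(\<lambda>x. if x \<in> S then f x else 0) \<in> borel_measurable lebesgue"
    using assms by (subst borel_measurable_if) auto
  moreover have "AE x in lebesgue. (if x \<in> S then f x else 0) = (if x \<in> S then g x else 0)"
    using assms by (auto simp: AE_restrict_space_iff elim!: eventually_mono)
  ultimately have "(\<lambda>x. if x \<in> S then g x else 0) \<in> borel_measurable lebesgue"
    by (rule borel_measurable_AE)
  then show ?thesis using assms(1) by (subst (asm) borel_measurable_if) auto
qed

lemma sets_Omega: "Omega L T \<in> sets lebesgue"
  by (simp add: Omega_eq_box)

lemma measurable_fst_Omega:
  assumes "g \<in> borel_measurable (lebesgue_on {0<..<L})"
  shows "(\<lambda>p. g (fst p) :: real) \<in> borel_measurable (lebesgue_on (Omega L T))"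
proof -
  obtain g' where g': "g' \<in> borel_measurable borel" "AE x in lebesgue_on {0<..<L}. g x = g' x"
    using lebesgue_on_borel_rep[OF assms] by blast
  have "(\<lambda>p::real \<times> real. g' (fst p)) \<in> borel_measurable borel"
    using g'(1) unfolding borel_prod[symmetric] by measurable
  then have m: "(\<lambda>p. g' (fst p)) \<in> borel_measurable (lebesgue_on (Omega L T))"
    by (intro measurable_restrict_space1 measurable_completion) simp
  show ?thesis
    by (rule lebesgue_on_measurable_AE[OF sets_Omega m])
      (use AE_fst[OF g'(2), of T] in \<open>auto elim!: eventually_mono\<close>)
qed

text \<open>Changing \<open>g\<close> on a null set of the interval changes \<open>g (fst p)\<close>
  on a null set of the rectangle, so the Borel case carries over.\<close>

lemma fubini_fst_mult:
  fixes g :: "real \<Rightarrow> real" and h :: "real \<times> real \<Rightarrow> real"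
  assumes g: "integrable (lebesgue_on {0<..<L}) g" and h: "continuous_on UNIV h"
  shows "integrable (lebesgue_on (Omega L T)) (\<lambda>p. g (fst p) * h p)"
    "(LINT p|lebesgue_on (Omega L T). g (fst p) * h p) =
       (LINT x|lebesgue_on {0<..<L}. g x * (LINT t|lebesgue_on {0<..<T}. h (x, t)))"
    "(LINT p|lebesgue_on (Omega L T). g (fst p) * h p) =
       (LINT t|lebesgue_on {0<..<T}. (LINT x|lebesgue_on {0<..<L}. g x * h (x, t)))"
    "integrable (lebesgue_on {0<..<T}) (\<lambda>t. (LINT x|lebesgue_on {0<..<L}. g x * h (x, t)))"
proof -
  let ?M = "lebesgue_on (Omega L T)" and ?X = "lebesgue_on {0<..<L}"
  have gm: "g \<in> borel_measurable ?X" using g by auto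
  obtain g' where g': "g' \<in> borel_measurable borel" "AE x in ?X. g x = g' x"
    using lebesgue_on_borel_rep[OF gm] by blast
  have g'X: "g' \<in> borel_measurable ?X"
    using g'(1) by (intro measurable_restrict_space1 measurable_completion) simp
  have g'i: "integrable ?X g'" by (rule integrable_cong_AE_imp[OF g g'X g'(2)])
  note F = fubini_borel[OF g'i g'(1) h, of T]
  have hX: "(\<lambda>x. h (x, t)) \<in> borel_measurable ?X" for t
    by (intro continuous_imp_measurable_on_sets_lebesgue continuous_on_compose2[OF h] continuous_intros) auto
  have hX': "(\<lambda>x. LINT t|lebesgue_on {0<..<T}. h (x, t)) \<in> borel_measurable ?X"
  proof -
    have hm[measurable]: "h \<in> borel_measurable (borel \<Otimes>\<^sub>M borel)"
      using h by (simp add: borel_prod borel_measurable_continuous_onI)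
    have "(LINT t|lebesgue_on {0<..<T}. h (x, t)) = (LINT t|lborel. indicator {0<..<T} t * h (x, t))" for x
      by (rule lebesgue_on_lborel) auto
    moreover have "(\<lambda>x. LINT t|lborel. indicator {0<..<T} t * h (x, t)) \<in> borel_measurable borel"
      by measurable
    ultimately show ?thesis by (intro measurable_restrict_space1 measurable_completion) simp
  qed
  have hM: "h \<in> borel_measurable ?M"
    by (rule continuous_imp_measurable_on_sets_lebesgue[OF continuous_on_subset[OF h] sets_Omega]) simp
  have AE: "AE p in ?M. g' (fst p) * h p = g (fst p) * h p"
    using AE_fst[OF g'(2), of T] by (auto elim!: eventually_mono)
  have m1: "(\<lambda>p. g' (fst p) * h p) \<in> borel_measurable ?M" "(\<lambda>p. g (fst p) * h p) \<in> borel_measurable ?M"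
    using measurable_fst_Omega[OF gm, of T] measurable_fst_Omega[OF g'X, of T] hM by measurable
  show "integrable ?M (\<lambda>p. g (fst p) * h p)"
    using F(1) integrable_cong_AE[OF m1 AE] by simp
  have e0: "(LINT p|?M. g (fst p) * h p) = (LINT p|?M. g' (fst p) * h p)"
    using integral_cong_AE[OF m1 AE] by simp
  have e1: "(LINT x|?X. g x * c x) = (LINT x|?X. g' x * c x)" if "c \<in> borel_measurable ?X" for c
  proof (rule integral_cong_AE)
    show "AE x in ?X. g x * c x = g' x * c x" using g'(2) by (auto elim!: eventually_mono)
  qed (use that gm g'X in measurable)
  show "(LINT p|?M. g (fst p) * h p) = (LINT x|?X. g x * (LINT t|lebesgue_on {0<..<T}. h (x, t)))"
    using e0 F(2) e1[OF hX'] by simp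
  show "(LINT p|?M. g (fst p) * h p) = (LINT t|lebesgue_on {0<..<T}. (LINT x|?X. g x * h (x, t)))"
    using e0 F(3) e1[OF hX] by simp
  show "integrable (lebesgue_on {0<..<T}) (\<lambda>t. (LINT x|?X. g x * h (x, t)))"
    using F(4) e1[OF hX] by simp
qed

lemma fubini_continuous:
  fixes h :: "real \<times> real \<Rightarrow> real"
  assumes h: "continuous_on UNIV h"
  shows "integrable (lebesgue_on (Omega L T)) h"
    "(LINT p|lebesgue_on (Omega L T). h p) =
       (LINT x|lebesgue_on {0<..<L}. (LINT t|lebesgue_on {0<..<T}. h (x, t)))"
    "(LINT p|lebesgue_on (Omega L T). h p) =
       (LINT t|lebesgue_on {0<..<T}. (LINT x|lebesgue_on {0<..<L}. h (x, t)))"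
    "integrable (lebesgue_on {0<..<T}) (\<lambda>t. (LINT x|lebesgue_on {0<..<L}. h (x, t)))"
proof -
  have "integrable (lebesgue_on {0<..<L}) (\<lambda>_. 1::real)"
    using finite_measure.integrable_const[OF finite_measure_box[of "0::real" L]] by simp
  from fubini_fst_mult[OF this h, of T]
  show "integrable (lebesgue_on (Omega L T)) h"
    "(LINT p|lebesgue_on (Omega L T). h p) =
       (LINT x|lebesgue_on {0<..<L}. (LINT t|lebesgue_on {0<..<T}. h (x, t)))"
    "(LINT p|lebesgue_on (Omega L T). h p) =
       (LINT t|lebesgue_on {0<..<T}. (LINT x|lebesgue_on {0<..<L}. h (x, t)))"
    "integrable (lebesgue_on {0<..<T}) (\<lambda>t. (LINT x|lebesgue_on {0<..<L}. h (x, t)))"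
    by simp_all
qed

lemma lebesgue_ftc:
  assumes "a \<le> (b::real)" "\<And>x. (H has_real_derivative H' x) (at x)" "continuous_on UNIV H'"
  shows "(LINT x|lebesgue_on {a<..<b}. H' x) = H b - H a"
proof -
  have c: "continuous_on (cbox a b) H'" using assms(3) continuous_on_subset by blast
  have "integrable (lebesgue_on (box a b)) H'"
    by (intro sqi_integrable finite_measure_box sqi_continuous c)
  then have "(LINT x|lebesgue_on {a<..<b}. H' x) = integral {a<..<b} H'"
    by (intro lebesgue_integral_eq_integral) auto
  also have "\<dots> = integral {a..b} H'" by (rule integral_open_interval_real[symmetric])
  also have "\<dots> = H b - H a"
    using assms(1,2)
    by (intro integral_unique fundamental_theorem_of_calculus)
      (auto simp: has_real_derivative_iff_has_vector_derivative[symmetric] intro: has_field_derivative_at_within)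
  finally show ?thesis .
qed

lemma integral_Omega_dt:
  assumes g: "integrable (lebesgue_on {0<..<L}) g" and T: "0 \<le> T"
    and H: "\<And>x t. ((\<lambda>s. H (x, s)) has_real_derivative Ht (x, t)) (at t)" "continuous_on UNIV Ht"
  shows "(LINT p|lebesgue_on (Omega L T). g (fst p) * Ht p) =
    (LINT x|lebesgue_on {0<..<L}. g x * (H (x, T) - H (x, 0)))"
proof -
  have "(LINT t|lebesgue_on {0<..<T}. Ht (x, t)) = H (x, T) - H (x, 0)" for x
    by (rule lebesgue_ftc[OF T H(1)]) (intro continuous_on_compose2[OF H(2)] continuous_intros, auto)
  then show ?thesis using fubini_fst_mult(2)[OF g H(2)] by simp
qed

lemma integral_Omega_dx:
  assumes L: "0 \<le> L"
    and H: "\<And>x t. ((\<lambda>y. H (y, t)) has_real_derivative Hx (x, t)) (at x)" "continuous_on UNIV Hx"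
  shows "(LINT p|lebesgue_on (Omega L T). Hx p) = (LINT t|lebesgue_on {0<..<T}. (H (L, t) - H (0, t)))"
proof -
  have "(LINT x|lebesgue_on {0<..<L}. Hx (x, t)) = H (L, t) - H (0, t)" for t
    by (rule lebesgue_ftc[OF L H(1)]) (intro continuous_on_compose2[OF H(2)] continuous_intros, auto)
  then show ?thesis using fubini_continuous(3)[OF H(2)] by simp
qed

section \<open>Classical functions vanishing on the lateral boundary\<close>

text \<open>Names for the derivatives that the energy identities use. Carrying them as given
  functions keeps \<open>frechet_derivative\<close> out of the classical computations.\<close>

datatype jet = J0 | Jt | Jx | Jxx | Jxt

text \<open>Regularity is asked on the whole plane, so derivatives are two-sided up to the edges of
  the rectangle. \<open>Jxt\<close> is both mixed derivatives by definition, so no exchange of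
  derivatives has to be justified.\<close>

definition nice :: "real \<Rightarrow> (jet \<Rightarrow> real \<times> real \<Rightarrow> real) \<Rightarrow> bool" where
  "nice L D \<longleftrightarrow> (\<forall>i. continuous_on UNIV (D i)) \<and>
    (\<forall>x t. ((\<lambda>s. D J0 (x, s)) has_real_derivative D Jt (x, t)) (at t) \<and>
           ((\<lambda>y. D J0 (y, t)) has_real_derivative D Jx (x, t)) (at x) \<and>
           ((\<lambda>y. D Jx (y, t)) has_real_derivative D Jxx (x, t)) (at x) \<and>
           ((\<lambda>s. D Jx (x, s)) has_real_derivative D Jxt (x, t)) (at t) \<and>
           ((\<lambda>y. D Jt (y, t)) has_real_derivative D Jxt (x, t)) (at x)) \<and>
    (\<forall>t. D J0 (0, t) = 0 \<and> D J0 (L, t) = 0)"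

lemma niceD:
  assumes "nice L D"
  shows "continuous_on S (D i)"
    "((\<lambda>s. D J0 (x, s)) has_real_derivative D Jt (x, t)) (at t)"
    "((\<lambda>y. D J0 (y, t)) has_real_derivative D Jx (x, t)) (at x)"
    "((\<lambda>y. D Jx (y, t)) has_real_derivative D Jxx (x, t)) (at x)"
    "((\<lambda>s. D Jx (x, s)) has_real_derivative D Jxt (x, t)) (at t)"
    "((\<lambda>y. D Jt (y, t)) has_real_derivative D Jxt (x, t)) (at x)"
    "D J0 (0, t) = 0" "D J0 (L, t) = 0"
  using assms continuous_on_subset[of UNIV "D i" S] by (auto simp: nice_def)

lemma nice_Jt_0:
  assumes "nice L D" shows "D Jt (0, t) = 0" "D Jt (L, t) = 0"
  using DERIV_unique[OF niceD(2)[OF assms, of 0 t]] DERIV_unique[OF niceD(2)[OF assms, of L t]]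
  by (simp_all add: niceD(7,8)[OF assms])

lemma nice_zero: "nice L (\<lambda>i p. 0)"
  by (simp add: nice_def)

lemma nice_lincomb:
  assumes "nice L D" "nice L D'"
  shows "nice L (\<lambda>i p. D i p + c * D' i p)"
  using assms unfolding nice_def by (auto intro!: continuous_intros derivative_eq_intros)

lemma nice_sum: "(\<And>j. j \<in> A \<Longrightarrow> nice L (D j)) \<Longrightarrow> nice L (\<lambda>i p. \<Sum>j\<in>A. c j * D j i p)"
proof (induction A rule: infinite_finite_induct)
  case (insert j A)
  then show ?case
    using nice_lincomb[of L "\<lambda>i p. \<Sum>j\<in>A. c j * D j i p" "D j" "c j"] by (simp add: add.commute)
qed (auto simp: nice_zero)

lemma nice_diff: "nice L D \<Longrightarrow> nice L D' \<Longrightarrow> nice L (\<lambda>i p. D i p - D' i p)"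
  using nice_lincomb[of L D D' "-1"] by simp

lemma nice_sqi: "nice L D \<Longrightarrow> sqi (lebesgue_on (Omega L T)) (D i)"
  unfolding Omega_eq_box by (intro sqi_continuous niceD)

lemma nsq_real: "nsq M f = (LINT x|M. (f x)\<^sup>2)" for f :: "_ \<Rightarrow> real"
  by (simp add: nsq_def ip_def power2_eq_square)

lemma integrable_const_interval: "integrable (lebesgue_on {0<..<L::real}) (\<lambda>_. c::real)"
  using finite_measure.integrable_const[OF finite_measure_box[of 0 L], of c] unfolding interval_eq_box .

section \<open>Classical derivatives are weak derivatives\<close>

lemma smooth_partial:
  assumes "smooth \<phi>"
  shows "((\<lambda>y. \<phi> (y, t)) has_real_derivative frechet_derivative \<phi> (at (x, t)) (1, 0)) (at x)"
    "((\<lambda>s. \<phi> (x, s)) has_real_derivative frechet_derivative \<phi> (at (x, t)) (0, 1)) (at t)"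
proof -
  have d: "(\<phi> has_derivative frechet_derivative \<phi> (at (x, t))) (at (x, t))"
    by (rule smooth_has_derivative[OF assms])
  have l: "frechet_derivative \<phi> (at (x, t)) (c *\<^sub>R v) = c * frechet_derivative \<phi> (at (x, t)) v" for c v
    using linear_scale[OF has_derivative_linear[OF d], of c v] by simp
  have 1: "((\<lambda>y. (y, t)) has_derivative (\<lambda>h. (h, 0))) (at x)"
    "((\<lambda>s. (x, s)) has_derivative (\<lambda>h. (0, h))) (at t)"
    by (auto intro!: derivative_eq_intros)
  have "((\<lambda>y. \<phi> (y, t)) has_derivative (\<lambda>h. frechet_derivative \<phi> (at (x, t)) (h, 0))) (at x)"
    by (rule has_derivative_compose[OF 1(1) d])
  moreover have "(\<lambda>h. frechet_derivative \<phi> (at (x, t)) (h, 0)) = (*) (frechet_derivative \<phi> (at (x, t)) (1, 0))"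
  proof
    show "frechet_derivative \<phi> (at (x, t)) (h, 0) = frechet_derivative \<phi> (at (x, t)) (1, 0) * h" for h
      using l[of h "(1,0)"] by simp
  qed
  ultimately show "((\<lambda>y. \<phi> (y, t)) has_real_derivative frechet_derivative \<phi> (at (x, t)) (1, 0)) (at x)"
    by (simp add: has_field_derivative_def)
  have "((\<lambda>s. \<phi> (x, s)) has_derivative (\<lambda>h. frechet_derivative \<phi> (at (x, t)) (0, h))) (at t)"
    by (rule has_derivative_compose[OF 1(2) d])
  moreover have "(\<lambda>h. frechet_derivative \<phi> (at (x, t)) (0, h)) = (*) (frechet_derivative \<phi> (at (x, t)) (0, 1))"
  proof
    show "frechet_derivative \<phi> (at (x, t)) (0, h) = frechet_derivative \<phi> (at (x, t)) (0, 1) * h" for h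
      using l[of h "(0,1)"] by simp
  qed
  ultimately show "((\<lambda>s. \<phi> (x, s)) has_real_derivative frechet_derivative \<phi> (at (x, t)) (0, 1)) (at t)"
    by (simp add: has_field_derivative_def)
qed

lemma Basis_pair[simp]: "(1, 0) \<in> (Basis :: (real \<times> real) set)" "(0, 1) \<in> (Basis :: (real \<times> real) set)"
  by (auto simp: Basis_prod_def)

lemma test_fun_boundary:
  assumes "test_fun S \<phi>" "p \<notin> S" shows "\<phi> p = 0"
  using assms by (auto simp: test_fun_def)

lemma has_weak_deriv_x_classical:
  assumes L: "0 \<le> L" and f: "continuous_on UNIV f" "continuous_on UNIV g"
    and d: "\<And>x t. ((\<lambda>y. f (y, t)) has_real_derivative g (x, t)) (at x)"
  shows "has_weak_deriv (Omega L T) (1,0) f g"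
  unfolding has_weak_deriv_def
proof (intro allI impI)
  fix \<phi> assume t: "test_fun (Omega L T) \<phi>"
  let ?M = "lebesgue_on (Omega L T)" and ?d = "\<lambda>p. frechet_derivative \<phi> (at p) (1, 0)"
  have s: "smooth \<phi>" using t by (rule test_fun_smooth)
  have cd: "continuous_on UNIV ?d" by (intro smooth_continuous_on smooth_deriv s) simp
  have cp: "continuous_on UNIV \<phi>" by (intro smooth_continuous_on s)
  have "(LINT p|?M. f p * ?d p + g p * \<phi> p) = (LINT t|lebesgue_on {0<..<T}. f (L, t) * \<phi> (L, t) - f (0, t) * \<phi> (0, t))"
  proof (rule integral_Omega_dx[OF L, where H="\<lambda>p. f p * \<phi> p"])
    show "((\<lambda>y. f (y, t) * \<phi> (y, t)) has_real_derivative f (x, t) * ?d (x, t) + g (x, t) * \<phi> (x, t)) (at x)" for x t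
      by (rule DERIV_cong[OF DERIV_mult[OF d smooth_partial(1)[OF s]]]) simp
    show "continuous_on UNIV (\<lambda>p. f p * ?d p + g p * \<phi> p)" by (intro continuous_intros f cd cp)
  qed
  also have "\<dots> = 0" using test_fun_boundary[OF t] by (simp add: Omega_def)
  finally have "(LINT p|?M. f p * ?d p + g p * \<phi> p) = 0" .
  moreover have "integrable ?M (\<lambda>p. f p * ?d p)" "integrable ?M (\<lambda>p. g p * \<phi> p)"
    by (intro fubini_continuous continuous_intros f cd cp)+
  ultimately show "(LINT p|?M. f p * ?d p) = - (LINT p|?M. g p * \<phi> p)" by simp
qed

lemma has_weak_deriv_t_classical:
  assumes T: "0 \<le> T" and f: "continuous_on UNIV f" "continuous_on UNIV g"
    and d: "\<And>x t. ((\<lambda>s. f (x, s)) has_real_derivative g (x, t)) (at t)"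
  shows "has_weak_deriv (Omega L T) (0,1) f g"
  unfolding has_weak_deriv_def
proof (intro allI impI)
  fix \<phi> assume t: "test_fun (Omega L T) \<phi>"
  let ?M = "lebesgue_on (Omega L T)" and ?d = "\<lambda>p. frechet_derivative \<phi> (at p) (0, 1)"
  have s: "smooth \<phi>" using t by (rule test_fun_smooth)
  have cd: "continuous_on UNIV ?d" by (intro smooth_continuous_on smooth_deriv s) simp
  have cp: "continuous_on UNIV \<phi>" by (intro smooth_continuous_on s)
  have "integrable (lebesgue_on {0<..<L}) (\<lambda>_. 1::real)"
    by (rule integrable_const_interval)
  then have "(LINT p|?M. 1 * (f p * ?d p + g p * \<phi> p)) = (LINT x|lebesgue_on {0<..<L}. 1 * (f (x, T) * \<phi> (x, T) - f (x, 0) * \<phi> (x, 0)))"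
  proof (rule integral_Omega_dt[OF _ T, where H="\<lambda>p. f p * \<phi> p"])
    show "((\<lambda>s. f (x, s) * \<phi> (x, s)) has_real_derivative f (x, t) * ?d (x, t) + g (x, t) * \<phi> (x, t)) (at t)" for x t
      by (rule DERIV_cong[OF DERIV_mult[OF d smooth_partial(2)[OF s]]]) simp
    show "continuous_on UNIV (\<lambda>p. f p * ?d p + g p * \<phi> p)" by (intro continuous_intros f cd cp)
  qed
  also have "\<dots> = 0" using test_fun_boundary[OF t] by (simp add: Omega_def)
  finally have "(LINT p|?M. f p * ?d p + g p * \<phi> p) = 0" by simp
  moreover have "integrable ?M (\<lambda>p. f p * ?d p)" "integrable ?M (\<lambda>p. g p * \<phi> p)"
    by (intro fubini_continuous continuous_intros f cd cp)+
  ultimately show "(LINT p|?M. f p * ?d p) = - (LINT p|?M. g p * \<phi> p)" by simp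
qed

lemma nice_weak_derivs:
  assumes "nice L D" "0 \<le> L" "0 \<le> T"
  shows "has_weak_deriv (Omega L T) (1,0) (D J0) (D Jx)" "has_weak_deriv (Omega L T) (1,0) (D Jx) (D Jxx)"
    "has_weak_deriv (Omega L T) (0,1) (D J0) (D Jt)"
  using assms by (auto intro!: has_weak_deriv_x_classical has_weak_deriv_t_classical niceD)

section \<open>Poincare and interpolation inequalities\<close>

lemma slice_continuous:
  assumes "continuous_on UNIV (h :: real \<times> real \<Rightarrow> real)"
  shows "continuous_on S (\<lambda>x. h (x, t))" "continuous_on S (\<lambda>s. h (x, s))"
  by (auto intro!: continuous_on_compose2[OF assms] continuous_intros)

lemma slice_sqi:
  assumes "continuous_on UNIV (h :: real \<times> real \<Rightarrow> real)"
  shows "sqi (lebesgue_on {0<..<a}) (\<lambda>x. h (x, t))"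
  unfolding interval_eq_box by (intro sqi_continuous slice_continuous assms)

text \<open>The function vanishes at \<open>x = 0\<close>, so it is the integral of
  \<open>Jx\<close> from there; Cauchy-Schwarz gives the factor \<open>x\<close>, at most
  \<open>L\<close>.\<close>

lemma nice_pointwise:
  assumes D: "nice L D" and x: "0 \<le> x" "x \<le> L"
  shows "(D J0 (x, t))\<^sup>2 \<le> L * (LINT y|lebesgue_on {0<..<L}. (D Jx (y, t))\<^sup>2)"
proof -
  have c: "continuous_on UNIV (D Jx)" "continuous_on UNIV (\<lambda>y. (D Jx (y, t))\<^sup>2)"
    by (intro continuous_intros slice_continuous niceD[OF D])+
  have HK: "(LINT y|lebesgue_on {0<..<a}. (D Jx (y, t))\<^sup>2) = integral {0..a} (\<lambda>y. (D Jx (y, t))\<^sup>2)" for a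
  proof -
    have "integrable (lebesgue_on {0<..<a}) (\<lambda>y. (D Jx (y, t))\<^sup>2)"
      using slice_sqi[OF c(1), of a t] by (simp add: sqi_def power2_eq_square)
    then show ?thesis by (simp add: lebesgue_integral_eq_integral integral_open_interval_real)
  qed
  let ?X = "lebesgue_on {0<..<x}"
  have one: "sqi ?X (\<lambda>_. 1::real)"
    unfolding interval_eq_box by (intro sqi_continuous continuous_intros)
  have "D J0 (x, t) = (LINT y|?X. D Jx (y, t))"
    using lebesgue_ftc[OF x(1) niceD(3)[OF D] slice_continuous(1)[OF c(1)]] by (simp add: niceD(7)[OF D])
  then have "(D J0 (x, t))\<^sup>2 = (ip ?X (\<lambda>_. 1) (\<lambda>y. D Jx (y, t)))\<^sup>2" by (simp add: ip_def)
  also have "\<dots> \<le> nsq ?X (\<lambda>_. 1::real) * nsq ?X (\<lambda>y. D Jx (y, t))"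
    by (rule ip_Cauchy_Schwarz[OF one slice_sqi[OF c(1)]])
  also have "nsq ?X (\<lambda>_. 1::real) = x"
    using lebesgue_ftc[OF x(1), of "\<lambda>y. y" "\<lambda>_. 1"] by (simp add: nsq_def ip_def)
  also have "nsq ?X (\<lambda>y. D Jx (y, t)) = integral {0..x} (\<lambda>y. (D Jx (y, t))\<^sup>2)"
    by (simp add: nsq_real HK)
  also have "\<dots> \<le> integral {0..L} (\<lambda>y. (D Jx (y, t))\<^sup>2)"
    using x continuous_on_subset[OF c(2)]
    by (intro integral_subset_le integrable_continuous_interval) auto
  also have "x * integral {0..L} (\<lambda>y. (D Jx (y, t))\<^sup>2) \<le> L * integral {0..L} (\<lambda>y. (D Jx (y, t))\<^sup>2)"
    using x by (intro mult_right_mono integral_nonneg integrable_continuous_interval continuous_on_subset[OF c(2)]) auto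
  finally show ?thesis using x by (simp add: HK mult_left_mono)
qed

text \<open>The \<open>x\<close>-derivative of \<open>J0 Jx\<close> integrates to zero over every
  slice because \<open>J0\<close> vanishes at both ends.\<close>

lemma nice_Jx_eq:
  assumes D: "nice L D" and L: "0 \<le> L"
  shows "nsq (lebesgue_on (Omega L T)) (D Jx) = - ip (lebesgue_on (Omega L T)) (D J0) (D Jxx)"
proof -
  let ?M = "lebesgue_on (Omega L T)"
  have "(LINT p|?M. D Jx p * D Jx p + D J0 p * D Jxx p) =
      (LINT t|lebesgue_on {0<..<T}. D J0 (L, t) * D Jx (L, t) - D J0 (0, t) * D Jx (0, t))"
  proof (rule integral_Omega_dx[OF L, where H="\<lambda>p. D J0 p * D Jx p"])
    show "((\<lambda>y. D J0 (y, t) * D Jx (y, t)) has_real_derivative D Jx (x, t) * D Jx (x, t) + D J0 (x, t) * D Jxx (x, t)) (at x)" for x t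
      by (rule DERIV_cong[OF DERIV_mult[OF niceD(3)[OF D] niceD(4)[OF D]]]) simp
  qed (intro continuous_intros niceD[OF D])
  also have "\<dots> = 0" by (simp add: niceD(7,8)[OF D])
  finally show ?thesis
    using sqi_inner_integrable[OF nice_sqi[OF D] nice_sqi[OF D], of T Jx Jx]
      sqi_inner_integrable[OF nice_sqi[OF D] nice_sqi[OF D], of T J0 Jxx]
    by (simp add: nsq_def ip_def)
qed

text \<open>\<open>Jx\<close> has no boundary values to start from, so the second-order bounds are
  indirect: with the norms \<open>a\<close>, \<open>b\<close>, \<open>d\<close> of
  \<open>J0\<close>, \<open>Jx\<close>, \<open>Jxx\<close>, the inequalities
  \<open>a \<le> L b\<close> and \<open>b^2 \<le> a d\<close> combine to
  \<open>b \<le> L d\<close>.\<close>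

lemma nice_Poincare:
  assumes D: "nice L D" and L: "0 \<le> L"
  shows "nsq (lebesgue_on (Omega L T)) (D J0) \<le> L\<^sup>2 * nsq (lebesgue_on (Omega L T)) (D Jx)"
    "nsq (lebesgue_on (Omega L T)) (D J0) \<le> L ^ 4 * nsq (lebesgue_on (Omega L T)) (D Jxx)"
    "nsq (lebesgue_on (Omega L T)) (D Jx) \<le> L\<^sup>2 * nsq (lebesgue_on (Omega L T)) (D Jxx)"
proof -
  let ?M = "lebesgue_on (Omega L T)" and ?X = "lebesgue_on {0<..<L}" and ?Y = "lebesgue_on {0<..<T}"
  have c: "continuous_on UNIV (\<lambda>p. (D i p)\<^sup>2)" for i by (intro continuous_intros niceD[OF D])
  define G where "G t = (LINT y|?X. (D Jx (y, t))\<^sup>2)" for t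
  have inner: "(LINT x|?X. (D J0 (x, t))\<^sup>2) \<le> L\<^sup>2 * G t" for t
  proof -
    have "(LINT x|?X. (D J0 (x, t))\<^sup>2) \<le> (LINT x|?X. L * G t)"
    proof (rule integral_mono)
      show "integrable ?X (\<lambda>x. (D J0 (x, t))\<^sup>2)"
        using slice_sqi[OF niceD(1)[OF D], of L J0 t] by (simp add: sqi_def power2_eq_square)
      show "integrable ?X (\<lambda>x. L * G t)" by (rule integrable_const_interval)
      show "(D J0 (x, t))\<^sup>2 \<le> L * G t" if "x \<in> space ?X" for x
        unfolding G_def using that by (intro nice_pointwise[OF D]) (auto simp: space_restrict_space)
    qed
    also have "\<dots> = L * (L * G t) - 0 * (L * G t)"
      by (rule lebesgue_ftc[OF L]) (auto intro!: derivative_eq_intros)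
    finally show ?thesis by (simp add: power2_eq_square mult.assoc)
  qed
  have "nsq ?M (D J0) = (LINT t|?Y. LINT x|?X. (D J0 (x, t))\<^sup>2)"
    unfolding nsq_real by (rule fubini_continuous[OF c])
  also have "\<dots> \<le> (LINT t|?Y. L\<^sup>2 * G t)"
    using inner fubini_continuous(4)[OF c[of J0], where T=T and L=L] fubini_continuous(4)[OF c[of Jx], where T=T and L=L]
    by (intro integral_mono) (auto simp: G_def)
  also have "\<dots> = L\<^sup>2 * nsq ?M (D Jx)"
    unfolding nsq_real G_def by (simp add: fubini_continuous(3)[OF c[of Jx]])
  finally show 1: "nsq ?M (D J0) \<le> L\<^sup>2 * nsq ?M (D Jx)" .
  define a b d where "a = sqrt (nsq ?M (D J0))" and "b = sqrt (nsq ?M (D Jx))" and "d = sqrt (nsq ?M (D Jxx))"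
  have nn: "a \<ge> 0" "b \<ge> 0" "d \<ge> 0" by (auto simp: a_def b_def d_def nsq_nonneg)
  have sq: "nsq ?M (D J0) = a\<^sup>2" "nsq ?M (D Jx) = b\<^sup>2" "nsq ?M (D Jxx) = d\<^sup>2"
    by (auto simp: a_def b_def d_def nsq_nonneg)
  have "a \<le> L * b"
    using 1 L nn unfolding sq by (intro power2_le_imp_le[of a "L * b"]) (auto simp: power_mult_distrib)
  moreover have "b\<^sup>2 \<le> a * d"
    using nice_Jx_eq[OF D L, of T] ip_abs_le[OF nice_sqi[OF D] nice_sqi[OF D], of T J0 Jxx]
    by (auto simp: sq(2)[symmetric] a_def d_def abs_le_iff)
  ultimately have "b * b \<le> L * d * b"
    using mult_right_mono[of a "L * b" d] nn by (simp add: power2_eq_square mult_ac)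
  then have b: "b \<le> L * d" using nn L by (cases "b = 0") auto
  then show "nsq ?M (D Jx) \<le> L\<^sup>2 * nsq ?M (D Jxx)"
    unfolding sq using power_mono[OF b nn(2), of 2] by (simp add: power_mult_distrib)
  have "a \<le> L * (L * d)" using \<open>a \<le> L * b\<close> mult_left_mono[OF b L] by simp
  then show "nsq ?M (D J0) \<le> L ^ 4 * nsq ?M (D Jxx)"
    unfolding sq using power_mono[of a "L * (L * d)" 2] nn by (simp add: power_mult_distrib flip: power_add mult.assoc)
qed

text \<open>The left side is the time integral of twice the slice integral of \<open>Jx Jxt\<close>.
  Integration by parts in \<open>x\<close> moves one derivative; the boundary terms vanish since
  \<open>Jt\<close> is zero on the lateral sides.\<close>

lemma nice_energy_slice:
  assumes D: "nice L D" and L: "0 \<le> L" and t: "0 \<le> t"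
  shows "(LINT x|lebesgue_on {0<..<L}. (D Jx (x, t))\<^sup>2 - (D Jx (x, 0))\<^sup>2) =
    - 2 * (LINT p|lebesgue_on (Omega L t). D Jxx p * D Jt p)"
proof -
  let ?M = "lebesgue_on (Omega L t)" and ?X = "lebesgue_on {0<..<L}"
  have i1: "integrable ?X (\<lambda>_. 1::real)"
    by (rule integrable_const_interval)
  have "(LINT p|?M. 1 * (2 * D Jx p * D Jxt p)) = (LINT x|?X. 1 * ((D Jx (x, t))\<^sup>2 - (D Jx (x, 0))\<^sup>2))"
  proof (rule integral_Omega_dt[OF i1 t, where H="\<lambda>p. (D Jx p)\<^sup>2"])
    show "((\<lambda>s. (D Jx (x, s))\<^sup>2) has_real_derivative 2 * D Jx (x, t) * D Jxt (x, t)) (at t)" for x t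
      by (rule DERIV_cong[OF DERIV_power[OF niceD(5)[OF D]]]) simp
  qed (intro continuous_intros niceD[OF D])
  moreover have "(LINT p|?M. D Jxx p * D Jt p + D Jx p * D Jxt p) =
     (LINT s|lebesgue_on {0<..<t}. D Jx (L, s) * D Jt (L, s) - D Jx (0, s) * D Jt (0, s))"
  proof (rule integral_Omega_dx[OF L, where H="\<lambda>p. D Jx p * D Jt p"])
    show "((\<lambda>y. D Jx (y, t) * D Jt (y, t)) has_real_derivative D Jxx (x, t) * D Jt (x, t) + D Jx (x, t) * D Jxt (x, t)) (at x)" for x t
      by (rule DERIV_cong[OF DERIV_mult[OF niceD(4)[OF D] niceD(6)[OF D]]]) simp
  qed (intro continuous_intros niceD[OF D])
  moreover have "integrable ?M (\<lambda>p. D Jxx p * D Jt p)" "integrable ?M (\<lambda>p. D Jx p * D Jxt p)"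
    by (intro fubini_continuous continuous_intros niceD[OF D])+
  ultimately show ?thesis by (simp add: nice_Jt_0[OF D] mult.assoc)
qed

text \<open>The slice integral \<open>G\<close> of the square of \<open>Jx\<close> vanishes at one
  end of the time interval and changes by at most twice \<open>\<bar>I\<bar>\<close>, which is at
  most \<open>Q\<close>. Starting from \<open>T\<close> costs two such changes, hence
  \<open>2 Q\<close>; \<open>nice_pointwise\<close> adds the factor \<open>L\<close>.\<close>

lemma nice_sup:
  assumes D: "nice L D" and L: "0 \<le> L" and p: "0 \<le> x" "x \<le> L" "0 \<le> t" "t \<le> T"
    and z: "(\<forall>x. D J0 (x, 0) = 0) \<or> (\<forall>x. D J0 (x, T) = 0)"
  shows "(D J0 (x, t))\<^sup>2 \<le> 2 * L * (nsq (lebesgue_on (Omega L T)) (D Jt) + nsq (lebesgue_on (Omega L T)) (D Jxx))"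
proof -
  let ?M = "lebesgue_on (Omega L T)" and ?X = "lebesgue_on {0<..<L}"
  define Q where "Q = nsq ?M (D Jt) + nsq ?M (D Jxx)"
  define I where "I s = (LINT p|lebesgue_on (Omega L s). D Jxx p * D Jt p)" for s
  define G where "G s = (LINT y|?X. (D Jx (y, s))\<^sup>2)" for s
  have iG: "integrable ?X (\<lambda>x. (D Jx (x, s))\<^sup>2)" for s
    using slice_sqi[OF niceD(1)[OF D], of L Jx s] by (simp add: sqi_def power2_eq_square)
  have GI: "G s - G 0 = - 2 * I s" if "0 \<le> s" for s
    using nice_energy_slice[OF D L that] iG by (simp add: G_def I_def)
  have Ibd: "\<bar>I s\<bar> \<le> Q / 2" if s: "0 \<le> s" "s \<le> T" for s
  proof -
    have c: "continuous_on UNIV (\<lambda>p. ((D Jt p)\<^sup>2 + (D Jxx p)\<^sup>2) / 2)" "continuous_on UNIV (\<lambda>p. D Jxx p * D Jt p)"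
      by (intro continuous_intros niceD[OF D]; simp)+
    have sub: "Omega L s \<subseteq> Omega L T" using s by (auto simp: Omega_def)
    have "\<bar>I s\<bar> \<le> (LINT p|lebesgue_on (Omega L s). \<bar>D Jxx p * D Jt p\<bar>)"
      unfolding I_def by (rule integral_abs_bound)
    also have "\<dots> \<le> (LINT p|lebesgue_on (Omega L s). ((D Jt p)\<^sup>2 + (D Jxx p)\<^sup>2) / 2)"
    proof (rule integral_mono)
      show "\<bar>D Jxx p * D Jt p\<bar> \<le> ((D Jt p)\<^sup>2 + (D Jxx p)\<^sup>2) / 2" for p
        using zero_le_power2[of "D Jxx p - D Jt p"] zero_le_power2[of "D Jxx p + D Jt p"]
        unfolding power2_diff power2_sum by (auto simp: abs_le_iff)
    qed (intro fubini_continuous c integrable_abs)+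
    also have "\<dots> = integral (Omega L s) (\<lambda>p. ((D Jt p)\<^sup>2 + (D Jxx p)\<^sup>2) / 2)"
      by (intro lebesgue_integral_eq_integral fubini_continuous c sets_Omega)
    also have "\<dots> \<le> integral (Omega L T) (\<lambda>p. ((D Jt p)\<^sup>2 + (D Jxx p)\<^sup>2) / 2)"
      using fubini_continuous(1)[OF c(1)] sets_Omega
      by (intro integral_subset_le sub integrable_on_lebesgue_on) auto
    also have "\<dots> = (LINT p|?M. ((D Jt p)\<^sup>2 + (D Jxx p)\<^sup>2) / 2)"
      by (intro lebesgue_integral_eq_integral[symmetric] fubini_continuous c sets_Omega)
    also have "\<dots> = Q / 2"
      using fubini_continuous(1)[of "\<lambda>p. (D Jt p)\<^sup>2" L T] fubini_continuous(1)[of "\<lambda>p. (D Jxx p)\<^sup>2" L T]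
      by (simp add: Q_def nsq_real continuous_on_power niceD[OF D])
    finally show ?thesis .
  qed
  have T: "0 \<le> T" using p by simp
  have Gz: "G s = 0" if "\<forall>x. D J0 (x, s) = 0" for s
  proof -
    have "D Jx (x, s) = 0" for x
      using DERIV_unique[OF niceD(3)[OF D, of s x]] that by simp
    then show ?thesis by (simp add: G_def)
  qed
  have "G t \<le> 2 * Q"
    using z
  proof
    assume "\<forall>x. D J0 (x, 0) = 0"
    then have "G t = - 2 * I t" using GI[OF p(3)] Gz by simp
    then show ?thesis using Ibd[OF p(3,4)] by (simp add: abs_le_iff)
  next
    assume "\<forall>x. D J0 (x, T) = 0"
    then have "G t = - 2 * I t + 2 * I T" using GI[OF p(3)] GI[OF T] Gz by simp
    then show ?thesis using Ibd[OF p(3,4)] Ibd[OF T order_refl] by (simp add: abs_le_iff)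
  qed
  then have "L * G t \<le> L * (2 * Q)" using L by (rule mult_left_mono)
  moreover have "(D J0 (x, t))\<^sup>2 \<le> L * G t" unfolding G_def by (rule nice_pointwise[OF D p(1,2)])
  ultimately show ?thesis by (simp add: Q_def mult_ac)
qed

section \<open>Trigonometric expansions\<close>

inductive span_of :: "('i \<Rightarrow> real \<times> real \<Rightarrow> real) \<Rightarrow> (real \<times> real \<Rightarrow> real) \<Rightarrow> bool" for e where
  base: "span_of e (e i)"
| lincomb: "span_of e f \<Longrightarrow> span_of e g \<Longrightarrow> span_of e (\<lambda>p. a * f p + b * g p)"

lemma span_of_cmult: "span_of e f \<Longrightarrow> span_of e (\<lambda>p. c * f p)"
  using span_of.lincomb[of e f f c 0] by simp

text \<open>The cosine is injective on \<open>[0, pi]\<close>. This is the separation of points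
  demanded by Stone-Weierstrass.\<close>

lemma cos_scale_inj:
  assumes "0 < A" "0 \<le> a" "a \<le> A" "0 \<le> b" "b \<le> A" "cos (pi * a / A) = cos (pi * b / A)"
  shows "a = b"
proof -
  have *: "0 \<le> pi * y / A" "pi * y / A \<le> pi" if "0 \<le> y" "y \<le> A" for y
    using mult_left_mono[OF that(2), of pi] that assms(1) by (simp_all add: pos_divide_le_eq)
  have "pi * a / A = pi * b / A"
    by (rule cos_inj_pi[OF *[OF assms(2,3)] *[OF assms(4,5)] assms(6)])
  then show ?thesis using assms(1) by simp
qed

text \<open>The functions that multiply the span of the family into itself form an algebra, so
  the Stone--Weierstrass theorem reduces completeness to the recurrences for
  \<open>cos (\<pi> x / L)\<close> and \<open>cos (\<pi> t / T)\<close>.\<close>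

lemma complete_if_stable:
  fixes e :: "'i \<Rightarrow> real \<times> real \<Rightarrow> real"
  assumes L: "0 < L" "0 < T" and ec: "\<And>i. continuous_on UNIV (e i)"
    and sx: "\<And>i. span_of e (\<lambda>p. cos (pi * fst p / L) * e i p)"
    and st: "\<And>i. span_of e (\<lambda>p. cos (pi * snd p / T) * e i p)"
    and nz: "\<And>p. p \<in> Omega L T \<Longrightarrow> e i0 p \<noteq> 0"
    and g: "sqi (lebesgue_on (Omega L T)) g"
    and orth: "\<And>i. ip (lebesgue_on (Omega L T)) g (e i) = 0"
  shows "AE p in lebesgue_on (Omega L T). g p = 0"
proof -
  let ?M = "lebesgue_on (Omega L T)" and ?K = "cbox (0,0) (L,T)"
  have csqi: "sqi ?M h" if "continuous_on UNIV h" for h :: "real \<times> real \<Rightarrow> real"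
    unfolding Omega_eq_box by (rule sqi_continuous[OF continuous_on_subset[OF that]]) simp
  have W: "continuous_on UNIV f \<and> ip ?M g f = 0" if "span_of e f" for f
    using that
  proof induction
    case (base i)
    then show ?case using ec orth by simp
  next
    case (lincomb f1 f2 a b)
    then show ?case
      by (auto intro!: continuous_intros simp: ip_add_right sqi_cmult csqi g ip_cmult_right)
  qed
  have K: "0 \<le> fst x \<and> fst x \<le> L \<and> 0 \<le> snd x \<and> snd x \<le> T" if "x \<in> ?K" for x
    using that by (cases x) (simp add: cbox_Pair_eq)
  define P where "P h \<longleftrightarrow> continuous_on UNIV h \<and> (\<forall>f. span_of e f \<longrightarrow> span_of e (\<lambda>p. h p * f p))"
    for h :: "real \<times> real \<Rightarrow> real"
  have stab: "P h" if h: "continuous_on UNIV h" "\<And>i. span_of e (\<lambda>p. h p * e i p)" for h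
    unfolding P_def
  proof (intro conjI allI impI)
    fix f assume "span_of e f"
    then show "span_of e (\<lambda>p. h p * f p)"
    proof induction
      case (lincomb f1 f2 a b)
      from span_of.lincomb[OF lincomb.IH, of a b] show ?case by (simp add: algebra_simps)
    qed (rule h(2))
  qed (rule h(1))
  have Pc1: "P (\<lambda>p. cos (pi * fst p / L))" by (rule stab[OF _ sx]) (intro continuous_intros, use L in auto)
  have Pc2: "P (\<lambda>p. cos (pi * snd p / T))" by (rule stab[OF _ st]) (intro continuous_intros, use L in auto)
  \<comment> \<open>A multiplier times \<open>e i0\<close> lies in the span, so \<open>g\<close>
    times \<open>e i0\<close> is orthogonal to a dense algebra. Since \<open>e i0\<close> has no
    zero in the open rectangle, it can be divided out afterwards.\<close>
  have "AE p in ?M. g p * e i0 p = 0"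
  proof (rule AE_0_if_orthogonal_dense[where P=P and K="?K"])
    show "Omega L T \<in> sets lebesgue" by (rule sets_Omega)
    show "integrable ?M (\<lambda>p. g p * e i0 p)"
      using sqi_inner_integrable[OF g csqi[OF ec]] by simp
    show "Omega L T \<subseteq> ?K" by (auto simp: Omega_def cbox_Pair_eq)
    show "integrable ?M (\<lambda>p. g p * e i0 p * h p) \<and> (LINT p|?M. g p * e i0 p * h p) = 0" if "P h" for h
    proof -
      have "span_of e (\<lambda>p. h p * e i0 p)" using that span_of.base[of e i0] by (simp add: P_def)
      from W[OF this] have *: "continuous_on UNIV (\<lambda>p. h p * e i0 p)" "ip ?M g (\<lambda>p. h p * e i0 p) = 0" by auto
      show ?thesis using sqi_inner_integrable[OF g csqi[OF *(1)]] *(2) by (simp add: ip_def mult_ac)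
    qed
    fix h :: "real \<times> real \<Rightarrow> real" and r :: real
    assume h: "continuous_on ?K h" "r > 0"
    show "\<exists>p. P p \<and> (\<forall>x\<in>?K. \<bar>h x - p x\<bar> < r)"
    proof (rule Stone_Weierstrass_HOL[OF compact_cbox])
      show "P (\<lambda>x. c)" for c using span_of_cmult[of e _ c] by (simp add: P_def)
      show "continuous_on ?K f" if "P f" for f using that continuous_on_subset by (auto simp: P_def)
      show "P (\<lambda>x. f x + k x)" if "P f \<and> P k" for f k
      proof -
        have "span_of e (\<lambda>p. (f p + k p) * u p)" if u: "span_of e u" for u
        proof -
          have "span_of e (\<lambda>p. f p * u p)" "span_of e (\<lambda>p. k p * u p)"
            using \<open>P f \<and> P k\<close> u by (auto simp: P_def)
          from span_of.lincomb[OF this, of 1 1] show ?thesis by (simp add: distrib_right)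
        qed
        then show ?thesis using that by (auto simp: P_def intro!: continuous_intros)
      qed
      show "P (\<lambda>x. f x * k x)" if "P f \<and> P k" for f k
        using that by (auto simp: P_def mult.assoc intro!: continuous_intros)
      show "\<exists>f. P f \<and> f x \<noteq> f y" if "x \<in> ?K \<and> y \<in> ?K \<and> x \<noteq> y" for x y
      proof (cases "fst x = fst y")
        case False
        then have "cos (pi * fst x / L) \<noteq> cos (pi * fst y / L)"
          using cos_scale_inj[of L "fst x" "fst y"] that K[of x] K[of y] L by blast
        then show ?thesis using Pc1 by blast
      next
        case True
        then have ne: "snd x \<noteq> snd y" using that by (auto simp: prod_eq_iff)
        then have "cos (pi * snd x / T) \<noteq> cos (pi * snd y / T)"
          using cos_scale_inj[of T "snd x" "snd y"] that K[of x] K[of y] L by blast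
        then show ?thesis using Pc2 by blast
      qed
    qed (use h in auto)
  qed
  with AE_space show ?thesis
  proof eventually_elim
    case (elim p)
    then show ?case using nz[of p] by (simp add: space_restrict_space)
  qed
qed

lemma integral_cos_int:
  assumes A: "A > 0" and c: "c = of_int k * pi / A"
  shows "(LINT t|lebesgue_on {0<..<A}. cos (c * t)) = (if k = 0 then A else 0)"
proof (cases "k = 0")
  case True
  have "(LINT t|lebesgue_on {0<..<A}. cos (c * t)) = A - 0"
    by (rule lebesgue_ftc) (use A True c in \<open>auto intro!: continuous_intros derivative_eq_intros\<close>)
  then show ?thesis using True by simp
next
  case False
  then have c0: "c \<noteq> 0" using A c by simp
  have "(LINT t|lebesgue_on {0<..<A}. cos (c * t)) = sin (c * A) / c - sin (c * 0) / c"
    by (rule lebesgue_ftc) (use A c0 in \<open>auto intro!: continuous_intros derivative_eq_intros\<close>)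
  moreover have "sin (c * A) = 0" using A c by (auto simp: sin_zero_iff_int2)
  ultimately show ?thesis using False by simp
qed

text \<open>Product-to-sum formulas lead to the frequencies \<open>a - b\<close> and
  \<open>a + b\<close>. Asking integrality of these two instead of \<open>a\<close> and
  \<open>b\<close> covers the half-integer frequencies; nonzero \<open>l\<close> removes the second
  term.\<close>

lemma integral_trig_prod:
  assumes A: "A > 0" and a: "a - b = of_int k * pi / A" "a + b = of_int l * pi / A" and l: "l \<noteq> 0"
  shows "(LINT t|lebesgue_on {0<..<A}. cos (a * t) * cos (b * t)) = (if k = 0 then A / 2 else 0)"
    "(LINT t|lebesgue_on {0<..<A}. sin (a * t) * sin (b * t)) = (if k = 0 then A / 2 else 0)"
proof -
  have int: "integrable (lebesgue_on {0<..<A}) (\<lambda>t. cos (c * t))" for c :: real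
    unfolding interval_eq_box by (intro sqi_integrable finite_measure_box sqi_continuous continuous_intros)
  have "cos (a * t) * cos (b * t) = (cos ((a - b) * t) + cos ((a + b) * t)) / 2" for t
    by (simp add: cos_add cos_diff algebra_simps)
  moreover have "(LINT t|lebesgue_on {0<..<A}. (cos ((a - b) * t) + cos ((a + b) * t)) / 2) = (if k = 0 then A / 2 else 0)"
    using integral_cos_int[OF A a(1)] integral_cos_int[OF A a(2)] l int by simp
  ultimately show "(LINT t|lebesgue_on {0<..<A}. cos (a * t) * cos (b * t)) = (if k = 0 then A / 2 else 0)" by presburger
  have "sin (a * t) * sin (b * t) = (cos ((a - b) * t) - cos ((a + b) * t)) / 2" for t
    by (simp add: cos_add cos_diff algebra_simps)
  moreover have "(LINT t|lebesgue_on {0<..<A}. (cos ((a - b) * t) - cos ((a + b) * t)) / 2) = (if k = 0 then A / 2 else 0)"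
    using integral_cos_int[OF A a(1)] integral_cos_int[OF A a(2)] l int by simp
  ultimately show "(LINT t|lebesgue_on {0<..<A}. sin (a * t) * sin (b * t)) = (if k = 0 then A / 2 else 0)" by presburger
qed

lemma integral_Omega_prod:
  assumes "continuous_on UNIV a" "continuous_on UNIV b"
  shows "(LINT p|lebesgue_on (Omega L T). a (fst p) * b (snd p)) =
    (LINT x|lebesgue_on {0<..<L}. a x) * (LINT t|lebesgue_on {0<..<T}. b t :: real)"
proof -
  have "integrable (lebesgue_on {0<..<L}) a"
    unfolding interval_eq_box
    by (intro sqi_integrable finite_measure_box sqi_continuous continuous_on_subset[OF assms(1)]) simp
  moreover have "continuous_on UNIV (\<lambda>p::real\<times>real. b (snd p))"
    by (intro continuous_on_compose2[OF assms(2)] continuous_intros) auto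
  ultimately show ?thesis using fubini_fst_mult(2)[of L a "\<lambda>p. b (snd p)" T] by simp
qed

section \<open>The two trigonometric families and their expansions\<close>

locale rectangle =
  fixes L T :: real
  assumes L: "L > 0" and T: "T > 0"
begin

abbreviation "M \<equiv> lebesgue_on (Omega L T)"

text \<open>Spatial sines vanish at 0 and \<open>L\<close>; the shift by 1 skips the zero mode. The
  shift by \<open>1 / 2\<close> in \<open>mu\<close> makes the cosine vanish at \<open>T\<close>
  while the sine vanishes at 0.\<close>

definition lam :: "nat \<Rightarrow> real" where "lam n = (real n + 1) * pi / L"
definition mu :: "nat \<Rightarrow> real" where "mu m = (real m + 1 / 2) * pi / T"

text \<open>An index \<open>(m, n)\<close> pairs time mode \<open>m\<close> with space mode
  \<open>n\<close>. The family \<open>jC\<close> vanishes at time \<open>T\<close> and expands test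
  functions; \<open>jZ\<close> vanishes at time 0 and expands \<open>u - w\<close>.\<close>

fun jC :: "nat \<times> nat \<Rightarrow> jet \<Rightarrow> real \<times> real \<Rightarrow> real" where
  "jC (m, n) J0 p = sin (lam n * fst p) * cos (mu m * snd p)"
| "jC (m, n) Jt p = sin (lam n * fst p) * (- mu m * sin (mu m * snd p))"
| "jC (m, n) Jx p = lam n * cos (lam n * fst p) * cos (mu m * snd p)"
| "jC (m, n) Jxx p = - (lam n)\<^sup>2 * sin (lam n * fst p) * cos (mu m * snd p)"
| "jC (m, n) Jxt p = lam n * cos (lam n * fst p) * (- mu m * sin (mu m * snd p))"

fun jZ :: "nat \<times> nat \<Rightarrow> jet \<Rightarrow> real \<times> real \<Rightarrow> real" where
  "jZ (m, n) J0 p = sin (lam n * fst p) * sin (mu m * snd p)"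
| "jZ (m, n) Jt p = sin (lam n * fst p) * (mu m * cos (mu m * snd p))"
| "jZ (m, n) Jx p = lam n * cos (lam n * fst p) * sin (mu m * snd p)"
| "jZ (m, n) Jxx p = - (lam n)\<^sup>2 * sin (lam n * fst p) * sin (mu m * snd p)"
| "jZ (m, n) Jxt p = lam n * cos (lam n * fst p) * (mu m * cos (mu m * snd p))"

lemma lam_pos: "lam n > 0" and mu_pos: "mu m > 0"
  using L T by (auto simp: lam_def mu_def add_pos_nonneg intro!: divide_pos_pos mult_pos_pos)

lemma sin_lam_L: "sin (lam n * L) = 0"
proof -
  have "lam n * L = of_int (int n + 1) * pi" using L by (simp add: lam_def)
  then show ?thesis unfolding sin_zero_iff_int2 by blast
qed

lemma cos_mu_T: "cos (mu m * T) = 0"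
proof -
  have "mu m * T = real m * pi + pi / 2" using T by (simp add: mu_def field_simps)
  then show ?thesis by (simp add: cos_add)
qed

lemma nice_jC: "nice L (jC i)" and nice_jZ: "nice L (jZ i)"
proof -
  obtain m n where i: "i = (m, n)" by (cases i)
  have "continuous_on UNIV (jC (m, n) j)" "continuous_on UNIV (jZ (m, n) j)" for j
    by (cases j; auto simp: fun_eq_iff intro!: continuous_intros cong: continuous_on_cong)+
  then show "nice L (jC i)" "nice L (jZ i)"
    unfolding nice_def i
    by (auto simp: sin_lam_L power2_eq_square intro!: derivative_eq_intros)
qed

lemma jC_T: "jC i J0 (x, T) = 0" and jZ_0: "jZ i J0 (x, 0) = 0"
  by (cases i; simp add: cos_mu_T)+

text \<open>Time differentiation exchanges the families up to a factor and \<open>Jxx\<close> acts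
  diagonally, so differential equations become relations between coefficients.\<close>

lemma jC_Jt: "jC i Jt p = - mu (fst i) * jZ i J0 p"
  and jZ_Jt: "jZ i Jt p = mu (fst i) * jC i J0 p"
  and jC_Jxx: "jC i Jxx p = - (lam (snd i))\<^sup>2 * jC i J0 p"
  and jZ_Jxx: "jZ i Jxx p = - (lam (snd i))\<^sup>2 * jZ i J0 p"
  by (cases i; simp)+

lemma sqi_jC: "sqi M (jC i j)" and sqi_jZ: "sqi M (jZ i j)"
  by (rule nice_sqi nice_jC nice_jZ)+

text \<open>Fubini factors the inner product into \<open>L / 2\<close> times \<open>T / 2\<close> on
  the diagonal. The sums of frequencies have index \<open>n + n' + 2\<close> and
  \<open>m + m' + 1\<close>, never zero.\<close>

lemma ip_jC: "ip M (jC i J0) (jC j J0) = (if i = j then L * T / 4 else 0)" (is ?C)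
  and ip_jZ: "ip M (jZ i J0) (jZ j J0) = (if i = j then L * T / 4 else 0)" (is ?Z)
proof -
  obtain m n m' n' where i: "i = (m, n)" and j: "j = (m', n')" by (cases i, cases j)
  have X: "(LINT x|lebesgue_on {0<..<L}. sin (lam n * x) * sin (lam n' * x)) = (if n = n' then L / 2 else 0)"
    using integral_trig_prod(2)[OF L, of "lam n" "lam n'" "int n - int n'" "int n + int n' + 2"]
    by (auto simp: lam_def diff_divide_distrib add_divide_distrib algebra_simps)
  have Y: "(LINT t|lebesgue_on {0<..<T}. cos (mu m * t) * cos (mu m' * t)) = (if m = m' then T / 2 else 0)"
    "(LINT t|lebesgue_on {0<..<T}. sin (mu m * t) * sin (mu m' * t)) = (if m = m' then T / 2 else 0)"
    using integral_trig_prod[OF T, of "mu m" "mu m'" "int m - int m'" "int m + int m' + 1"]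
    by (auto simp: mu_def diff_divide_distrib add_divide_distrib algebra_simps)
  have c: "continuous_on UNIV (\<lambda>x. sin (lam n * x) * sin (lam n' * x))"
    "continuous_on UNIV (\<lambda>t. cos (mu m * t) * cos (mu m' * t))"
    "continuous_on UNIV (\<lambda>t. sin (mu m * t) * sin (mu m' * t))"
    by (intro continuous_intros)+
  show ?C using integral_Omega_prod[OF c(1,2), of L T] X Y(1) by (simp add: ip_def i j mult_ac)
  show ?Z using integral_Omega_prod[OF c(1,3), of L T] X Y(2) by (simp add: ip_def i j mult_ac)
qed

text \<open>For \<open>n = 0\<close> the lower neighbour has frequency zero; its sine vanishes, so
  the term is dropped.\<close>

lemma cos_sin_lam: "cos (pi * x / L) * sin (lam n * x) =
    (sin (lam (Suc n) * x) + (if n = 0 then 0 else sin (lam (n - 1) * x))) / 2"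
proof -
  have 1: "sin (a + b) + sin (a - b) = 2 * (cos b * sin a)" for a b :: real by (simp add: sin_add sin_diff)
  have "lam (Suc n) * x = lam n * x + pi * x / L"
    by (simp add: lam_def diff_divide_distrib add_divide_distrib algebra_simps)
  moreover have "(if n = 0 then 0 else sin (lam (n - 1) * x)) = sin (lam n * x - pi * x / L)"
    by (cases n) (simp_all add: lam_def diff_divide_distrib add_divide_distrib algebra_simps)
  ultimately show ?thesis using 1[of "lam n * x" "pi * x / L"] by simp
qed

text \<open>Truncated subtraction is harmless: for \<open>m = 0\<close> the lower frequency
  \<open>mu 0 - pi / T\<close> equals \<open>- mu 0\<close>, and the cosine is even.\<close>

lemma cos_cos_mu: "cos (pi * t / T) * cos (mu m * t) =
    (cos (mu (Suc m) * t) + cos (mu (m - 1) * t)) / 2"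
proof -
  have 1: "cos (a + b) + cos (a - b) = 2 * (cos b * cos a)" for a b :: real by (simp add: cos_add cos_diff)
  have "mu (Suc m) * t = mu m * t + pi * t / T" by (simp add: mu_def diff_divide_distrib add_divide_distrib algebra_simps)
  moreover have "cos (mu (m - 1) * t) = cos (mu m * t - pi * t / T)"
  proof (cases m)
    case 0
    have "mu m * t - pi * t / T = - (mu (m - 1) * t)" using 0 T by (simp add: mu_def field_simps)
    then show ?thesis by simp
  qed (simp add: mu_def diff_divide_distrib add_divide_distrib algebra_simps)
  ultimately show ?thesis using 1[of "mu m * t" "pi * t / T"] by simp
qed

text \<open>The same folding at \<open>m = 0\<close>; the sine is odd, hence the sign.\<close>

lemma cos_sin_mu: "cos (pi * t / T) * sin (mu m * t) =
    (sin (mu (Suc m) * t) + (if m = 0 then -1 else 1) * sin (mu (m - 1) * t)) / 2"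
proof -
  have 1: "sin (a + b) + sin (a - b) = 2 * (cos b * sin a)" for a b :: real by (simp add: sin_add sin_diff)
  have "mu (Suc m) * t = mu m * t + pi * t / T" by (simp add: mu_def diff_divide_distrib add_divide_distrib algebra_simps)
  moreover have "(if m = 0 then -1 else 1) * sin (mu (m - 1) * t) = sin (mu m * t - pi * t / T)"
  proof (cases m)
    case 0
    have *: "mu m * t - pi * t / T = - (mu (m - 1) * t)" using 0 T by (simp add: mu_def field_simps)
    show ?thesis unfolding * using 0 by simp
  qed (simp add: mu_def diff_divide_distrib add_divide_distrib algebra_simps)
  ultimately show ?thesis using 1[of "mu m * t" "pi * t / T"] by simp
qed

text \<open>The recurrences are the stability hypotheses. The member without zeros is the lowest
  mode, whose arguments stay in \<open>(0, pi)\<close> and \<open>(0, pi / 2)\<close> on the open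
  rectangle.\<close>

lemma complete_jC:
  assumes "sqi M g" "\<And>i. ip M g (jC i J0) = 0"
  shows "AE p in M. g p = 0"
proof (rule complete_if_stable[OF L T, where e="\<lambda>i. jC i J0" and ?i0.0="(0,0)"])
  have lc: "span_of (\<lambda>i. jC i J0) (\<lambda>p. a * jC j J0 p + b * jC k J0 p)" for a b j k
    by (intro span_of.lincomb span_of.base)
  show "span_of (\<lambda>i. jC i J0) (\<lambda>p. cos (pi * fst p / L) * jC i J0 p)" for i
  proof -
    obtain m n where i: "i = (m, n)" by (cases i)
    have "cos (pi * fst p / L) * jC i J0 p =
      1 / 2 * jC (m, Suc n) J0 p + (if n = 0 then 0 else 1 / 2) * jC (m, n - 1) J0 p" for p
    proof -
      have "cos (pi * fst p / L) * jC i J0 p = (cos (pi * fst p / L) * sin (lam n * fst p)) * cos (mu m * snd p)"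
        by (simp add: i)
      then show ?thesis unfolding cos_sin_lam by (cases "n = 0") (simp_all add: field_simps)
    qed
    then show ?thesis using lc[of "1/2" "(m, Suc n)" "if n = 0 then 0 else 1/2" "(m, n - 1)"] by simp
  qed
  show "span_of (\<lambda>i. jC i J0) (\<lambda>p. cos (pi * snd p / T) * jC i J0 p)" for i
  proof -
    obtain m n where i: "i = (m, n)" by (cases i)
    have "cos (pi * snd p / T) * jC i J0 p = 1 / 2 * jC (Suc m, n) J0 p + 1 / 2 * jC (m - 1, n) J0 p" for p
    proof -
      have "cos (pi * snd p / T) * jC i J0 p = sin (lam n * fst p) * (cos (pi * snd p / T) * cos (mu m * snd p))"
        by (simp add: i)
      then show ?thesis unfolding cos_cos_mu by (simp add: algebra_simps)
    qed
    then show ?thesis using lc[of "1/2" "(Suc m, n)" "1/2" "(m - 1, n)"] by simp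
  qed
  show "jC (0, 0) J0 p \<noteq> 0" if "p \<in> Omega L T" for p
  proof -
    have "0 < sin (lam 0 * fst p)" "0 < cos (mu 0 * snd p)"
      using that L T by (auto simp: Omega_def lam_def mu_def field_simps intro!: sin_gt_zero cos_gt_zero)
    then show ?thesis by simp
  qed
qed (simp_all add: assms niceD(1)[OF nice_jC])

lemma complete_jZ:
  assumes "sqi M g" "\<And>i. ip M g (jZ i J0) = 0"
  shows "AE p in M. g p = 0"
proof (rule complete_if_stable[OF L T, where e="\<lambda>i. jZ i J0" and ?i0.0="(0,0)"])
  have lc: "span_of (\<lambda>i. jZ i J0) (\<lambda>p. a * jZ j J0 p + b * jZ k J0 p)" for a b j k
    by (intro span_of.lincomb span_of.base)
  show "span_of (\<lambda>i. jZ i J0) (\<lambda>p. cos (pi * fst p / L) * jZ i J0 p)" for i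
  proof -
    obtain m n where i: "i = (m, n)" by (cases i)
    have "cos (pi * fst p / L) * jZ i J0 p =
      1 / 2 * jZ (m, Suc n) J0 p + (if n = 0 then 0 else 1 / 2) * jZ (m, n - 1) J0 p" for p
    proof -
      have "cos (pi * fst p / L) * jZ i J0 p = (cos (pi * fst p / L) * sin (lam n * fst p)) * sin (mu m * snd p)"
        by (simp add: i)
      then show ?thesis unfolding cos_sin_lam by (cases "n = 0") (simp_all add: field_simps)
    qed
    then show ?thesis using lc[of "1/2" "(m, Suc n)" "if n = 0 then 0 else 1/2" "(m, n - 1)"] by simp
  qed
  show "span_of (\<lambda>i. jZ i J0) (\<lambda>p. cos (pi * snd p / T) * jZ i J0 p)" for i
  proof -
    obtain m n where i: "i = (m, n)" by (cases i)
    have "cos (pi * snd p / T) * jZ i J0 p =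
      1 / 2 * jZ (Suc m, n) J0 p + (if m = 0 then -1 else 1) / 2 * jZ (m - 1, n) J0 p" for p
    proof -
      have "cos (pi * snd p / T) * jZ i J0 p = sin (lam n * fst p) * (cos (pi * snd p / T) * sin (mu m * snd p))"
        by (simp add: i)
      then show ?thesis unfolding cos_sin_mu by (simp add: algebra_simps)
    qed
    then show ?thesis using lc[of "1/2" "(Suc m, n)" "(if m = 0 then -1 else 1)/2" "(m - 1, n)"] by simp
  qed
  show "jZ (0, 0) J0 p \<noteq> 0" if "p \<in> Omega L T" for p
  proof -
    have "0 < sin (lam 0 * fst p)" "0 < sin (mu 0 * snd p)"
      using that L T by (auto simp: Omega_def lam_def mu_def field_simps intro!: sin_gt_zero)
    then show ?thesis by simp
  qed
qed (simp_all add: assms niceD(1)[OF nice_jZ])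

definition A :: "nat \<Rightarrow> (nat \<times> nat) set" where "A N = {..<N} \<times> {..<N}"

definition SC :: "(nat \<times> nat \<Rightarrow> real) \<Rightarrow> nat \<Rightarrow> jet \<Rightarrow> real \<times> real \<Rightarrow> real" where
  "SC c N j p = (\<Sum>i\<in>A N. c i * jC i j p)"

definition SZ :: "(nat \<times> nat \<Rightarrow> real) \<Rightarrow> nat \<Rightarrow> jet \<Rightarrow> real \<times> real \<Rightarrow> real" where
  "SZ c N j p = (\<Sum>i\<in>A N. c i * jZ i j p)"

definition cC :: "(real \<times> real \<Rightarrow> real) \<Rightarrow> nat \<times> nat \<Rightarrow> real" where
  "cC f i = ip M f (jC i J0) / (L * T / 4)"

definition cZ :: "(real \<times> real \<Rightarrow> real) \<Rightarrow> nat \<times> nat \<Rightarrow> real" where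
  "cZ f i = ip M f (jZ i J0) / (L * T / 4)"

lemma nice_SC: "nice L (SC c N)" and nice_SZ: "nice L (SZ c N)"
  using nice_sum[of "A N" L jC c] nice_sum[of "A N" L jZ c] nice_jC nice_jZ
  by (simp_all add: SC_def[abs_def] SZ_def[abs_def])

lemma A_exhaust: "finite (A N)" "A N \<subseteq> A (Suc N)" "(\<Union>N. A N) = UNIV"
proof -
  show "finite (A N)" "A N \<subseteq> A (Suc N)" by (auto simp: A_def)
  have "(m, n) \<in> A (Suc (max m n))" for m n by (auto simp: A_def)
  then show "(\<Union>N. A N) = UNIV" by fastforce
qed

lemma finite_M: "finite_measure M"
  unfolding Omega_eq_box by (rule finite_measure_box)

lemma expansion_C: "sqi M f \<Longrightarrow> L2conv M (\<lambda>N. SC (cC f) N J0) f"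
  unfolding SC_def cC_def
  by (rule L2_orthogonal_expansion[where e="\<lambda>i. jC i J0" and A=A])
    (use L T in \<open>simp_all add: finite_M sqi_jC ip_jC complete_jC A_exhaust\<close>)

lemma expansion_Z: "sqi M f \<Longrightarrow> L2conv M (\<lambda>N. SZ (cZ f) N J0) f"
  unfolding SZ_def cZ_def
  by (rule L2_orthogonal_expansion[where e="\<lambda>i. jZ i J0" and A=A])
    (use L T in \<open>simp_all add: finite_M sqi_jZ ip_jZ complete_jZ A_exhaust\<close>)

text \<open>Termwise differentiation of the partial sums gives partial sums of the other family. The
  hypothesis identifies their coefficients as those of \<open>g\<close>, so the differentiated
  series converges without any decay estimate on \<open>c\<close>.\<close>

lemma SC_Jt_conv:
  assumes "sqi M g" "\<And>i. cZ g i = - mu (fst i) * c i"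
  shows "L2conv M (\<lambda>N. SC c N Jt) g"
proof -
  have "SC c N Jt = SZ (cZ g) N J0" for N
    by (auto simp: SC_def SZ_def assms(2) jC_Jt mult_ac)
  then show ?thesis using expansion_Z[OF assms(1)] by simp
qed

lemma SC_Jxx_conv:
  assumes "sqi M g" "\<And>i. cC g i = - (lam (snd i))\<^sup>2 * c i"
  shows "L2conv M (\<lambda>N. SC c N Jxx) g"
proof -
  have "SC c N Jxx = SC (cC g) N J0" for N
    by (auto simp: SC_def assms(2) jC_Jxx mult_ac)
  then show ?thesis using expansion_C[OF assms(1)] by simp
qed

lemma SZ_Jt_conv:
  assumes "sqi M g" "\<And>i. cC g i = mu (fst i) * c i"
  shows "L2conv M (\<lambda>N. SZ c N Jt) g"
proof -
  have "SZ c N Jt = SC (cC g) N J0" for N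
    by (auto simp: SC_def SZ_def assms(2) jZ_Jt mult_ac)
  then show ?thesis using expansion_C[OF assms(1)] by simp
qed

lemma SZ_Jxx_conv:
  assumes "sqi M g" "\<And>i. cZ g i = - (lam (snd i))\<^sup>2 * c i"
  shows "L2conv M (\<lambda>N. SZ c N Jxx) g"
proof -
  have "SZ c N Jxx = SZ (cZ g) N J0" for N
    by (auto simp: SZ_def assms(2) jZ_Jxx mult_ac)
  then show ?thesis using expansion_Z[OF assms(1)] by simp
qed

end

section \<open>Integration by parts up to the boundary\<close>

lemma Basis_real2: "(Basis :: (real \<times> real) set) = {(1, 0), (0, 1)}"
  by (auto simp: Basis_prod_def)

lemma kappa_pair: "kappa N (L, T) (x, t) = rho N L x * rho N T t"
  by (simp add: kappa_def Basis_real2)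

lemma kappa_deriv:
  "frechet_derivative (kappa N (L, T)) (at (x, t)) (1, 0) = rho' N L x * rho N T t"
  "frechet_derivative (kappa N (L, T)) (at (x, t)) (0, 1) = rho N L x * rho' N T t"
proof -
  have "((\<lambda>y. kappa N (L, T) (y, t)) has_real_derivative rho' N L x * rho N T t) (at x)"
    unfolding kappa_pair using rho_deriv by (auto intro!: derivative_eq_intros)
  then show "frechet_derivative (kappa N (L, T)) (at (x, t)) (1, 0) = rho' N L x * rho N T t"
    using DERIV_unique[OF smooth_partial(1)[OF smooth_kappa]] by blast
  have "((\<lambda>s. kappa N (L, T) (x, s)) has_real_derivative rho N L x * rho' N T t) (at t)"
    unfolding kappa_pair using rho_deriv by (auto intro!: derivative_eq_intros)
  then show "frechet_derivative (kappa N (L, T)) (at (x, t)) (0, 1) = rho N L x * rho' N T t"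
    using DERIV_unique[OF smooth_partial(2)[OF smooth_kappa]] by blast
qed

text \<open>The derivative of the step \<open>flat 0 (N y - 1)\<close>, an approximate point mass at
  the face: its integral is at most 1 because the step takes values in [0, 1].\<close>

definition layer :: "nat \<Rightarrow> real \<Rightarrow> real" where
  "layer N y = real N * flat 2 (real N * y - 1)"

lemma layer_nonneg: "0 \<le> layer N y"
  by (simp add: layer_def flat_nonneg)

lemma layer_le: "y > 0 \<Longrightarrow> real N * y > 2 \<Longrightarrow> layer N y \<le> 4 / (real N * y\<^sup>2)"
  unfolding layer_def by (rule mult_flat2_le)

lemma abs_mult_layer_le: "\<bar>y\<bar> * layer N y \<le> 3"
  unfolding layer_def by (rule abs_mult_flat2_le)

lemma continuous_on_layer: "continuous_on S (layer N)"
proof -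
  have "smooth (\<lambda>y. real N * flat 2 (real N * y + - 1))"
    by (intro smooth_mult smooth_const smooth_affine_comp smooth_flat)
  from smooth_continuous_on[OF this, of S] show ?thesis by (simp add: layer_def[abs_def])
qed

lemma integral_layer:
  assumes "A > 0"
  shows "(LINT y|lebesgue_on {0<..<A}. layer N y) \<le> 1" "(LINT y|lebesgue_on {0<..<A}. layer N (A - y)) \<le> 1"
proof -
  have d: "((\<lambda>y. flat 0 (real N * y - 1)) has_real_derivative layer N y) (at y)" for y
  proof -
    have "((\<lambda>y. real N * y - 1) has_real_derivative real N) (at y)"
      by (auto intro!: derivative_eq_intros)
    from DERIV_chain2[OF flat_deriv[of 0] this] show ?thesis
      by (simp add: layer_def numeral_2_eq_2 mult.commute)
  qed
  have "(LINT y|lebesgue_on {0<..<A}. layer N y) = flat 0 (real N * A - 1) - flat 0 (real N * 0 - 1)"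
    by (rule lebesgue_ftc[OF _ d continuous_on_layer]) (use assms in simp)
  then show "(LINT y|lebesgue_on {0<..<A}. layer N y) \<le> 1"
    using flat0_le_1[of "real N * A - 1"] flat_nonneg[of 0 "real N * 0 - 1"] by simp
  have d': "((\<lambda>y. - flat 0 (real N * (A - y) - 1)) has_real_derivative layer N (A - y)) (at y)" for y
  proof -
    have "((\<lambda>y. A - y) has_real_derivative - 1) (at y)" by (auto intro!: derivative_eq_intros)
    from DERIV_minus[OF DERIV_chain2[OF d this]] show ?thesis by simp
  qed
  have "(LINT y|lebesgue_on {0<..<A}. layer N (A - y)) = - flat 0 (real N * (A - A) - 1) - (- flat 0 (real N * (A - 0) - 1))"
    by (rule lebesgue_ftc[OF _ d']) (use assms in \<open>auto intro!: continuous_on_compose2[OF continuous_on_layer] continuous_intros\<close>)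
  then show "(LINT y|lebesgue_on {0<..<A}. layer N (A - y)) \<le> 1"
    using flat0_le_1[of "real N * A - 1"] flat_nonneg[of 0 "real N * 0 - 1"] by simp
qed

text \<open>The bound is \<open>T\<close> for the faces in \<open>x\<close> and \<open>L\<close> for
  those in \<open>t\<close>; \<open>L + T\<close> serves both.\<close>

lemma integral_Omega_layer:
  assumes L: "L > 0" "T > 0" and b: "b \<in> Basis"
  shows "(LINT p|lebesgue_on (Omega L T). layer N (p \<bullet> b)) \<le> L + T"
    "(LINT p|lebesgue_on (Omega L T). layer N ((L, T) \<bullet> b - p \<bullet> b)) \<le> L + T"
proof -
  have one: "(LINT y|lebesgue_on {0<..<A}. 1) = A" if "A > 0" for A :: real
    using lebesgue_ftc[of 0 A "\<lambda>y. y" "\<lambda>_. 1"] that by (simp add: less_imp_le)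
  have c: "continuous_on UNIV (layer N)" "continuous_on UNIV (\<lambda>y. layer N (A - y))" for A
    by (intro continuous_on_layer continuous_on_compose2[OF continuous_on_layer] continuous_intros; auto)+
  consider "b = (1, 0)" | "b = (0, 1)" using b by (auto simp: Basis_real2)
  then have "(LINT p|lebesgue_on (Omega L T). layer N (p \<bullet> b)) \<le> L + T \<and>
    (LINT p|lebesgue_on (Omega L T). layer N ((L, T) \<bullet> b - p \<bullet> b)) \<le> L + T"
  proof cases
    case 1
    have "(LINT x|lebesgue_on {0<..<L}. layer N x) * T \<le> 1 * T" "(LINT x|lebesgue_on {0<..<L}. layer N (L - x)) * T \<le> 1 * T"
      using L by (intro mult_right_mono integral_layer; simp)+
    then have "(LINT x|lebesgue_on {0<..<L}. layer N x) * T \<le> L + T" "(LINT x|lebesgue_on {0<..<L}. layer N (L - x)) * T \<le> L + T"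
      using L by linarith+
    then show ?thesis
      using integral_Omega_prod[OF c(1) continuous_on_const, of L T 1] integral_Omega_prod[OF c(2) continuous_on_const, of L T L 1]
        one[OF L(2)] L by (simp add: 1 inner_prod_def)
  next
    case 2
    have "L * (LINT x|lebesgue_on {0<..<T}. layer N x) \<le> L * 1" "L * (LINT x|lebesgue_on {0<..<T}. layer N (T - x)) \<le> L * 1"
      using L by (intro mult_left_mono integral_layer; simp)+
    then have "L * (LINT x|lebesgue_on {0<..<T}. layer N x) \<le> L + T" "L * (LINT x|lebesgue_on {0<..<T}. layer N (T - x)) \<le> L + T"
      using L by linarith+
    then show ?thesis
      using integral_Omega_prod[OF continuous_on_const c(1), of L T 1] integral_Omega_prod[OF continuous_on_const c(2), of L T 1 T]
        one[OF L(1)] L by (simp add: 2 inner_prod_def)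
  qed
  then show "(LINT p|lebesgue_on (Omega L T). layer N (p \<bullet> b)) \<le> L + T"
    "(LINT p|lebesgue_on (Omega L T). layer N ((L, T) \<bullet> b - p \<bullet> b)) \<le> L + T" by auto
qed

lemma kappa_deriv_le:
  fixes L T :: real
  assumes "b \<in> Basis"
  shows "\<bar>frechet_derivative (kappa N (L, T)) (at p) b\<bar> \<le> layer N (p \<bullet> b) + layer N ((L, T) \<bullet> b - p \<bullet> b)"
proof -
  have *: "\<bar>rho' N A y * r\<bar> \<le> layer N y + layer N (A - y)" if "0 \<le> r" "r \<le> 1" for A y r
  proof -
    have "\<bar>rho' N A y * r\<bar> \<le> \<bar>rho' N A y\<bar> * 1" unfolding abs_mult using that by (intro mult_left_mono) auto
    then show ?thesis using rho'_abs_le[of N A y] by (simp add: layer_def)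
  qed
  show ?thesis
    using assms *[OF rho_bounds, of L "fst p" N T "snd p"] *[OF rho_bounds, of T "snd p" N L "fst p"]
    by (cases p) (auto simp: Basis_real2 kappa_deriv mult.commute)
qed

lemma kappa_deriv_continuous:
  "b \<in> Basis \<Longrightarrow> continuous_on S (\<lambda>p. frechet_derivative (kappa N c) (at p) b)"
  by (intro smooth_continuous_on smooth_deriv smooth_kappa)

lemma layer_tendsto: "y > 0 \<Longrightarrow> (\<lambda>N. layer N y) \<longlonglongrightarrow> 0"
proof (rule Lim_null_comparison)
  assume y: "y > 0"
  have "filterlim (\<lambda>N. real N * y) at_top sequentially" using y by real_asymp
  then have "\<forall>\<^sub>F N in sequentially. real N * y > 2" by (simp add: filterlim_at_top_dense)
  then show "\<forall>\<^sub>F N in sequentially. norm (layer N y) \<le> 4 / (real N * y\<^sup>2)"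
    by eventually_elim (use y layer_le layer_nonneg in auto)
  show "(\<lambda>N. 4 / (real N * y\<^sup>2)) \<longlonglongrightarrow> 0" using y by real_asymp
qed

context rectangle
begin

abbreviation "cutoff_deriv N b p \<equiv> frechet_derivative (kappa N (L, T)) (at p) b"

lemma kappa_limit:
  assumes u: "integrable M u"
  shows "(\<lambda>N. LINT p|M. u p * kappa (Suc N) (L, T) p) \<longlonglongrightarrow> (LINT p|M. u p)"
proof (rule integral_dominated_convergence[where w="\<lambda>p. \<bar>u p\<bar>"])
  have um[measurable]: "u \<in> borel_measurable M" using u by auto
  have [measurable]: "kappa N (L, T) \<in> borel_measurable M" for N
    unfolding Omega_eq_box by (intro continuous_measurable_box smooth_continuous_on smooth_kappa)
  show "u \<in> borel_measurable M" "integrable M (\<lambda>p. \<bar>u p\<bar>)" using u by auto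
  show "(\<lambda>p. u p * kappa (Suc N) (L, T) p) \<in> borel_measurable M" for N by measurable
  show "AE p in M. (\<lambda>N. u p * kappa (Suc N) (L, T) p) \<longlonglongrightarrow> u p"
  proof (rule AE_I2)
    fix p assume "p \<in> space M"
    then have "(\<lambda>N. kappa (Suc N) (L, T) p) \<longlonglongrightarrow> 1"
      by (intro LIMSEQ_Suc tendsto_kappa) (simp add: space_restrict_space Omega_eq_box)
    then have "(\<lambda>N. u p * kappa (Suc N) (L, T) p) \<longlonglongrightarrow> u p * 1" by (intro tendsto_intros)
    then show "(\<lambda>N. u p * kappa (Suc N) (L, T) p) \<longlonglongrightarrow> u p" by simp
  qed
  show "AE p in M. norm (u p * kappa (Suc N) (L, T) p) \<le> \<bar>u p\<bar>" for N
    by (intro AE_I2) (simp add: abs_mult kappa_bounds mult_left_le)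
qed

lemma smooth_sqi: "smooth h \<Longrightarrow> sqi M h"
  unfolding Omega_eq_box by (intro sqi_continuous smooth_continuous_on)

text \<open>Here \<open>h\<close> need not vanish near the boundary. The product with the cutoff is
  a test function, for positive index, and the product rule leaves one extra term, which
  \<open>lim\<close> disposes of.\<close>

lemma integration_by_parts:
  assumes f: "sqi M f" "sqi M g" "has_weak_deriv (Omega L T) b f g" and b: "b \<in> Basis" and h: "smooth h"
    and lim: "(\<lambda>N. LINT p|M. f p * (h p * cutoff_deriv (Suc N) b p)) \<longlonglongrightarrow> 0"
  shows "ip M f (\<lambda>p. frechet_derivative h (at p) b) = - ip M g h"
proof -
  let ?h = "\<lambda>p. frechet_derivative h (at p) b"
  have sh: "smooth ?h" by (rule smooth_deriv[OF h b])
  have i1: "integrable M (\<lambda>p. f p * ?h p)" "integrable M (\<lambda>p. g p * h p)"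
    using sqi_inner_integrable[OF f(1) smooth_sqi[OF sh]] sqi_inner_integrable[OF f(2) smooth_sqi[OF h]] by auto
  have i2: "integrable M (\<lambda>p. f p * ?h p * kappa N (L, T) p)" for N
    using sqi_inner_integrable[OF f(1) smooth_sqi[OF smooth_mult[OF sh smooth_kappa]]] by (simp add: mult.assoc)
  have i3: "integrable M (\<lambda>p. f p * (h p * cutoff_deriv N b p))" for N
    using sqi_inner_integrable[OF f(1) smooth_sqi[OF smooth_mult[OF h smooth_deriv[OF smooth_kappa b]]]] by simp
  have eq: "(LINT p|M. f p * (h p * cutoff_deriv (Suc N) b p)) + (LINT p|M. f p * ?h p * kappa (Suc N) (L, T) p)
      = - (LINT p|M. g p * h p * kappa (Suc N) (L, T) p)" for N
  proof -
    have "test_fun (Omega L T) (\<lambda>p. h p * kappa (Suc N) (L, T) p)"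
      unfolding Omega_eq_box by (rule test_fun_mult_kappa[OF h]) simp
    then have "(LINT p|M. f p * frechet_derivative (\<lambda>p. h p * kappa (Suc N) (L, T) p) (at p) b)
      = - (LINT p|M. g p * (h p * kappa (Suc N) (L, T) p))"
      using f(3) by (simp add: has_weak_deriv_def)
    moreover have "f p * frechet_derivative (\<lambda>p. h p * kappa (Suc N) (L, T) p) (at p) b =
      f p * (h p * cutoff_deriv (Suc N) b p) + f p * ?h p * kappa (Suc N) (L, T) p" for p
      unfolding frechet_derivative_mult_smooth[OF h smooth_kappa] by (simp add: algebra_simps)
    ultimately show ?thesis using i2 i3 by (simp add: mult.assoc)
  qed
  have "(\<lambda>N. (LINT p|M. f p * (h p * cutoff_deriv (Suc N) b p)) + (LINT p|M. f p * ?h p * kappa (Suc N) (L, T) p))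
      \<longlonglongrightarrow> 0 + (LINT p|M. f p * ?h p)"
    by (intro tendsto_add lim kappa_limit i1)
  moreover have "(\<lambda>N. - (LINT p|M. g p * h p * kappa (Suc N) (L, T) p)) \<longlonglongrightarrow> - (LINT p|M. g p * h p)"
    by (intro tendsto_minus kappa_limit i1)
  ultimately show ?thesis unfolding eq ip_def using LIMSEQ_unique by fastforce
qed

lemma Omega_coord:
  assumes "p \<in> Omega L T" "b \<in> Basis"
  shows "0 < p \<bullet> b" "p \<bullet> b < (L, T) \<bullet> b"
  using assms by (auto simp: Omega_eq_box mem_box)

text \<open>The derivative of the cutoff is of order \<open>N\<close> in a layer of width \<open>1 / N\<close>. It is harmless if
  the test function decays linearly at the face (dominated convergence), or if the product with
  \<open>f\<close> is continuous and vanishes there.\<close>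

lemma cutoff_lim_Lipschitz:
  assumes f: "sqi M f" and h: "continuous_on UNIV h" and b: "b \<in> Basis"
    and B: "\<And>p. p \<in> Omega L T \<Longrightarrow> \<bar>h p\<bar> \<le> B * \<bar>p \<bullet> b\<bar>" "\<And>p. p \<in> Omega L T \<Longrightarrow> \<bar>h p\<bar> \<le> B * \<bar>(L, T) \<bullet> b - p \<bullet> b\<bar>"
  shows "(\<lambda>N. LINT p|M. f p * (h p * cutoff_deriv (Suc N) b p)) \<longlonglongrightarrow> 0"
proof -
  have fm[measurable]: "f \<in> borel_measurable M" using f by (rule sqi_measurable)
  have [measurable]: "h \<in> borel_measurable M"
    unfolding Omega_eq_box by (rule continuous_measurable_box[OF continuous_on_subset[OF h]]) simp
  have [measurable]: "cutoff_deriv N b \<in> borel_measurable M" for N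
    unfolding Omega_eq_box by (rule continuous_measurable_box[OF kappa_deriv_continuous[OF b]])
  have "(\<lambda>N. LINT p|M. f p * (h p * cutoff_deriv (Suc N) b p)) \<longlonglongrightarrow> (LINT p|M. 0)"
  proof (rule integral_dominated_convergence[where w="\<lambda>p. \<bar>f p\<bar> * (6 * \<bar>B\<bar>)"])
    show "integrable M (\<lambda>p. \<bar>f p\<bar> * (6 * \<bar>B\<bar>))" using sqi_integrable[OF finite_M f] by simp
    show "AE p in M. (\<lambda>N. f p * (h p * cutoff_deriv (Suc N) b p)) \<longlonglongrightarrow> 0"
    proof (rule AE_I2)
      fix p assume "p \<in> space M"
      then have p: "p \<in> Omega L T" by (simp add: space_restrict_space)
      have "(\<lambda>N. layer N (p \<bullet> b) + layer N ((L, T) \<bullet> b - p \<bullet> b)) \<longlonglongrightarrow> 0 + 0"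
        by (intro tendsto_add layer_tendsto) (use Omega_coord[OF p b] in auto)
      then have "(\<lambda>N. cutoff_deriv N b p) \<longlonglongrightarrow> 0"
        by (intro Lim_null_comparison[where g="\<lambda>N. layer N (p \<bullet> b) + layer N ((L, T) \<bullet> b - p \<bullet> b)" and f="\<lambda>N. cutoff_deriv N b p"])
          (simp_all add: kappa_deriv_le[OF b])
      from LIMSEQ_Suc[OF this] have "(\<lambda>N. f p * (h p * cutoff_deriv (Suc N) b p)) \<longlonglongrightarrow> f p * (h p * 0)"
        by (intro tendsto_intros)
      then show "(\<lambda>N. f p * (h p * cutoff_deriv (Suc N) b p)) \<longlonglongrightarrow> 0" by simp
    qed
    \<comment> \<open>The linear decay of \<open>h\<close> compensates the height of the layer:
      distance times \<open>layer\<close> is at most 3 for each of the two opposite faces, hence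
      6.\<close>
    show "AE p in M. norm (f p * (h p * cutoff_deriv (Suc N) b p)) \<le> \<bar>f p\<bar> * (6 * \<bar>B\<bar>)" for N
    proof (rule AE_I2)
      fix p assume "p \<in> space M"
      then have p: "p \<in> Omega L T" by (simp add: space_restrict_space)
      let ?y = "p \<bullet> b" and ?z = "(L, T) \<bullet> b - p \<bullet> b"
      have "\<bar>h p * cutoff_deriv (Suc N) b p\<bar> \<le> \<bar>h p\<bar> * (layer (Suc N) ?y + layer (Suc N) ?z)"
        unfolding abs_mult by (intro mult_left_mono kappa_deriv_le b) simp
      also have "\<dots> = \<bar>h p\<bar> * layer (Suc N) ?y + \<bar>h p\<bar> * layer (Suc N) ?z" by (simp add: distrib_left)
      also have "\<dots> \<le> (\<bar>B\<bar> * \<bar>?y\<bar>) * layer (Suc N) ?y + (\<bar>B\<bar> * \<bar>?z\<bar>) * layer (Suc N) ?z"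
      proof (intro add_mono mult_right_mono layer_nonneg)
        show "\<bar>h p\<bar> \<le> \<bar>B\<bar> * \<bar>?y\<bar>" using B(1)[OF p] by (rule order.trans) (intro mult_right_mono, auto)
        show "\<bar>h p\<bar> \<le> \<bar>B\<bar> * \<bar>?z\<bar>" using B(2)[OF p] by (rule order.trans) (intro mult_right_mono, auto)
      qed
      also have "\<dots> = \<bar>B\<bar> * (\<bar>?y\<bar> * layer (Suc N) ?y) + \<bar>B\<bar> * (\<bar>?z\<bar> * layer (Suc N) ?z)" by (simp only: mult.assoc)
      also have "\<dots> \<le> \<bar>B\<bar> * 3 + \<bar>B\<bar> * 3" by (intro add_mono mult_left_mono abs_mult_layer_le) auto
      finally have "\<bar>h p * cutoff_deriv (Suc N) b p\<bar> \<le> 6 * \<bar>B\<bar>" by simp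
      then have "\<bar>f p\<bar> * \<bar>h p * cutoff_deriv (Suc N) b p\<bar> \<le> \<bar>f p\<bar> * (6 * \<bar>B\<bar>)" by (rule mult_left_mono) simp
      then show "norm (f p * (h p * cutoff_deriv (Suc N) b p)) \<le> \<bar>f p\<bar> * (6 * \<bar>B\<bar>)" by (simp add: abs_mult)
    qed
  qed measurable
  then show ?thesis by simp
qed

text \<open>Uniform continuity on the closed rectangle, applied to a point and its perpendicular
  projection onto the nearby face.\<close>

lemma face_near:
  fixes u :: "real \<times> real \<Rightarrow> real"
  assumes u: "continuous_on (cbox (0,0) (L,T)) u" and b: "b \<in> Basis" and e: "e > 0"
    and z: "\<And>p. p \<in> cbox (0,0) (L,T) \<Longrightarrow> p \<bullet> b = 0 \<or> p \<bullet> b = (L, T) \<bullet> b \<Longrightarrow> u p = 0"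
  obtains \<delta> where "\<delta> > 0"
    "\<And>p. p \<in> Omega L T \<Longrightarrow> p \<bullet> b < \<delta> \<or> (L, T) \<bullet> b - p \<bullet> b < \<delta> \<Longrightarrow> \<bar>u p\<bar> \<le> e"
proof -
  have "uniformly_continuous_on (cbox (0,0) (L,T)) u" using u by (rule compact_uniformly_continuous) simp
  then obtain \<delta> where \<delta>: "\<delta> > 0" and
    uc: "\<And>p q. p \<in> cbox (0,0) (L,T) \<Longrightarrow> q \<in> cbox (0,0) (L,T) \<Longrightarrow> dist q p < \<delta> \<Longrightarrow> dist (u q) (u p) < e"
    using e unfolding uniformly_continuous_on_def by metis
  have "\<bar>u p\<bar> \<le> e" if p: "p \<in> Omega L T" and near: "p \<bullet> b < \<delta> \<or> (L, T) \<bullet> b - p \<bullet> b < \<delta>" for p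
  proof -
    obtain x t where pxt: "p = (x, t)" by (cases p)
    have box: "(x', t') \<in> cbox (0,0) (L,T)" if "0 \<le> x'" "x' \<le> L" "0 \<le> t'" "t' \<le> T" for x' t'
      using that by (simp add: cbox_Pair_eq)
    have r: "0 < x" "x < L" "0 < t" "t < T" using p by (auto simp: pxt Omega_def)
    have "\<exists>q. q \<in> cbox (0,0) (L,T) \<and> dist q p < \<delta> \<and> (q \<bullet> b = 0 \<or> q \<bullet> b = (L, T) \<bullet> b)"
    proof -
      consider "b = (1, 0)" "x < \<delta>" | "b = (1, 0)" "L - x < \<delta>" | "b = (0, 1)" "t < \<delta>" | "b = (0, 1)" "T - t < \<delta>"
        using b near by (auto simp: Basis_real2 pxt)
      then show ?thesis
      proof cases
        case 1 then show ?thesis using r by (intro exI[of _ "(0, t)"]) (auto simp: box pxt dist_prod_def dist_real_def)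
      next
        case 2 then show ?thesis using r by (intro exI[of _ "(L, t)"]) (auto simp: box pxt dist_prod_def dist_real_def)
      next
        case 3 then show ?thesis using r by (intro exI[of _ "(x, 0)"]) (auto simp: box pxt dist_prod_def dist_real_def)
      next
        case 4 then show ?thesis using r by (intro exI[of _ "(x, T)"]) (auto simp: box pxt dist_prod_def dist_real_def)
      qed
    qed
    then obtain q where q: "q \<in> cbox (0,0) (L,T)" "dist q p < \<delta>" "u q = 0" using z by blast
    have "p \<in> cbox (0,0) (L,T)" using r by (simp add: pxt box)
    from uc[OF this q(1,2)] q(3) show ?thesis by (simp add: dist_real_def)
  qed
  then show ?thesis using that \<delta> by blast
qed

lemma measure_Omega: "(LINT p|M. c) = L * T * c"
proof -
  have one: "(LINT y|lebesgue_on {0<..<A}. 1) = A" if "A > 0" for A :: real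
    using lebesgue_ftc[of 0 A "\<lambda>y. y" "\<lambda>_. 1"] that by (simp add: less_imp_le)
  have "(LINT p|M. 1) = L * T"
    using integral_Omega_prod[OF continuous_on_const continuous_on_const, of L T 1 1] one[OF L] one[OF T] by simp
  then show ?thesis using integral_mult_right_zero[of M c "\<lambda>_. 1"] by simp
qed

text \<open>The layer keeps its mass as \<open>N\<close> grows, so smallness has to come from
  \<open>f h\<close>. Within distance \<open>\<delta>\<close> of the faces the product is at most
  \<open>e\<close> and the layer has bounded mass; farther away the product is bounded and the layer
  is of order \<open>1 / N\<close>.\<close>

lemma cutoff_lim_continuous:
  assumes u: "continuous_on (cbox (0,0) (L,T)) (\<lambda>p. f p * h p)" and b: "b \<in> Basis"
    and z: "\<And>p. p \<in> cbox (0,0) (L,T) \<Longrightarrow> p \<bullet> b = 0 \<or> p \<bullet> b = (L, T) \<bullet> b \<Longrightarrow> f p * h p = 0"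
  shows "(\<lambda>N. LINT p|M. f p * (h p * cutoff_deriv (Suc N) b p)) \<longlonglongrightarrow> 0"
proof -
  have "(\<lambda>N. LINT p|M. f p * (h p * cutoff_deriv N b p)) \<longlonglongrightarrow> 0"
  proof (rule LIMSEQ_I)
    fix r :: real assume r: "r > 0"
    let ?u = "\<lambda>p. f p * h p"
    \<comment> \<open>Two opposite layers of mass at most \<open>L + T\<close> contribute
      \<open>r / 4\<close> together, and the far part another \<open>r / 4\<close>.\<close>
    define e where "e = r / 8 / (L + T)"
    have e: "e > 0" using r L T by (simp add: e_def)
    obtain \<delta> where \<delta>: "\<delta> > 0"
      "\<And>p. p \<in> Omega L T \<Longrightarrow> p \<bullet> b < \<delta> \<or> (L, T) \<bullet> b - p \<bullet> b < \<delta> \<Longrightarrow> \<bar>?u p\<bar> \<le> e"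
      using face_near[OF u b e z] by blast
    obtain B where B: "B > 0" "\<And>p. p \<in> cbox (0,0) (L,T) \<Longrightarrow> \<bar>?u p\<bar> \<le> B"
      using continuous_bounded_cbox[OF u] by blast
    have "(\<lambda>N. L * T * (B * (8 / (real N * \<delta>\<^sup>2)))) \<longlonglongrightarrow> 0" using \<delta>(1) L T B by real_asymp
    then have "\<forall>\<^sub>F N in sequentially. L * T * (B * (8 / (real N * \<delta>\<^sup>2))) < r / 4"
      using r by (intro order_tendstoD(2)) auto
    moreover have "filterlim (\<lambda>N. real N * \<delta>) at_top sequentially" using \<delta>(1) by real_asymp
    then have "\<forall>\<^sub>F N in sequentially. real N * \<delta> > 2" by (simp add: filterlim_at_top_dense)
    ultimately have "\<forall>\<^sub>F N in sequentially. norm ((LINT p|M. f p * (h p * cutoff_deriv N b p)) - 0) < r"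
    proof eventually_elim
      case (elim N)
      let ?a = "\<lambda>p. layer N (p \<bullet> b)" and ?c = "\<lambda>p. layer N ((L, T) \<bullet> b - p \<bullet> b)"
      let ?k = "4 / (real N * \<delta>\<^sup>2)"
      have N: "real N > 0" using elim(2) \<delta>(1) by (metis mult_zero_left not_less_iff_gr_or_eq of_nat_0_le_iff less_eq_real_def zero_less_numeral)
      have k: "?k \<ge> 0" using N by simp
      have far: "layer N y \<le> ?k" if "y \<ge> \<delta>" for y
      proof -
        have "real N * \<delta> \<le> real N * y" using that N by simp
        then have "layer N y \<le> 4 / (real N * y\<^sup>2)" using elim(2) that \<delta>(1) by (intro layer_le) auto
        also have "\<dots> \<le> ?k" using that \<delta>(1) N by (intro divide_left_mono mult_left_mono power_mono mult_pos_pos) auto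
        finally show ?thesis .
      qed
      have tm: "\<bar>?u p\<bar> * layer N y \<le> e * layer N y + B * ?k" if p: "p \<in> Omega L T" and y: "y < \<delta> \<Longrightarrow> \<bar>?u p\<bar> \<le> e" for p y
      proof (cases "y < \<delta>")
        case True
        then have "\<bar>?u p\<bar> * layer N y \<le> e * layer N y" using y by (intro mult_right_mono layer_nonneg) auto
        moreover have "0 \<le> B * ?k" using B(1) k by simp
        ultimately show ?thesis by linarith
      next
        case False
        have "p \<in> cbox (0,0) (L,T)" using p by (auto simp: Omega_def cbox_Pair_eq)
        then have "\<bar>?u p\<bar> * layer N y \<le> B * ?k" using False B(2) far[of y] B(1) k by (intro mult_mono layer_nonneg) auto
        moreover have "0 \<le> e * layer N y" using e layer_nonneg by simp
        ultimately show ?thesis by linarith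
      qed
      have ca: "continuous_on UNIV ?a" "continuous_on UNIV ?c"
        by (intro continuous_on_compose2[OF continuous_on_layer] continuous_intros; auto)+
      have ia: "integrable M ?a" "integrable M ?c" by (intro fubini_continuous ca)+
      have ii: "integrable M (\<lambda>p. e * ?a p)" "integrable M (\<lambda>p. e * ?c p)" using ia by auto
      have cst: "integrable M (\<lambda>p. B * (8 / (real N * \<delta>\<^sup>2)))"
        by (rule finite_measure.integrable_const[OF finite_M])
      have "\<bar>LINT p|M. f p * (h p * cutoff_deriv N b p)\<bar> \<le> (LINT p|M. \<bar>f p * (h p * cutoff_deriv N b p)\<bar>)"
        by (rule integral_abs_bound)
      also have "\<dots> \<le> (LINT p|M. e * ?a p + e * ?c p + B * (8 / (real N * \<delta>\<^sup>2)))"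
      proof (rule integral_mono)
        have "sqi (lebesgue_on (box (0,0) (L,T))) (\<lambda>p. f p * h p * cutoff_deriv N b p)"
          by (intro sqi_continuous continuous_intros u kappa_deriv_continuous b)
        then have "integrable (lebesgue_on (box (0,0) (L,T))) (\<lambda>p. f p * h p * cutoff_deriv N b p)"
          by (rule sqi_integrable[OF finite_measure_box])
        then show "integrable M (\<lambda>p. \<bar>f p * (h p * cutoff_deriv N b p)\<bar>)"
          by (simp add: Omega_eq_box mult.assoc zero_prod_def)
        show "integrable M (\<lambda>p. e * ?a p + e * ?c p + B * (8 / (real N * \<delta>\<^sup>2)))"
          by (rule Bochner_Integration.integrable_add[OF Bochner_Integration.integrable_add[OF ii] cst])
        fix p assume "p \<in> space M"
        then have p: "p \<in> Omega L T" by (simp add: space_restrict_space)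
        have "\<bar>f p * (h p * cutoff_deriv N b p)\<bar> = \<bar>?u p\<bar> * \<bar>cutoff_deriv N b p\<bar>" by (simp add: abs_mult)
        also have "\<dots> \<le> \<bar>?u p\<bar> * (?a p + ?c p)" by (intro mult_left_mono kappa_deriv_le b) simp
        also have "\<dots> = \<bar>?u p\<bar> * ?a p + \<bar>?u p\<bar> * ?c p" by (rule distrib_left)
        also have "\<dots> \<le> (e * ?a p + B * ?k) + (e * ?c p + B * ?k)"
          by (intro add_mono tm p \<delta>(2)) auto
        also have "\<dots> = e * ?a p + e * ?c p + B * (8 / (real N * \<delta>\<^sup>2))" by simp
        finally show "\<bar>f p * (h p * cutoff_deriv N b p)\<bar> \<le> e * ?a p + e * ?c p + B * (8 / (real N * \<delta>\<^sup>2))" .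
      qed
      also have "\<dots> = e * (LINT p|M. ?a p) + e * (LINT p|M. ?c p) + L * T * (B * (8 / (real N * \<delta>\<^sup>2)))"
        by (simp only: Bochner_Integration.integral_add[OF Bochner_Integration.integrable_add[OF ii] cst]
            Bochner_Integration.integral_add[OF ii] measure_Omega integral_mult_right_zero) (simp only: mult_ac)
      also have "\<dots> \<le> e * (L + T) + e * (L + T) + r / 4"
        using e elim(1) by (intro add_mono mult_left_mono integral_Omega_layer L T b) auto
      also have "\<dots> = r / 2"
      proof -
        have "L + T \<noteq> 0" using L T by simp
        from iffD1[OF nonzero_eq_divide_eq[OF this] e_def] have "e * (L + T) = r / 8" .
        then show ?thesis by simp
      qed
      also have "\<dots> < r" using r by simp
      finally show ?case by simp
    qed
    then show "\<exists>no. \<forall>N\<ge>no. norm ((LINT p|M. f p * (h p * cutoff_deriv N b p)) - 0) < r"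
      by (simp add: eventually_sequentially)
  qed
  then show ?thesis by (rule LIMSEQ_Suc)
qed

end

section \<open>Weak derivatives and approximation\<close>

context rectangle
begin

text \<open>\<open>integration_by_parts\<close> speaks of \<open>frechet_derivative\<close>;
  uniqueness of one-variable derivatives identifies it with the explicit jets.\<close>

lemma jet_derivs:
  "frechet_derivative (jC i J0) (at p) (1, 0) = jC i Jx p"
  "frechet_derivative (jC i Jx) (at p) (1, 0) = jC i Jxx p"
  "frechet_derivative (jZ i J0) (at p) (0, 1) = jZ i Jt p"
  "smooth (jC i J0)" "smooth (jC i Jx)" "smooth (jZ i J0)"
proof -
  obtain m n where i: "i = (m, n)" by (cases i)
  have s: "smooth (\<lambda>p::real\<times>real. (A * sin (a * (p \<bullet> (1, 0))) + B * cos (a * (p \<bullet> (1, 0)))) *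
      (A' * sin (b * (p \<bullet> (0, 1))) + B' * cos (b * (p \<bullet> (0, 1)))))" for A B a A' B' b
    by (intro smooth_mult smooth_inner_comp[OF smooth_sin_cos])
  have "jC i J0 = (\<lambda>p. (1 * sin (lam n * (p \<bullet> (1, 0))) + 0 * cos (lam n * (p \<bullet> (1, 0)))) *
      (0 * sin (mu m * (p \<bullet> (0, 1))) + 1 * cos (mu m * (p \<bullet> (0, 1)))))"
    by (rule ext) (simp add: i inner_prod_def)
  then show s1: "smooth (jC i J0)" by (simp only: s)
  have "jC i Jx = (\<lambda>p. (0 * sin (lam n * (p \<bullet> (1, 0))) + lam n * cos (lam n * (p \<bullet> (1, 0)))) *
      (0 * sin (mu m * (p \<bullet> (0, 1))) + 1 * cos (mu m * (p \<bullet> (0, 1)))))"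
    by (rule ext) (simp add: i inner_prod_def)
  then show s2: "smooth (jC i Jx)" by (simp only: s)
  have "jZ i J0 = (\<lambda>p. (1 * sin (lam n * (p \<bullet> (1, 0))) + 0 * cos (lam n * (p \<bullet> (1, 0)))) *
      (1 * sin (mu m * (p \<bullet> (0, 1))) + 0 * cos (mu m * (p \<bullet> (0, 1)))))"
    by (rule ext) (simp add: i inner_prod_def)
  then show s3: "smooth (jZ i J0)" by (simp only: s)
  obtain x t where p: "p = (x, t)" by (cases p)
  show "frechet_derivative (jC i J0) (at p) (1, 0) = jC i Jx p"
    unfolding p by (rule DERIV_unique[OF smooth_partial(1)[OF s1] niceD(3)[OF nice_jC]])
  show "frechet_derivative (jC i Jx) (at p) (1, 0) = jC i Jxx p"
    unfolding p by (rule DERIV_unique[OF smooth_partial(1)[OF s2] niceD(4)[OF nice_jC]])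
  show "frechet_derivative (jZ i J0) (at p) (0, 1) = jZ i Jt p"
    unfolding p by (rule DERIV_unique[OF smooth_partial(2)[OF s3] niceD(2)[OF nice_jZ]])
qed

lemmas weak_unique = weak_deriv_unique[where c="(L, T)", folded Omega_eq_box]
lemmas weak_cong = has_weak_deriv_cong_AE[where c="(L, T)", folded Omega_eq_box]
lemmas weak_limit = has_weak_deriv_limit[where c="(L, T)", folded Omega_eq_box]
lemmas weak_lincomb = has_weak_deriv_lincomb[where c="(L, T)", folded Omega_eq_box]

text \<open>Relational versions of the weak derivatives: arguments can use whichever witnesses are
  at hand and pass to the chosen \<open>Dx\<close>, \<open>Dxx\<close> and \<open>Dt\<close> only at
  the end.\<close>

definition weak_x :: "(real \<times> real \<Rightarrow> real) \<Rightarrow> (real \<times> real \<Rightarrow> real) \<Rightarrow> (real \<times> real \<Rightarrow> real) \<Rightarrow> bool" where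
  "weak_x f fx fxx \<longleftrightarrow> sqi M fx \<and> sqi M fxx \<and>
     has_weak_deriv (Omega L T) (1, 0) f fx \<and> has_weak_deriv (Omega L T) (1, 0) fx fxx"

definition weak_t :: "(real \<times> real \<Rightarrow> real) \<Rightarrow> (real \<times> real \<Rightarrow> real) \<Rightarrow> bool" where
  "weak_t f ft \<longleftrightarrow> sqi M ft \<and> has_weak_deriv (Omega L T) (0, 1) f ft"

lemma H21hatI:
  assumes "weak_x f fx fxx" "weak_t f ft" "continuous_on (cbox (0, 0) (L, T)) f"
    "\<And>t. 0 \<le> t \<Longrightarrow> t \<le> T \<Longrightarrow> f (0, t) = 0 \<and> f (L, t) = 0"
  shows "f \<in> H21hat L T"
proof -
  have "sqi M f" unfolding Omega_eq_box using sqi_continuous[OF assms(3)] by (simp add: zero_prod_def)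
  moreover have "cbox (0, 0) (L, T) = {0..L} \<times> {0..T}" by (auto simp: cbox_Pair_eq)
  moreover have "\<exists>fx\<in>L2 (Omega L T). \<exists>fxx\<in>L2 (Omega L T). has_weak_deriv (Omega L T) (1, 0) f fx \<and>
      has_weak_deriv (Omega L T) (1, 0) fx fxx"
    using assms(1) unfolding weak_x_def L2_iff_sqi[symmetric] by blast
  moreover have "\<exists>ft\<in>L2 (Omega L T). has_weak_deriv (Omega L T) (0, 1) f ft"
    using assms(2) unfolding weak_t_def L2_iff_sqi[symmetric] by blast
  ultimately show ?thesis
    using assms(3,4) by (auto simp: H21hat_def H21_def L2_iff_sqi)
qed

lemma H21hat_sqi: "f \<in> H21hat L T \<Longrightarrow> sqi M f"
  by (simp add: H21hat_def H21_def L2_iff_sqi)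

lemma H21hat_continuous: "f \<in> H21hat L T \<Longrightarrow> continuous_on (cbox (0, 0) (L, T)) f"
proof -
  have "cbox (0, 0) (L, T) = {0..L} \<times> {0..T}" by (auto simp: cbox_Pair_eq)
  then show "f \<in> H21hat L T \<Longrightarrow> continuous_on (cbox (0, 0) (L, T)) f" by (simp add: H21hat_def)
qed

lemma H21hat_boundary: "f \<in> H21hat L T \<Longrightarrow> 0 \<le> t \<Longrightarrow> t \<le> T \<Longrightarrow> f (0, t) = 0 \<and> f (L, t) = 0"
  by (simp add: H21hat_def)

lemma weak_x_unique:
  assumes "weak_x f fx fxx" "weak_x f gx gxx"
  shows "AE p in M. fx p = gx p" "AE p in M. fxx p = gxx p"
proof -
  note w = assms[unfolded weak_x_def]
  show 1: "AE p in M. fx p = gx p"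
    by (rule weak_unique[of "(1, 0)" f]) (use w in blast)+
  have "has_weak_deriv (Omega L T) (1, 0) gx fxx"
    by (rule weak_cong[of "(1, 0)" fx fxx, OF _ _ 1]) (use w in \<open>blast | simp\<close>)+
  then show "AE p in M. fxx p = gxx p"
    using w by (intro weak_unique[of "(1, 0)" gx]) blast+
qed

lemma weak_t_unique: "weak_t f ft \<Longrightarrow> weak_t f gt \<Longrightarrow> AE p in M. ft p = gt p"
  unfolding weak_t_def by (rule weak_unique[of "(0, 1)" f]) blast+

lemma weak_t_Dt: "weak_t f ft \<Longrightarrow> weak_t f (Dt L T f)"
  unfolding weak_t_def Dt_def using weak_deriv_works by blast

text \<open>\<open>Dxx\<close> differentiates the chosen \<open>Dx\<close>, not the given
  \<open>fx\<close>; since the two agree almost everywhere, \<open>fxx\<close> is a weak derivative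
  of \<open>Dx\<close> as well.\<close>

lemma weak_x_Dx:
  assumes "weak_x f fx fxx" shows "weak_x f (Dx L T f) (Dxx L T f)"
proof -
  have a: "sqi M (Dx L T f)" "has_weak_deriv (Omega L T) (1, 0) f (Dx L T f)"
    using assms weak_deriv_works unfolding weak_x_def Dx_def by blast+
  note w = assms[unfolded weak_x_def]
  have 1: "AE p in M. fx p = Dx L T f p"
    by (rule weak_unique[of "(1, 0)" f]) (use w a in blast)+
  have "has_weak_deriv (Omega L T) (1, 0) (Dx L T f) fxx"
    by (rule weak_cong[of "(1, 0)" fx fxx, OF _ _ 1]) (use w a in \<open>blast | simp\<close>)+
  then have "sqi M (Dxx L T f)" "has_weak_deriv (Omega L T) (1, 0) (Dx L T f) (Dxx L T f)"
    using assms weak_deriv_works unfolding weak_x_def Dxx_def Dx_def[of L T "Dx L T f"] by blast+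
  with a show ?thesis by (simp add: weak_x_def)
qed

lemma H21hat_weak:
  assumes "f \<in> H21hat L T"
  shows "weak_t f (Dt L T f)" "weak_x f (Dx L T f) (Dxx L T f)"
proof -
  obtain ft where "weak_t f ft" using assms by (auto simp: H21hat_def H21_def L2_iff_sqi weak_t_def)
  then show "weak_t f (Dt L T f)" by (rule weak_t_Dt)
  obtain fx fxx where "weak_x f fx fxx" using assms by (auto simp: H21hat_def H21_def L2_iff_sqi weak_x_def)
  then show "weak_x f (Dx L T f) (Dxx L T f)" by (rule weak_x_Dx)
qed

lemma weak_x_lincomb:
  assumes "weak_x f fx fxx" "weak_x g gx gxx" "sqi M f" "sqi M g"
  shows "weak_x (\<lambda>p. f p + r * g p) (\<lambda>p. fx p + r * gx p) (\<lambda>p. fxx p + r * gxx p)"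
  using assms unfolding weak_x_def
  by (auto intro!: weak_lincomb sqi_add sqi_cmult)

lemma weak_t_lincomb:
  assumes "weak_t f ft" "weak_t g gt" "sqi M f" "sqi M g"
  shows "weak_t (\<lambda>p. f p + r * g p) (\<lambda>p. ft p + r * gt p)"
  using assms unfolding weak_t_def
  by (auto intro!: weak_lincomb sqi_add sqi_cmult)

lemma H21hat_lincomb:
  assumes "f \<in> H21hat L T" "g \<in> H21hat L T"
  shows "(\<lambda>p. f p + r * g p) \<in> H21hat L T"
proof (rule H21hatI)
  show "weak_x (\<lambda>p. f p + r * g p) (\<lambda>p. Dx L T f p + r * Dx L T g p) (\<lambda>p. Dxx L T f p + r * Dxx L T g p)"
    by (intro weak_x_lincomb H21hat_weak H21hat_sqi assms)
  show "weak_t (\<lambda>p. f p + r * g p) (\<lambda>p. Dt L T f p + r * Dt L T g p)"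
    by (intro weak_t_lincomb H21hat_weak H21hat_sqi assms)
  show "continuous_on (cbox (0, 0) (L, T)) (\<lambda>p. f p + r * g p)"
    by (intro continuous_intros H21hat_continuous assms)
  show "f (0, t) + r * g (0, t) = 0 \<and> f (L, t) + r * g (L, t) = 0" if "0 \<le> t" "t \<le> T" for t
    using H21hat_boundary[OF assms(1) that] H21hat_boundary[OF assms(2) that] by simp
qed

text \<open>Two integrations by parts, each with its own reason for the lateral faces to contribute
  nothing: \<open>fx\<close> is merely square-integrable, but the sine decays linearly there; the
  cosine in \<open>jC i Jx\<close> does not vanish, but \<open>f\<close> is continuous and
  does.\<close>

lemma cC_Dxx:
  assumes f: "f \<in> H21hat L T" and w: "weak_x f fx fxx"
  shows "cC fxx i = - (lam (snd i))\<^sup>2 * cC f i"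
proof -
  obtain m n where i: "i = (m, n)" by (cases i)
  note wd = w[unfolded weak_x_def]
  have "ip M fx (\<lambda>p. frechet_derivative (jC i J0) (at p) (1, 0)) = - ip M fxx (jC i J0)"
  proof (rule integration_by_parts)
    show "(\<lambda>N. LINT p|M. fx p * (jC i J0 p * cutoff_deriv (Suc N) (1, 0) p)) \<longlonglongrightarrow> 0"
    proof (rule cutoff_lim_Lipschitz[where B="lam n"])
      fix p assume "p \<in> Omega L T"
      have c: "\<bar>s * c\<bar> \<le> B" if "\<bar>s\<bar> \<le> B" "\<bar>c\<bar> \<le> 1" for s c B :: real
        using mult_mono[OF that] that by (simp add: abs_mult)
      have "\<bar>sin (lam n * fst p)\<bar> \<le> lam n * \<bar>fst p\<bar>"
        using abs_sin_x_le_abs_x[of "lam n * fst p"] lam_pos[of n] by (simp add: abs_mult)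
      then show "\<bar>jC i J0 p\<bar> \<le> lam n * \<bar>p \<bullet> (1, 0)\<bar>" by (simp add: i inner_prod_def c)
      \<comment> \<open>Rewriting the sine from the far end \<open>L\<close> gives the decay at the
        opposite face.\<close>
      have "sin (lam n * fst p) = - (cos (lam n * L) * sin (lam n * (L - fst p)))"
        using sin_diff[of "lam n * L" "lam n * (L - fst p)"] sin_lam_L[of n] by (simp add: algebra_simps)
      then have "\<bar>sin (lam n * fst p)\<bar> \<le> 1 * \<bar>sin (lam n * (L - fst p))\<bar>"
        unfolding abs_minus_cancel by (simp only: abs_minus_cancel abs_mult) (intro mult_right_mono, auto)
      also have "\<dots> \<le> lam n * \<bar>L - fst p\<bar>"
        using abs_sin_x_le_abs_x[of "lam n * (L - fst p)"] lam_pos[of n] by (simp add: abs_mult)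
      finally show "\<bar>jC i J0 p\<bar> \<le> lam n * \<bar>(L, T) \<bullet> (1, 0) - p \<bullet> (1, 0)\<bar>" by (simp add: i inner_prod_def c)
    qed (use wd niceD(1)[OF nice_jC] in auto)
  qed (use wd jet_derivs in auto)
  moreover have "ip M f (\<lambda>p. frechet_derivative (jC i Jx) (at p) (1, 0)) = - ip M fx (jC i Jx)"
  proof (rule integration_by_parts)
    show "(\<lambda>N. LINT p|M. f p * (jC i Jx p * cutoff_deriv (Suc N) (1, 0) p)) \<longlonglongrightarrow> 0"
    proof (rule cutoff_lim_continuous)
      show "continuous_on (cbox (0, 0) (L, T)) (\<lambda>p. f p * jC i Jx p)"
        by (intro continuous_intros H21hat_continuous f niceD[OF nice_jC])
      show "f p * jC i Jx p = 0" if "p \<in> cbox (0, 0) (L, T)" "p \<bullet> (1, 0) = 0 \<or> p \<bullet> (1, 0) = (L, T) \<bullet> (1, 0)" for p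
        using that H21hat_boundary[OF f, of "snd p"] by (cases p) (auto simp: cbox_Pair_eq inner_prod_def)
    qed simp
  qed (use wd jet_derivs H21hat_sqi[OF f] in auto)
  ultimately have "ip M fxx (jC i J0) = ip M f (jC i Jxx)"
    by (simp add: jet_derivs)
  also have "jC i Jxx = (\<lambda>p. - (lam (snd i))\<^sup>2 * jC i J0 p)" by (rule ext) (rule jC_Jxx)
  also have "ip M f (\<lambda>p. - (lam (snd i))\<^sup>2 * jC i J0 p) = - (lam (snd i))\<^sup>2 * ip M f (jC i J0)"
    by (rule ip_cmult_right)
  finally show ?thesis by (simp add: cC_def)
qed

text \<open>At time \<open>T\<close> the function \<open>f\<close> vanishes, at time 0 the sine
  does, so \<open>f\<close> may have arbitrary initial values.\<close>

lemma cZ_Dt: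
  assumes f: "f \<in> H21hat L T" and w: "weak_t f ft" and z: "\<And>x. 0 \<le> x \<Longrightarrow> x \<le> L \<Longrightarrow> f (x, T) = 0"
  shows "cZ ft i = - mu (fst i) * cC f i"
proof -
  note wd = w[unfolded weak_t_def]
  have "ip M f (\<lambda>p. frechet_derivative (jZ i J0) (at p) (0, 1)) = - ip M ft (jZ i J0)"
  proof (rule integration_by_parts)
    show "(\<lambda>N. LINT p|M. f p * (jZ i J0 p * cutoff_deriv (Suc N) (0, 1) p)) \<longlonglongrightarrow> 0"
    proof (rule cutoff_lim_continuous)
      show "continuous_on (cbox (0, 0) (L, T)) (\<lambda>p. f p * jZ i J0 p)"
        by (intro continuous_intros H21hat_continuous f niceD[OF nice_jZ])
      show "f p * jZ i J0 p = 0" if "p \<in> cbox (0, 0) (L, T)" "p \<bullet> (0, 1) = 0 \<or> p \<bullet> (0, 1) = (L, T) \<bullet> (0, 1)" for p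
        using that z[of "fst p"] jZ_0[of i "fst p"] by (cases p) (auto simp: cbox_Pair_eq inner_prod_def)
    qed simp
  qed (use wd jet_derivs H21hat_sqi[OF f] in auto)
  then have "ip M ft (jZ i J0) = - ip M f (jZ i Jt)" by (simp add: jet_derivs)
  also have "jZ i Jt = (\<lambda>p. mu (fst i) * jC i J0 p)" by (rule ext) (rule jZ_Jt)
  also have "ip M f (\<lambda>p. mu (fst i) * jC i J0 p) = mu (fst i) * ip M f (jC i J0)"
    by (rule ip_cmult_right)
  finally show ?thesis by (simp add: cC_def cZ_def)
qed

text \<open>A bound by \<open>Jxx\<close> that is stable under differences carries the Cauchy
  property to the lower derivative \<open>j\<close>, whose limit inherits the bound.\<close>

lemma L2_Cauchy_nice:
  assumes D: "\<And>N. nice L (D N)" and le: "\<And>E. nice L E \<Longrightarrow> nsq M (E j) \<le> K * nsq M (E Jxx)" and K: "K > 0"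
    and Q: "L2conv M (\<lambda>N. D N Jxx) Q" "sqi M Q"
  obtains R where "sqi M R" "L2conv M (\<lambda>N. D N j) R" "nsq M R \<le> K * nsq M Q"
proof -
  obtain R where R: "sqi M R" "L2conv M (\<lambda>N. D N j) R"
  proof (rule L2_complete[OF finite_M nice_sqi[OF D]])
    fix e :: real assume "e > 0"
    then have "e / K > 0" using K by simp
    from L2conv_Cauchy[OF Q(1) nice_sqi[OF D] Q(2) this]
    obtain N where N: "\<And>i k. i \<ge> N \<Longrightarrow> k \<ge> N \<Longrightarrow> nsq M (\<lambda>x. D i Jxx x - D k Jxx x) < e / K" by blast
    have "nsq M (\<lambda>x. D i j x - D k j x) < e" if "i \<ge> N" "k \<ge> N" for i k
    proof -
      have "nsq M (\<lambda>x. D i j x - D k j x) \<le> K * nsq M (\<lambda>x. D i Jxx x - D k Jxx x)"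
        by (rule le[OF nice_diff[OF D D]])
      also have "\<dots> < e" using N[OF that] K by (simp add: field_simps)
      finally show ?thesis .
    qed
    then show "\<exists>N. \<forall>i\<ge>N. \<forall>k\<ge>N. nsq M (\<lambda>x. D i j x - D k j x) < e" by blast
  qed blast
  moreover have "nsq M R \<le> K * nsq M Q"
  proof (rule LIMSEQ_le)
    show "(\<lambda>N. nsq M (D N j)) \<longlonglongrightarrow> nsq M R" by (rule L2conv_nsq[OF R(2) nice_sqi[OF D] R(1)])
    show "(\<lambda>N. K * nsq M (D N Jxx)) \<longlonglongrightarrow> K * nsq M Q"
      by (intro tendsto_intros L2conv_nsq[OF Q(1) nice_sqi[OF D] Q(2)])
    show "\<exists>N. \<forall>n\<ge>N. nsq M (D n j) \<le> K * nsq M (D n Jxx)" using le[OF D] by blast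
  qed
  ultimately show ?thesis using that by blast
qed

lemma x_closure:
  assumes D: "\<And>N. nice L (D N)" and f: "L2conv M (\<lambda>N. D N J0) f" "sqi M f"
    and Q: "L2conv M (\<lambda>N. D N Jxx) Q" "sqi M Q"
  obtains R where "weak_x f R Q" "nsq M f \<le> L ^ 4 * nsq M Q" "nsq M R \<le> L\<^sup>2 * nsq M Q"
proof -
  have L0: "0 \<le> L" "0 \<le> T" using L T by auto
  obtain R where R: "sqi M R" "L2conv M (\<lambda>N. D N Jx) R" "nsq M R \<le> L\<^sup>2 * nsq M Q"
  proof (rule L2_Cauchy_nice[where D=D and j=Jx and K="L\<^sup>2" and Q=Q])
    show "nsq M (E Jx) \<le> L\<^sup>2 * nsq M (E Jxx)" if "nice L E" for E by (rule nice_Poincare(3)[OF that L0(1)])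
  qed (use D Q L in auto)
  have "has_weak_deriv (Omega L T) (1, 0) f R"
    by (rule weak_limit[where f="\<lambda>N. D N J0" and g="\<lambda>N. D N Jx"])
      (use nice_weak_derivs[OF D L0] f R nice_sqi[OF D] in auto)
  moreover have "has_weak_deriv (Omega L T) (1, 0) R Q"
    by (rule weak_limit[where f="\<lambda>N. D N Jx" and g="\<lambda>N. D N Jxx"])
      (use nice_weak_derivs[OF D L0] Q R nice_sqi[OF D] in auto)
  moreover have "nsq M f \<le> L ^ 4 * nsq M Q"
  proof (rule LIMSEQ_le)
    show "(\<lambda>N. nsq M (D N J0)) \<longlonglongrightarrow> nsq M f" by (rule L2conv_nsq[OF f(1) nice_sqi[OF D] f(2)])
    show "(\<lambda>N. L ^ 4 * nsq M (D N Jxx)) \<longlonglongrightarrow> L ^ 4 * nsq M Q"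
      by (intro tendsto_intros L2conv_nsq[OF Q(1) nice_sqi[OF D] Q(2)])
    show "\<exists>N. \<forall>n\<ge>N. nsq M (D n J0) \<le> L ^ 4 * nsq M (D n Jxx)" using nice_Poincare(2)[OF D L0(1)] by blast
  qed
  ultimately show ?thesis using that R Q by (auto simp: weak_x_def)
qed

text \<open>The trigonometric partial sums of \<open>f\<close> are classical and their second
  derivatives converge to \<open>Dxx\<close>, so the classical inequalities pass to the
  limit.\<close>

lemma H21hat_Poincare:
  assumes f: "f \<in> H21hat L T"
  shows "nsq M f \<le> L ^ 4 * nsq M (Dxx L T f)" "nsq M (Dx L T f) \<le> L\<^sup>2 * nsq M (Dxx L T f)"
proof -
  note w = H21hat_weak(2)[OF f]
  have s: "sqi M f" "sqi M (Dxx L T f)" "sqi M (Dx L T f)" using w H21hat_sqi[OF f] by (auto simp: weak_x_def)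
  obtain R where R: "weak_x f R (Dxx L T f)" "nsq M f \<le> L ^ 4 * nsq M (Dxx L T f)" "nsq M R \<le> L\<^sup>2 * nsq M (Dxx L T f)"
    using x_closure[OF nice_SC expansion_C[OF s(1)] s(1) SC_Jxx_conv[OF s(2) cC_Dxx[OF f w]] s(2)] by blast
  have "nsq M (Dx L T f) = nsq M R"
    unfolding nsq_def using weak_x_unique(1)[OF w R(1)] s R(1)
    by (intro ip_cong_AE) (auto simp: weak_x_def sqi_def)
  then show "nsq M f \<le> L ^ 4 * nsq M (Dxx L T f)" "nsq M (Dx L T f) \<le> L\<^sup>2 * nsq M (Dxx L T f)"
    using R by auto
qed

lemma nsq_le_sup:
  assumes "f \<in> borel_measurable M" "\<And>p. p \<in> Omega L T \<Longrightarrow> \<bar>f p\<bar> \<le> B"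
  shows "nsq M f \<le> B\<^sup>2 * (L * T)"
proof -
  have one: "sqi M (\<lambda>_. 1::real)" unfolding Omega_eq_box by (intro sqi_continuous continuous_intros)
  have "nsq M (\<lambda>p. f p * 1) \<le> B\<^sup>2 * nsq M (\<lambda>_. 1::real)"
    by (rule nsq_mult_bounded[OF one assms(1)]) (use assms(2) in \<open>auto simp: space_restrict_space\<close>)
  also have "nsq M (\<lambda>_. 1::real) = L * T" using measure_Omega[of 1] by (simp add: nsq_real)
  finally show ?thesis by simp
qed

text \<open>\<open>nice_sup\<close> applied to differences makes the sequence uniformly Cauchy, so
  the limit is continuous up to the boundary and keeps its boundary values. Used with sums vanishing
  at 0 for the solution and with sums vanishing at \<open>T\<close> for test functions.\<close>

lemma t_closure:
  assumes D: "\<And>N. nice L (D N)" and P: "L2conv M (\<lambda>N. D N Jt) P" "sqi M P"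
    and Q: "L2conv M (\<lambda>N. D N Jxx) Q" "sqi M Q"
    and z: "(\<forall>N x. D N J0 (x, 0) = 0) \<or> (\<forall>N x. D N J0 (x, T) = 0)"
  obtains u where "u \<in> H21hat L T" "uniform_limit (cbox (0,0) (L,T)) (\<lambda>N. D N J0) u sequentially"
    "L2conv M (\<lambda>N. D N J0) u" "weak_t u P" "\<And>fx fxx. weak_x u fx fxx \<Longrightarrow> AE p in M. fxx p = Q p"
proof -
  have L0: "0 \<le> L" "0 \<le> T" using L T by auto
  let ?K = "cbox (0,0) (L,T)"
  have bound: "\<bar>D i J0 p - D k J0 p\<bar>\<^sup>2 \<le> 2 * L * (nsq M (\<lambda>p. D i Jt p - D k Jt p) + nsq M (\<lambda>p. D i Jxx p - D k Jxx p))"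
    if p: "p \<in> ?K" for p i k
  proof -
    obtain x t where xt: "p = (x, t)" by (cases p)
    have "0 \<le> x" "x \<le> L" "0 \<le> t" "t \<le> T" using p by (auto simp: xt cbox_Pair_eq)
    from nice_sup[OF nice_diff[OF D D] L0(1) this] z show ?thesis by (auto simp: xt)
  qed
  have "uniformly_Cauchy_on ?K (\<lambda>N. D N J0)"
    unfolding uniformly_Cauchy_on_def
  proof (intro allI impI)
    fix e :: real assume e: "e > 0"
    \<comment> \<open>With this \<open>r\<close> the bound \<open>2 L (r + r)\<close> equals half of
      the square of \<open>e\<close>.\<close>
    define r where "r = e\<^sup>2 / (8 * L)"
    have r: "r > 0" using e L by (simp add: r_def)
    obtain N1 where N1: "\<And>i k. i \<ge> N1 \<Longrightarrow> k \<ge> N1 \<Longrightarrow> nsq M (\<lambda>x. D i Jt x - D k Jt x) < r"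
      using L2conv_Cauchy[OF P(1) nice_sqi[OF D] P(2) r] by blast
    obtain N2 where N2: "\<And>i k. i \<ge> N2 \<Longrightarrow> k \<ge> N2 \<Longrightarrow> nsq M (\<lambda>x. D i Jxx x - D k Jxx x) < r"
      using L2conv_Cauchy[OF Q(1) nice_sqi[OF D] Q(2) r] by blast
    have "dist (D i J0 p) (D k J0 p) < e" if p: "p \<in> ?K" and ik: "i \<ge> max N1 N2" "k \<ge> max N1 N2" for p i k
    proof -
      have "\<bar>D i J0 p - D k J0 p\<bar>\<^sup>2 \<le> 2 * L * (nsq M (\<lambda>p. D i Jt p - D k Jt p) + nsq M (\<lambda>p. D i Jxx p - D k Jxx p))"
        by (rule bound[OF p])
      also have "\<dots> < 2 * L * (r + r)"
        using N1[of i k] N2[of i k] ik L by (intro mult_strict_left_mono add_strict_mono) auto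
      also have "\<dots> < e\<^sup>2" using L e by (simp add: r_def)
      finally have "\<bar>D i J0 p - D k J0 p\<bar> < e" using e by (meson less_imp_le power2_less_imp_less)
      then show ?thesis by (simp add: dist_real_def)
    qed
    then show "\<exists>M. \<forall>x\<in>?K. \<forall>m\<ge>M. \<forall>n\<ge>M. dist (D m J0 x) (D n J0 x) < e" by blast
  qed
  then obtain u where u: "uniform_limit ?K (\<lambda>N. D N J0) u sequentially"
    using Cauchy_uniformly_convergent[of ?K "\<lambda>N. D N J0"] by (auto simp: uniformly_convergent_on_def)
  have cu: "continuous_on ?K u"
    by (rule uniform_limit_theorem[OF _ u]) (simp_all add: niceD(1)[OF D])
  have su: "sqi M u" unfolding Omega_eq_box using sqi_continuous[OF cu] by (simp add: zero_prod_def)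
  have sub: "Omega L T \<subseteq> ?K" by (auto simp: Omega_def cbox_Pair_eq)
  have cl: "L2conv M (\<lambda>N. D N J0) u"
    unfolding L2conv_def
  proof (rule LIMSEQ_I)
    fix r :: real assume r: "r > 0"
    define e where "e = sqrt (r / (2 * (L * T)))"
    have e: "e > 0" "e\<^sup>2 * (L * T) = r / 2" using r L T by (auto simp: e_def)
    have "\<forall>\<^sub>F N in sequentially. \<forall>p\<in>?K. dist (D N J0 p) (u p) < e" by (rule uniform_limitD[OF u e(1)])
    then have "\<forall>\<^sub>F N in sequentially. norm (nsq M (\<lambda>x. D N J0 x - u x) - 0) < r"
    proof eventually_elim
      case (elim N)
      have "nsq M (\<lambda>x. D N J0 x - u x) \<le> e\<^sup>2 * (L * T)"
      proof (rule nsq_le_sup)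
        show "(\<lambda>x. D N J0 x - u x) \<in> borel_measurable M"
          using sqi_diff[OF nice_sqi[OF D] su] by (simp add: sqi_def)
        show "\<bar>D N J0 p - u p\<bar> \<le> e" if "p \<in> Omega L T" for p
          using elim that sub by (force simp: dist_real_def)
      qed
      then show ?case using e r nsq_nonneg[of M "\<lambda>x. D N J0 x - u x"] by simp
    qed
    then show "\<exists>no. \<forall>N\<ge>no. norm (nsq M (\<lambda>x. D N J0 x - u x) - 0) < r" by (simp add: eventually_sequentially)
  qed
  have "has_weak_deriv (Omega L T) (0, 1) u P"
    by (rule weak_limit[where f="\<lambda>N. D N J0" and g="\<lambda>N. D N Jt"])
      (use nice_weak_derivs[OF D L0] P cl su nice_sqi[OF D] in auto)
  then have wt: "weak_t u P" using P by (simp add: weak_t_def)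
  obtain R where wx: "weak_x u R Q" using x_closure[OF D cl su Q] by blast
  have "u \<in> H21hat L T"
  proof (rule H21hatI[OF wx wt cu])
    fix t assume t: "0 \<le> t" "t \<le> T"
    have lim: "(\<lambda>N. D N J0 p) \<longlonglongrightarrow> u p" if "p \<in> ?K" for p using tendsto_uniform_limitI[OF u that] .
    have "(0, t) \<in> ?K" "(L, t) \<in> ?K" using t L by (auto simp: cbox_Pair_eq)
    from lim[OF this(1)] lim[OF this(2)] show "u (0, t) = 0 \<and> u (L, t) = 0"
      by (simp add: niceD(7,8)[OF D] LIMSEQ_const_iff)
  qed
  then show ?thesis using that u cl wt weak_x_unique(2)[OF _ wx] by blast
qed

end

section \<open>Functions of the space variable and time reversal\<close>

lemma Ck_slice: "Ck n \<phi> \<Longrightarrow> Ck n (\<lambda>x::real. \<phi> (x, t::real))"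
proof (induction n arbitrary: \<phi>)
  case (Suc n)
  show ?case
  proof (rule Ck_SucI)
    show "((\<lambda>x. \<phi> (x, t)) has_derivative (\<lambda>h. frechet_derivative \<phi> (at (x, t)) (h, 0))) (at x)" for x
      by (rule has_derivative_compose[OF _ Ck_SucD[OF Suc.prems]]) (auto intro!: derivative_eq_intros)
    show "Ck n (\<lambda>x. frechet_derivative \<phi> (at (x, t)) (b, 0))" if "b \<in> Basis" for b
      using that Suc.prems by (auto intro!: Suc.IH[where \<phi>="\<lambda>p. frechet_derivative \<phi> (at p) (1, 0)"])
  qed
qed simp

lemma test_fun_slice:
  assumes "test_fun (Omega L T) \<phi>"
  shows "test_fun {0<..<L} (\<lambda>x. \<phi> (x, t))"
    "frechet_derivative (\<lambda>x. \<phi> (x, t)) (at x) 1 = frechet_derivative \<phi> (at (x, t)) (1, 0)"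
proof -
  obtain K where K: "compact K" "K \<subseteq> Omega L T" "\<And>p. p \<notin> K \<Longrightarrow> \<phi> p = 0"
    using assms by (auto simp: test_fun_def)
  have s: "smooth \<phi>" by (rule test_fun_smooth[OF assms])
  have ss: "smooth (\<lambda>x. \<phi> (x, t))" using s by (simp add: smooth_iff_Ck Ck_slice)
  have "compact (fst ` (K \<inter> UNIV \<times> {t}))"
    by (intro compact_continuous_image continuous_intros compact_Int_closed K closed_Times)
  moreover have "fst ` (K \<inter> UNIV \<times> {t}) \<subseteq> {0<..<L}" using K(2) by (auto simp: Omega_def)
  moreover have "\<phi> (x, t) = 0" if "x \<notin> fst ` (K \<inter> UNIV \<times> {t})" for x
    using K(3)[of "(x, t)"] that by force
  ultimately show "test_fun {0<..<L} (\<lambda>x. \<phi> (x, t))" using ss unfolding test_fun_def by blast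
  have "((\<lambda>x. \<phi> (x, t)) has_derivative (\<lambda>h. frechet_derivative \<phi> (at (x, t)) (1, 0) * h)) (at x)"
    using smooth_partial(1)[OF s, of t x] by (simp add: has_field_derivative_def)
  from frechet_derivative_at[OF this]
  have "frechet_derivative (\<lambda>x. \<phi> (x, t)) (at x) = (\<lambda>h. frechet_derivative \<phi> (at (x, t)) (1, 0) * h)" by simp
  then show "frechet_derivative (\<lambda>x. \<phi> (x, t)) (at x) 1 = frechet_derivative \<phi> (at (x, t)) (1, 0)" by simp
qed

text \<open>Each slice of a test function at fixed time is a test function on the interval, and
  Fubini integrates the one-dimensional identity over time.\<close>

lemma has_weak_deriv_fst:
  assumes w: "has_weak_deriv {0<..<L} 1 g g'"
    and i: "integrable (lebesgue_on {0<..<L}) g" "integrable (lebesgue_on {0<..<L}) g'"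
  shows "has_weak_deriv (Omega L T) (1, 0) (\<lambda>p. g (fst p)) (\<lambda>p. g' (fst p))"
  unfolding has_weak_deriv_def
proof (intro allI impI)
  fix \<phi> assume t: "test_fun (Omega L T) \<phi>"
  have s: "smooth \<phi>" by (rule test_fun_smooth[OF t])
  have c: "continuous_on UNIV \<phi>" "continuous_on UNIV (\<lambda>p. frechet_derivative \<phi> (at p) (1, 0))"
    by (intro smooth_continuous_on smooth_deriv s; simp)+
  have "(LINT p|lebesgue_on (Omega L T). g (fst p) * frechet_derivative \<phi> (at p) (1, 0)) =
    (LINT t|lebesgue_on {0<..<T}. LINT x|lebesgue_on {0<..<L}. g x * frechet_derivative \<phi> (at (x, t)) (1, 0))"
    by (rule fubini_fst_mult(3)[OF i(1) c(2)])
  also have "\<dots> = (LINT t|lebesgue_on {0<..<T}. - (LINT x|lebesgue_on {0<..<L}. g' x * \<phi> (x, t)))"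
  proof (rule Bochner_Integration.integral_cong[OF refl])
    fix t
    show "(LINT x|lebesgue_on {0<..<L}. g x * frechet_derivative \<phi> (at (x, t)) (1, 0))
      = - (LINT x|lebesgue_on {0<..<L}. g' x * \<phi> (x, t))"
      using w[unfolded has_weak_deriv_def, rule_format, OF test_fun_slice(1)[OF t, of t]]
      by (simp add: test_fun_slice(2)[OF t])
  qed
  also have "\<dots> = - (LINT p|lebesgue_on (Omega L T). g' (fst p) * \<phi> p)"
    using fubini_fst_mult(3)[OF i(2) c(1), of T] by simp
  finally show "(LINT p|lebesgue_on (Omega L T). g (fst p) * frechet_derivative \<phi> (at p) (1, 0)) =
    - (LINT p|lebesgue_on (Omega L T). g' (fst p) * \<phi> p)" .
qed

lemma has_weak_deriv_fst_t:
  assumes i: "integrable (lebesgue_on {0<..<L}) g" and T: "0 \<le> T"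
  shows "has_weak_deriv (Omega L T) (0, 1) (\<lambda>p. g (fst p)) (\<lambda>p. 0)"
  unfolding has_weak_deriv_def
proof (intro allI impI)
  fix \<phi> assume t: "test_fun (Omega L T) \<phi>"
  have s: "smooth \<phi>" by (rule test_fun_smooth[OF t])
  have c: "continuous_on UNIV (\<lambda>p. frechet_derivative \<phi> (at p) (0, 1))"
    by (intro smooth_continuous_on smooth_deriv s) simp
  have "(LINT p|lebesgue_on (Omega L T). g (fst p) * frechet_derivative \<phi> (at p) (0, 1)) =
    (LINT x|lebesgue_on {0<..<L}. g x * (\<phi> (x, T) - \<phi> (x, 0)))"
    by (rule integral_Omega_dt[OF i T smooth_partial(2)[OF s] c])
  also have "\<dots> = 0" using test_fun_boundary[OF t] by (simp add: Omega_def)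
  finally show "(LINT p|lebesgue_on (Omega L T). g (fst p) * frechet_derivative \<phi> (at p) (0, 1)) =
    - (LINT p|lebesgue_on (Omega L T). 0 * \<phi> p)" by simp
qed

lemma sqi_fst:
  assumes "sqi (lebesgue_on {0<..<L}) (g :: real \<Rightarrow> real)"
  shows "sqi (lebesgue_on (Omega L T)) (\<lambda>p. g (fst p))"
  using assms measurable_fst_Omega[of g L T] fubini_fst_mult(1)[of L "\<lambda>x. g x \<bullet> g x" "\<lambda>_. 1" T]
  by (auto simp: sqi_def)

text \<open>As with \<open>Dxx\<close>, the second choice in \<open>dd\<close> is made for the
  chosen first derivative, which agrees with the given one only almost everywhere.\<close>

lemma H2_derivs:
  assumes "w \<in> H2 L"
  obtains w1 where "sqi (lebesgue_on {0<..<L}) w" "sqi (lebesgue_on {0<..<L}) w1" "sqi (lebesgue_on {0<..<L}) (dd L w)"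
    "has_weak_deriv {0<..<L} 1 w w1" "has_weak_deriv {0<..<L} 1 w1 (dd L w)"
proof -
  let ?X = "lebesgue_on {0<..<L}"
  obtain a b where ab: "sqi ?X a" "sqi ?X b" "has_weak_deriv {0<..<L} 1 w a" "has_weak_deriv {0<..<L} 1 a b"
    using assms by (auto simp: H2_def L2_iff_sqi)
  have w: "sqi ?X w" using assms by (simp add: H2_def L2_iff_sqi)
  define w1 where "w1 = weak_deriv {0<..<L} 1 w"
  have w1: "sqi ?X w1" "has_weak_deriv {0<..<L} 1 w w1"
    using weak_deriv_works[OF ab(1,3)] by (auto simp: w1_def)
  have ae: "AE x in ?X. a x = w1 x"
    by (rule weak_deriv_unique[where c=L, folded interval_eq_box, of 1 w]) (use ab w1 in blast)+
  have "has_weak_deriv {0<..<L} 1 w1 b"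
    by (rule has_weak_deriv_cong_AE[where c=L, folded interval_eq_box, OF ab(4) _ ae])
      (use ab w1 in auto)
  then have "sqi ?X (dd L w)" "has_weak_deriv {0<..<L} 1 w1 (dd L w)"
    using weak_deriv_works[OF ab(2)] by (auto simp: dd_def w1_def)
  then show ?thesis using that w w1 by blast
qed

lemma Ck_reflect: "Ck n \<phi> \<Longrightarrow> Ck n (\<lambda>p. \<phi> (fst p, T - snd p :: real) :: real)" for \<phi> :: "real \<times> real \<Rightarrow> real"
proof (induction n arbitrary: \<phi>)
  case (Suc n)
  let ?r = "\<lambda>p::real \<times> real. (fst p, T - snd p)"
  have d: "(\<phi> has_derivative frechet_derivative \<phi> (at q)) (at q)" for q by (rule Ck_SucD[OF Suc.prems])
  show ?case
  proof (rule Ck_SucI)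
    show "((\<lambda>p. \<phi> (?r p)) has_derivative (\<lambda>h. frechet_derivative \<phi> (at (?r p)) (fst h, - snd h))) (at p)" for p
      by (rule has_derivative_compose[OF _ d]) (auto intro!: derivative_eq_intros)
    fix b :: "real \<times> real" assume "b \<in> Basis"
    then consider "b = (1, 0)" | "b = (0, 1)" by (auto simp: Basis_real2)
    then show "Ck n (\<lambda>p. frechet_derivative \<phi> (at (?r p)) (fst b, - snd b))"
    proof cases
      case 1
      then show ?thesis using Suc.prems Suc.IH[of "\<lambda>p. frechet_derivative \<phi> (at p) (1, 0)"] by simp
    next
      case 2
      have "frechet_derivative \<phi> (at q) (0, - 1) = (- 1) * frechet_derivative \<phi> (at q) (0, 1)" for q
        using linear_scale[OF has_derivative_linear[OF d], of q "- 1" "(0, 1)"] by simp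
      moreover have "Ck n (\<lambda>p. (- 1) * frechet_derivative \<phi> (at (?r p)) (0, 1))"
        using Suc.prems by (intro Ck_mult Ck_const Suc.IH[of "\<lambda>p. frechet_derivative \<phi> (at p) (0, 1)"]) simp
      ultimately show ?thesis using 2 by simp
    qed
  qed
qed simp

section \<open>Time reversal and functions of the space variable on the rectangle\<close>

context rectangle
begin

definition reflect :: "real \<times> real \<Rightarrow> real \<times> real" where "reflect p = (fst p, T - snd p)"

lemma reflect_reflect[simp]: "reflect (reflect p) = p" and fst_reflect[simp]: "fst (reflect p) = fst p"
  by (auto simp: reflect_def)

lemma reflect_Omega[simp]: "reflect p \<in> Omega L T \<longleftrightarrow> p \<in> Omega L T"
  by (cases p) (auto simp: reflect_def Omega_def)

lemma reflect_lebesgue: "reflect \<in> lebesgue \<rightarrow>\<^sub>M lebesgue" "distr lebesgue lebesgue reflect = lebesgue"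
proof -
  \<comment> \<open>Time reversal as an affine map: scaling by 1 and -1, then translation by
    \<open>(0, T)\<close>; the determinant has absolute value 1.\<close>
  define c :: "real \<times> real \<Rightarrow> real" where "c j = (if j = (1, 0) then 1 else - 1)" for j
  have c: "\<And>j. j \<in> Basis \<Longrightarrow> c j \<noteq> 0" by (simp add: c_def)
  have reflect: "(\<lambda>x. (0, T) + (\<Sum>j\<in>Basis. (c j * (x \<bullet> j)) *\<^sub>R j)) = reflect"
    by (auto simp: Basis_real2 c_def reflect_def inner_prod_def)
  show "reflect \<in> lebesgue \<rightarrow>\<^sub>M lebesgue" using lebesgue_affine_measurable[where t="(0, T)" and c=c, OF c] reflect by simp
  have "(\<Prod>j\<in>Basis. \<bar>c j\<bar>) = 1" by (simp add: c_def Basis_real2)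
  then show "distr lebesgue lebesgue reflect = lebesgue"
    using lebesgue_affine_euclidean[where t="(0, T)" and c=c, OF c] reflect by (simp add: density_1)
qed

lemma reflect_M: "reflect \<in> M \<rightarrow>\<^sub>M M" "distr M M reflect = M"
proof -
  show m: "reflect \<in> M \<rightarrow>\<^sub>M M"
    by (intro measurable_restrict_space3 reflect_lebesgue) auto
  show "distr M M reflect = M"
  proof (rule measure_eqI)
    fix A assume A: "A \<in> sets (distr M M reflect)"
    then have A': "A \<in> sets lebesgue" "A \<subseteq> Omega L T"
      using sets_Omega by (auto simp: sets_restrict_space_iff)
    have pre: "reflect -` A \<subseteq> Omega L T" using A'(2) reflect_Omega by blast
    then have eq: "reflect -` A \<inter> space M = reflect -` A"
      by (auto simp: space_restrict_space)
    have "emeasure (distr M M reflect) A = emeasure M (reflect -` A)"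
      using A m eq by (simp add: emeasure_distr)
    also have "\<dots> = emeasure lebesgue (reflect -` A)"
      using pre sets_Omega by (intro emeasure_restrict_space) auto
    also have "\<dots> = emeasure (distr lebesgue lebesgue reflect) A"
      using A'(1) reflect_lebesgue(1) by (simp add: emeasure_distr)
    also have "\<dots> = emeasure M A"
      using A'(2) sets_Omega by (simp add: reflect_lebesgue emeasure_restrict_space)
    finally show "emeasure (distr M M reflect) A = emeasure M A" .
  qed simp
qed

lemma integral_reflect: "h \<in> borel_measurable M \<Longrightarrow> (LINT p|M. h (reflect p)) = (LINT p|M. h p :: real)"
  using integral_distr[OF reflect_M(1), of h] reflect_M(2) by simp

lemma measurable_reflect: "h \<in> borel_measurable M \<Longrightarrow> (\<lambda>p. h (reflect p) :: real) \<in> borel_measurable M"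
  using measurable_compose[OF reflect_M(1)] by blast

lemma sqi_reflect: "sqi M h \<Longrightarrow> sqi M (\<lambda>p. h (reflect p) :: real)"
  using integrable_distr[OF reflect_M(1), of "\<lambda>p. h p \<bullet> h p"] reflect_M(2) measurable_reflect[of h] by (simp add: sqi_def)

lemma ip_reflect:
  assumes "f \<in> borel_measurable M" "g \<in> borel_measurable M"
  shows "ip M (\<lambda>p. f (reflect p) :: real) g = ip M f (\<lambda>p. g (reflect p))"
proof -
  have "(\<lambda>p. f (reflect p) \<bullet> g p) \<in> borel_measurable M" using assms measurable_reflect[of f] by measurable
  from integral_reflect[OF this] show ?thesis by (simp add: ip_def)
qed

lemma AE_reflect: "AE p in M. P p \<Longrightarrow> AE p in M. P (reflect p)"
proof -
  assume "AE p in M. P p"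
  then have "AE p in distr M M reflect. P p" unfolding reflect_M(2) .
  from AE_distrD[OF reflect_M(1) this] show ?thesis .
qed

lemma test_fun_reflect:
  assumes "test_fun (Omega L T) \<phi>"
  shows "test_fun (Omega L T) (\<lambda>p. \<phi> (reflect p))"
    "frechet_derivative (\<lambda>p. \<phi> (reflect p)) (at p) (1, 0) = frechet_derivative \<phi> (at (reflect p)) (1, 0)"
    "frechet_derivative (\<lambda>p. \<phi> (reflect p)) (at p) (0, 1) = - frechet_derivative \<phi> (at (reflect p)) (0, 1)"
proof -
  obtain K where K: "compact K" "K \<subseteq> Omega L T" "\<And>p. p \<notin> K \<Longrightarrow> \<phi> p = 0"
    using assms by (auto simp: test_fun_def)
  have s: "smooth \<phi>" by (rule test_fun_smooth[OF assms])
  have "smooth (\<lambda>p. \<phi> (reflect p))" using s Ck_reflect[of _ \<phi> T] by (simp add: smooth_iff_Ck reflect_def)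
  moreover have "compact (reflect ` K)"
    unfolding reflect_def by (intro compact_continuous_image continuous_intros K)
  moreover have "reflect ` K \<subseteq> Omega L T" using K(2) reflect_Omega by auto
  moreover have "\<phi> (reflect p) = 0" if "p \<notin> reflect ` K" for p
    using K(3)[of "reflect p"] that by (metis image_eqI reflect_reflect)
  ultimately show "test_fun (Omega L T) (\<lambda>p. \<phi> (reflect p))" unfolding test_fun_def by blast
  have d: "(\<phi> has_derivative frechet_derivative \<phi> (at q)) (at q)" for q by (rule smooth_has_derivative[OF s])
  have "((\<lambda>p. \<phi> (reflect p)) has_derivative (\<lambda>h. frechet_derivative \<phi> (at (reflect p)) (fst h, - snd h))) (at p)"
    unfolding reflect_def by (rule has_derivative_compose[OF _ d]) (auto intro!: derivative_eq_intros)
  from frechet_derivative_at[OF this]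
  have fd: "frechet_derivative (\<lambda>p. \<phi> (reflect p)) (at p) = (\<lambda>h. frechet_derivative \<phi> (at (reflect p)) (fst h, - snd h))" by simp
  show "frechet_derivative (\<lambda>p. \<phi> (reflect p)) (at p) (1, 0) = frechet_derivative \<phi> (at (reflect p)) (1, 0)"
    unfolding fd by simp
  show "frechet_derivative (\<lambda>p. \<phi> (reflect p)) (at p) (0, 1) = - frechet_derivative \<phi> (at (reflect p)) (0, 1)"
    unfolding fd using linear_scale[OF has_derivative_linear[OF d], of "reflect p" "- 1" "(0, 1)"] by simp
qed

lemma has_weak_deriv_reflect:
  assumes f: "sqi M f" "sqi M g"
  shows "has_weak_deriv (Omega L T) (1, 0) f g \<Longrightarrow> has_weak_deriv (Omega L T) (1, 0) (\<lambda>p. f (reflect p)) (\<lambda>p. g (reflect p))"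
    "has_weak_deriv (Omega L T) (0, 1) f g \<Longrightarrow> has_weak_deriv (Omega L T) (0, 1) (\<lambda>p. f (reflect p)) (\<lambda>p. - g (reflect p))"
proof -
  have m: "f \<in> borel_measurable M" "g \<in> borel_measurable M" using f by (auto simp: sqi_def)
  have mt: "\<phi> \<in> borel_measurable M" "b \<in> Basis \<Longrightarrow> (\<lambda>p. frechet_derivative \<phi> (at p) b) \<in> borel_measurable M"
    if "test_fun (Omega L T) \<phi>" for \<phi> b
    using that test_fun_sqi[of "(L, T)" \<phi>] test_fun_deriv_sqi[of "(L, T)" \<phi> b]
    by (simp_all add: Omega_eq_box sqi_def)
  show "has_weak_deriv (Omega L T) (1, 0) (\<lambda>p. f (reflect p)) (\<lambda>p. g (reflect p))"
    if w: "has_weak_deriv (Omega L T) (1, 0) f g"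
    unfolding has_weak_deriv_ip
  proof (intro allI impI)
    fix \<phi> assume t: "test_fun (Omega L T) \<phi>"
    have "ip M (\<lambda>p. f (reflect p)) (\<lambda>p. frechet_derivative \<phi> (at p) (1, 0)) =
        ip M f (\<lambda>p. frechet_derivative (\<lambda>p. \<phi> (reflect p)) (at p) (1, 0))"
      by (subst ip_reflect) (use m mt[OF t] in \<open>auto simp: test_fun_reflect[OF t]\<close>)
    also have "\<dots> = - ip M g (\<lambda>p. \<phi> (reflect p))"
      using w test_fun_reflect(1)[OF t] by (simp add: has_weak_deriv_ip)
    also have "ip M g (\<lambda>p. \<phi> (reflect p)) = ip M (\<lambda>p. g (reflect p)) \<phi>"
      by (rule ip_reflect[symmetric]) (use m mt[OF t] in auto)
    finally show "ip M (\<lambda>p. f (reflect p)) (\<lambda>p. frechet_derivative \<phi> (at p) (1, 0)) = - ip M (\<lambda>p. g (reflect p)) \<phi>" .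
  qed
  show "has_weak_deriv (Omega L T) (0, 1) (\<lambda>p. f (reflect p)) (\<lambda>p. - g (reflect p))"
    if w: "has_weak_deriv (Omega L T) (0, 1) f g"
    unfolding has_weak_deriv_ip
  proof (intro allI impI)
    fix \<phi> assume t: "test_fun (Omega L T) \<phi>"
    have "ip M (\<lambda>p. f (reflect p)) (\<lambda>p. frechet_derivative \<phi> (at p) (0, 1)) =
        ip M f (\<lambda>p. - frechet_derivative (\<lambda>p. \<phi> (reflect p)) (at p) (0, 1))"
      by (subst ip_reflect) (use m mt[OF t] in \<open>auto simp: test_fun_reflect[OF t]\<close>)
    also have "\<dots> = - ip M f (\<lambda>p. frechet_derivative (\<lambda>p. \<phi> (reflect p)) (at p) (0, 1))"
      by (subst (1 2) ip_commute) (rule ip_minus_left)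
    also have "\<dots> = ip M g (\<lambda>p. \<phi> (reflect p))"
      using w test_fun_reflect(1)[OF t] by (simp add: has_weak_deriv_ip)
    also have "ip M g (\<lambda>p. \<phi> (reflect p)) = ip M (\<lambda>p. g (reflect p)) \<phi>"
      by (rule ip_reflect[symmetric]) (use m mt[OF t] in auto)
    finally show "ip M (\<lambda>p. f (reflect p)) (\<lambda>p. frechet_derivative \<phi> (at p) (0, 1)) = - ip M (\<lambda>p. - g (reflect p)) \<phi>"
      by (simp add: ip_minus_left)
  qed
qed

lemma H21hat_reflect:
  assumes f: "f \<in> H21hat L T"
  shows "(\<lambda>p. f (reflect p)) \<in> H21hat L T" "weak_t (\<lambda>p. f (reflect p)) (\<lambda>p. - Dt L T f (reflect p))"
    "weak_x (\<lambda>p. f (reflect p)) (\<lambda>p. Dx L T f (reflect p)) (\<lambda>p. Dxx L T f (reflect p))"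
proof -
  note w = H21hat_weak[OF f, unfolded weak_t_def weak_x_def]
  show t: "weak_t (\<lambda>p. f (reflect p)) (\<lambda>p. - Dt L T f (reflect p))"
    using w H21hat_sqi[OF f] by (auto simp: weak_t_def intro!: has_weak_deriv_reflect sqi_minus sqi_reflect)
  show x: "weak_x (\<lambda>p. f (reflect p)) (\<lambda>p. Dx L T f (reflect p)) (\<lambda>p. Dxx L T f (reflect p))"
    using w H21hat_sqi[OF f] by (auto simp: weak_x_def intro!: has_weak_deriv_reflect sqi_reflect)
  show "(\<lambda>p. f (reflect p)) \<in> H21hat L T"
  proof (rule H21hatI[OF x t])
    show "continuous_on (cbox (0, 0) (L, T)) (\<lambda>p. f (reflect p))"
      unfolding reflect_def
      by (rule continuous_on_compose2[OF H21hat_continuous[OF f]])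
        (auto intro!: continuous_intros simp: cbox_Pair_eq)
    show "f (reflect (0, t)) = 0 \<and> f (reflect (L, t)) = 0" if "0 \<le> t" "t \<le> T" for t
      using H21hat_boundary[OF f, of "T - t"] that by (simp add: reflect_def)
  qed
qed

text \<open>The initial value extended constantly in time. The conditions at 0 and \<open>L\<close>
  are what puts this extension into \<open>H21hat\<close>.\<close>

lemma H21hat_fst:
  assumes w: "w \<in> H2 L" "w 0 = 0" "w L = 0"
  obtains w1 where "(\<lambda>p. w (fst p)) \<in> H21hat L T" "weak_t (\<lambda>p. w (fst p)) (\<lambda>p. 0)"
    "weak_x (\<lambda>p. w (fst p)) (\<lambda>p. w1 (fst p)) (\<lambda>p. dd L w (fst p))"
proof -
  let ?X = "lebesgue_on {0<..<L}"
  have fX: "finite_measure ?X" unfolding interval_eq_box by (rule finite_measure_box)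
  obtain w1 where w1: "sqi ?X w" "sqi ?X w1" "sqi ?X (dd L w)"
    "has_weak_deriv {0<..<L} 1 w w1" "has_weak_deriv {0<..<L} 1 w1 (dd L w)"
    using H2_derivs[OF w(1)] by blast
  have i: "integrable ?X w" "integrable ?X w1" "integrable ?X (dd L w)"
    using w1 sqi_integrable[OF fX] by auto
  have x: "weak_x (\<lambda>p. w (fst p)) (\<lambda>p. w1 (fst p)) (\<lambda>p. dd L w (fst p))"
    using w1 i by (auto simp: weak_x_def intro!: sqi_fst has_weak_deriv_fst)
  have t: "weak_t (\<lambda>p. w (fst p)) (\<lambda>p. 0)"
    using i T by (auto simp: weak_t_def sqi_zero intro!: has_weak_deriv_fst_t)
  have "(\<lambda>p. w (fst p)) \<in> H21hat L T"
  proof (rule H21hatI[OF x t])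
    have "continuous_on {0..L} w" using w(1) by (simp add: H2_def)
    then show "continuous_on (cbox (0, 0) (L, T)) (\<lambda>p. w (fst p))"
      by (rule continuous_on_compose2) (auto intro!: continuous_intros simp: cbox_Pair_eq)
  qed (use w in auto)
  then show ?thesis using that x t by blast
qed

text \<open>The set of agreement is closed and has full measure in the open rectangle, so it
  contains the closure. Almost everywhere statements become pointwise ones here.\<close>

lemma continuous_AE_eq:
  assumes f: "continuous_on (cbox (0,0) (L,T)) f" and g: "continuous_on (cbox (0,0) (L,T)) (g :: _ \<Rightarrow> real)"
    and ae: "AE p in M. f p = g p" and p: "p \<in> cbox (0,0) (L,T)"
  shows "f p = g p"
proof -
  define C where "C = {p \<in> cbox (0,0) (L,T). f p - g p = 0}"
  have clC: "closed C"
    unfolding C_def by (intro continuous_closed_preimage_constant continuous_intros f g closed_cbox)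
  have sub: "Omega L T \<subseteq> cbox (0,0) (L,T)" by (auto simp: Omega_def cbox_Pair_eq)
  have "AE p\<in>Omega L T in lebesgue. p \<in> C"
    using ae sets_Omega sub by (auto simp: AE_restrict_space_iff C_def elim!: eventually_mono)
  then have "Omega L T \<subseteq> C"
    using mem_closed_if_AE_lebesgue_open[of "Omega L T" C] clC by (auto simp: Omega_eq_box)
  then have "closure (Omega L T) \<subseteq> C" using clC by (rule closure_minimal)
  moreover have "closure (Omega L T) = cbox (0,0) (L,T)"
    using L T unfolding Omega_def by (simp add: closure_Times cbox_Pair_eq)
  ultimately show ?thesis using p by (auto simp: C_def)
qed

end

section \<open>Coercivity of the first-order system\<close>

lemma sqi_Pair:
  fixes a b :: "'a \<Rightarrow> real"
  assumes "sqi M a" "sqi M b"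
  shows "sqi M (\<lambda>p. (a p, b p))"
  using assms by (auto simp: sqi_def inner_prod_def)

lemma ip_Pair:
  fixes a b c d :: "'a \<Rightarrow> real"
  assumes "sqi M a" "sqi M b" "sqi M c" "sqi M d"
  shows "ip M (\<lambda>p. (a p, b p)) (\<lambda>p. (c p, d p)) = ip M a c + ip M b d"
  using sqi_inner_integrable[OF assms(1,3)] sqi_inner_integrable[OF assms(2,4)]
  by (simp add: ip_def inner_prod_def)

lemma sqi_fst_snd:
  fixes U :: "'a \<Rightarrow> real \<times> real"
  assumes "sqi M U"
  shows "sqi M (\<lambda>p. fst (U p))" "sqi M (\<lambda>p. snd (U p))"
proof -
  have [measurable]: "U \<in> M \<rightarrow>\<^sub>M borel \<Otimes>\<^sub>M borel"
    using sqi_measurable[OF assms] by (simp add: borel_prod)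
  have m: "(\<lambda>p. fst (U p)) \<in> borel_measurable M" "(\<lambda>p. snd (U p)) \<in> borel_measurable M"
    by measurable
  have I: "integrable M (\<lambda>x. U x \<bullet> U x)" using assms by (simp add: sqi_def)
  have le: "norm (a * a) \<le> norm (a * a + b * b)" "norm (b * b) \<le> norm (a * a + b * b)" for a b :: real
    by (simp_all add: abs_of_nonneg)
  have i1: "integrable M (\<lambda>p. fst (U p) * fst (U p))"
    by (rule Bochner_Integration.integrable_bound[OF I borel_measurable_times[OF m(1) m(1)]])
      (rule AE_I2, simp only: inner_prod_def inner_real_def, rule le)
  have i2: "integrable M (\<lambda>p. snd (U p) * snd (U p))"
    by (rule Bochner_Integration.integrable_bound[OF I borel_measurable_times[OF m(2) m(2)]])
      (rule AE_I2, simp only: inner_prod_def inner_real_def, rule le)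
  from i1 i2 show "sqi M (\<lambda>p. fst (U p))" "sqi M (\<lambda>p. snd (U p))" using m by (auto simp: sqi_def)
qed

text \<open>The bounds on \<open>k\<close> hold at every point, also outside the interval, which
  keeps null sets out of the algebra; the main theorem reaches this situation by truncating its
  coefficient.\<close>

locale beam = rectangle L T for L T :: real +
  fixes k :: "real \<Rightarrow> real" and k0 K :: real
  assumes k_measurable: "k \<in> borel_measurable (lebesgue_on {0<..<L})"
    and k0: "0 < k0" and k_bounds: "\<And>x. k0 \<le> k x" "\<And>x. k x \<le> K"
begin

abbreviation "X \<equiv> lebesgue_on {0<..<L}"

lemma finite_X: "finite_measure X"
  unfolding interval_eq_box by (rule finite_measure_box)

lemma k_pos: "0 < k x" using k0 k_bounds(1)[of x] by simp
lemma K_pos: "0 < K" using k_pos[of 0] k_bounds(2)[of 0] by simp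

lemma sqi_k: "sqi M g \<Longrightarrow> sqi M (\<lambda>p. k (fst p) * g p)"
  by (rule sqi_mult_bounded[OF _ measurable_fst_Omega[OF k_measurable], where B=K])
    (use k_pos k_bounds in \<open>auto simp: abs_of_pos\<close>)

lemma weak_form:
  assumes "u \<in> H21hat L T" "\<eta> \<in> H21hat L T"
  shows "(LINT p|M. - (Dt L T u p * Dt L T \<eta> p) + k (fst p) * Dxx L T u p * Dxx L T \<eta> p) =
    - ip M (Dt L T u) (Dt L T \<eta>) + ip M (\<lambda>p. k (fst p) * Dxx L T u p) (Dxx L T \<eta>)"
proof -
  have s: "sqi M (Dt L T u)" "sqi M (Dt L T \<eta>)" "sqi M (Dxx L T u)" "sqi M (Dxx L T \<eta>)"
    using H21hat_weak[OF assms(1)] H21hat_weak[OF assms(2)] by (auto simp: weak_t_def weak_x_def)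
  show ?thesis
    using sqi_inner_integrable[OF s(1,2)] sqi_inner_integrable[OF sqi_k[OF s(3)] s(4)]
    by (simp add: ip_def)
qed

lemma weak_solution_iff:
  "weak_solution L T k w v F u \<longleftrightarrow> u \<in> H21hat L T \<and> (\<forall>x\<in>{0<..<L}. u (x, 0) = w x) \<and>
    (\<forall>\<eta>\<in>H21hat L T. (\<forall>x\<in>{0<..<L}. \<eta> (x, T) = 0) \<longrightarrow>
      - ip M (Dt L T u) (Dt L T \<eta>) + ip M (\<lambda>p. k (fst p) * Dxx L T u p) (Dxx L T \<eta>) =
      ip M \<eta> F + ip X v (\<lambda>x. \<eta> (x, 0)))"
  unfolding weak_solution_def using weak_form by (auto simp: ip_def)

text \<open>Both test components vanish laterally: for \<open>\<phi>\<close> this encodes the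
  condition on \<open>k q\<close>, that is on the second derivative of \<open>u\<close>, and for
  \<open>\<psi>\<close> the condition on \<open>p\<close>. Vanishing at \<open>T\<close> leaves the
  final values free.\<close>

definition adm :: "(jet \<Rightarrow> real \<times> real \<Rightarrow> real) \<Rightarrow> bool" where
  "adm \<phi> \<longleftrightarrow> nice L \<phi> \<and> (\<forall>x. \<phi> J0 (x, T) = 0)"

lemma adm_nice: "adm \<phi> \<Longrightarrow> nice L \<phi>" by (simp add: adm_def)

lemma adm_lincomb: "adm \<phi> \<Longrightarrow> adm \<psi> \<Longrightarrow> adm (\<lambda>i p. \<phi> i p + c * \<psi> i p)"
  by (simp add: adm_def nice_lincomb)

lemma adm_zero: "adm (\<lambda>i p. 0)"
  by (simp add: adm_def nice_zero)

lemma adm_jC: "adm (jC i)"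
  by (simp add: adm_def nice_jC jC_T)

lemma trace_sqi: "nice L \<phi> \<Longrightarrow> sqi X (\<lambda>x. \<phi> J0 (x, 0))"
  by (intro slice_sqi niceD)

text \<open>\<open>S1\<close> and \<open>S2\<close> form the formal adjoint: the factors of
  \<open>p\<close> and \<open>q\<close> after all derivatives of the tested system have been moved
  to \<open>(\<phi>, \<psi>)\<close>.\<close>

definition S1 :: "(jet \<Rightarrow> real \<times> real \<Rightarrow> real) \<Rightarrow> (jet \<Rightarrow> real \<times> real \<Rightarrow> real) \<Rightarrow> real \<times> real \<Rightarrow> real" where
  "S1 \<phi> \<psi> p = - \<phi> Jt p - \<psi> Jxx p"
definition S2 :: "(jet \<Rightarrow> real \<times> real \<Rightarrow> real) \<Rightarrow> (jet \<Rightarrow> real \<times> real \<Rightarrow> real) \<Rightarrow> real \<times> real \<Rightarrow> real" where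
  "S2 \<phi> \<psi> p = - \<psi> Jt p + k (fst p) * \<phi> Jxx p"

lemma sqi_S:
  assumes "nice L \<phi>" "nice L \<psi>" shows "sqi M (S1 \<phi> \<psi>)" "sqi M (S2 \<phi> \<psi>)"
  unfolding S1_def[abs_def] S2_def[abs_def]
  by (intro sqi_diff sqi_minus sqi_add sqi_k nice_sqi assms)+

definition kinv :: "real \<Rightarrow> real" where "kinv x = 1 / k x"

lemma kinv: "0 < kinv x" "kinv x \<le> 1 / k0" "1 \<le> K * kinv x" "k x * kinv x = 1"
  using k_pos[of x] k0 k_bounds[of x] by (auto simp: kinv_def field_simps)

lemma kinv_measurable: "kinv \<in> borel_measurable X"
  unfolding kinv_def[abs_def] using k_measurable by measurable

lemma kinv_integrable: "integrable X kinv"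
proof -
  have "sqi X kinv"
    by (rule sqi_bounded[OF finite_X kinv_measurable, where B="1 / k0"])
      (use kinv in \<open>auto simp: abs_of_pos\<close>)
  then show ?thesis by (rule sqi_integrable[OF finite_X])
qed

text \<open>The integrand is the time derivative of \<open>(1 + t) \<phi>\<^sup>2\<close> times
  \<open>g\<close>. Only the initial value survives, with weight 1.\<close>

lemma energy_part:
  assumes g: "integrable X g" and \<phi>: "adm \<phi>"
  shows "(LINT p|M. g (fst p) * ((1 + snd p) * (2 * \<phi> J0 p * \<phi> Jt p) + (\<phi> J0 p)\<^sup>2)) =
    - (LINT x|X. g x * (\<phi> J0 (x, 0))\<^sup>2)"
proof -
  note D = adm_nice[OF \<phi>]
  have "(LINT p|M. g (fst p) * ((1 + snd p) * (2 * \<phi> J0 p * \<phi> Jt p) + (\<phi> J0 p)\<^sup>2)) =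
    (LINT x|X. g x * ((1 + snd (x, T)) * (\<phi> J0 (x, T))\<^sup>2 - (1 + snd (x, 0)) * (\<phi> J0 (x, 0))\<^sup>2))"
  proof (rule integral_Omega_dt[OF g, where H="\<lambda>p. (1 + snd p) * (\<phi> J0 p)\<^sup>2"])
    show "((\<lambda>s. (1 + snd (x, s)) * (\<phi> J0 (x, s))\<^sup>2) has_real_derivative
      (1 + snd (x, t)) * (2 * \<phi> J0 (x, t) * \<phi> Jt (x, t)) + (\<phi> J0 (x, t))\<^sup>2) (at t)" for x t
    proof -
      have "((\<lambda>s. (\<phi> J0 (x, s))\<^sup>2) has_real_derivative 2 * \<phi> J0 (x, t) * \<phi> Jt (x, t)) (at t)"
        by (rule DERIV_cong[OF DERIV_power[OF niceD(2)[OF D]]]) simp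
      moreover have "((\<lambda>s. 1 + s) has_real_derivative 1) (at t)" by (auto intro!: derivative_eq_intros)
      ultimately show ?thesis by (auto intro!: DERIV_cong[OF DERIV_mult])
    qed
    show "continuous_on UNIV (\<lambda>p. (1 + snd p) * (2 * \<phi> J0 p * \<phi> Jt p) + (\<phi> J0 p)\<^sup>2)"
      by (intro continuous_intros niceD[OF D])
  qed (use T in simp)
  then show ?thesis using \<phi> by (simp add: adm_def)
qed

text \<open>The energy of a test pair: squares over the rectangle from the derivative of the weight,
  squares at time 0 from the boundary term, with \<open>\<psi>\<close> weighted by
  \<open>1 / k\<close>.\<close>

definition Z :: "(jet \<Rightarrow> real \<times> real \<Rightarrow> real) \<Rightarrow> (jet \<Rightarrow> real \<times> real \<Rightarrow> real) \<Rightarrow> real" where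
  "Z \<phi> \<psi> = nsq M (\<phi> J0) + (LINT p|M. kinv (fst p) * (\<psi> J0 p)\<^sup>2) +
     nsq X (\<lambda>x. \<phi> J0 (x, 0)) + (LINT x|X. kinv x * (\<psi> J0 (x, 0))\<^sup>2)"

lemma Z_parts:
  assumes "nice L \<psi>"
  shows "0 \<le> (LINT p|M. kinv (fst p) * (\<psi> J0 p)\<^sup>2)" "0 \<le> (LINT x|X. kinv x * (\<psi> J0 (x, 0))\<^sup>2)"
    "nsq X (\<lambda>x. \<psi> J0 (x, 0)) \<le> K * (LINT x|X. kinv x * (\<psi> J0 (x, 0))\<^sup>2)"
proof -
  show "0 \<le> (LINT p|M. kinv (fst p) * (\<psi> J0 p)\<^sup>2)" "0 \<le> (LINT x|X. kinv x * (\<psi> J0 (x, 0))\<^sup>2)"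
    using kinv(1) by (auto intro!: integral_nonneg_AE AE_I2 mult_nonneg_nonneg simp: less_imp_le)
  have sq: "integrable X (\<lambda>x. (\<psi> J0 (x, 0))\<^sup>2)"
    using trace_sqi[OF assms] by (simp add: sqi_def power2_eq_square)
  have I: "integrable X (\<lambda>x. kinv x * (\<psi> J0 (x, 0))\<^sup>2)"
  proof -
    have "sqi X (\<lambda>x. kinv x * \<psi> J0 (x, 0))"
      by (rule sqi_mult_bounded[OF trace_sqi[OF assms] kinv_measurable, where B="1 / k0"])
        (use kinv in \<open>auto simp: abs_of_pos\<close>)
    from sqi_inner_integrable[OF this trace_sqi[OF assms]] show ?thesis
      by (simp add: power2_eq_square mult.assoc)
  qed
  have "nsq X (\<lambda>x. \<psi> J0 (x, 0)) \<le> (LINT x|X. K * (kinv x * (\<psi> J0 (x, 0))\<^sup>2))"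
    unfolding nsq_real
  proof (rule integral_mono)
    show "(\<psi> J0 (x, 0))\<^sup>2 \<le> K * (kinv x * (\<psi> J0 (x, 0))\<^sup>2)" for x
      using mult_right_mono[OF kinv(3)[of x], of "(\<psi> J0 (x, 0))\<^sup>2"] by (simp add: mult.assoc)
  qed (use sq I in auto)
  then show "nsq X (\<lambda>x. \<psi> J0 (x, 0)) \<le> K * (LINT x|X. kinv x * (\<psi> J0 (x, 0))\<^sup>2)" by simp
qed

definition Y1 :: "(jet \<Rightarrow> real \<times> real \<Rightarrow> real) \<Rightarrow> real \<times> real \<Rightarrow> real" where
  "Y1 \<phi> p = (1 + snd p) * \<phi> J0 p"
definition Y2 :: "(jet \<Rightarrow> real \<times> real \<Rightarrow> real) \<Rightarrow> real \<times> real \<Rightarrow> real" where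
  "Y2 \<psi> p = (1 + snd p) * (kinv (fst p) * \<psi> J0 p)"

lemma kinv_M: "(\<lambda>p. kinv (fst p)) \<in> borel_measurable M"
  by (rule measurable_fst_Omega[OF kinv_measurable])

lemma sqi_kinv: "sqi M g \<Longrightarrow> sqi M (\<lambda>p. kinv (fst p) * g p)"
  by (rule sqi_mult_bounded[OF _ kinv_M, where B="1 / k0"])
    (use kinv in \<open>auto simp: abs_of_pos\<close>)

lemma time_weight: "(\<lambda>p::real \<times> real. 1 + snd p) \<in> borel_measurable M" "AE p in M. \<bar>1 + snd p\<bar> \<le> 1 + T"
proof -
  show "(\<lambda>p::real \<times> real. 1 + snd p) \<in> borel_measurable M"
    unfolding Omega_eq_box by (intro continuous_measurable_box continuous_intros)
  show "AE p in M. \<bar>1 + snd p\<bar> \<le> 1 + T"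
    by (rule AE_I2) (auto simp: space_restrict_space Omega_def)
qed

lemma sqi_Y:
  assumes "nice L \<phi>" shows "sqi M (Y1 \<phi>)" "sqi M (Y2 \<phi>)"
  unfolding Y1_def[abs_def] Y2_def[abs_def]
  by (intro sqi_mult_bounded[OF _ time_weight] sqi_kinv nice_sqi assms)+

text \<open>The first-order system tested against \<open>(1 + t) (\<phi>, \<psi> / k)\<close>: the spatial
  terms cancel and the time derivatives leave a definite quadratic form.\<close>

lemma energy_identity:
  assumes \<phi>: "adm \<phi>" and \<psi>: "adm \<psi>"
  shows "2 * (ip M (S1 \<phi> \<psi>) (Y1 \<phi>) + ip M (S2 \<phi> \<psi>) (Y2 \<psi>)) = Z \<phi> \<psi>"
proof -
  note D = adm_nice[OF \<phi>] and D' = adm_nice[OF \<psi>]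
  define A where "A p = 1 * ((1 + snd p) * (2 * \<phi> J0 p * \<phi> Jt p) + (\<phi> J0 p)\<^sup>2)" for p
  define B where "B p = kinv (fst p) * ((1 + snd p) * (2 * \<psi> J0 p * \<psi> Jt p) + (\<psi> J0 p)\<^sup>2)" for p
  define C where "C p = (1 + snd p) * (\<phi> Jxx p * \<psi> J0 p - \<psi> Jxx p * \<phi> J0 p)" for p
  have cA: "continuous_on UNIV (\<lambda>p. (1 + snd p) * (2 * \<phi> J0 p * \<phi> Jt p) + (\<phi> J0 p)\<^sup>2)"
    and cB: "continuous_on UNIV (\<lambda>p. (1 + snd p) * (2 * \<psi> J0 p * \<psi> Jt p) + (\<psi> J0 p)\<^sup>2)"
    and cC: "continuous_on UNIV C" and c2: "continuous_on UNIV (\<lambda>p. (\<phi> J0 p)\<^sup>2)"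
    and c3: "continuous_on UNIV (\<lambda>p. (\<psi> J0 p)\<^sup>2)"
    unfolding C_def by (intro continuous_intros niceD[OF D] niceD[OF D'])+
  have i1: "integrable X (\<lambda>_. 1::real)" by (rule integrable_const_interval)
  have A: "integrable M A" "(LINT p|M. A p) = - nsq X (\<lambda>x. \<phi> J0 (x, 0))"
    using fubini_fst_mult(1)[OF i1 cA, of T] energy_part[OF i1 \<phi>] by (simp_all add: A_def[abs_def] nsq_real)
  have B: "integrable M B" "(LINT p|M. B p) = - (LINT x|X. kinv x * (\<psi> J0 (x, 0))\<^sup>2)"
    using fubini_fst_mult(1)[OF kinv_integrable cB, of T] energy_part[OF kinv_integrable \<psi>] by (simp_all add: B_def[abs_def])
  have C: "integrable M C" "(LINT p|M. C p) = 0"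
  proof -
    show "integrable M C" by (rule fubini_continuous(1)[OF cC])
    \<comment> \<open>An antiderivative in \<open>x\<close> of the spatial terms: the products of
      first derivatives cancel, and \<open>H\<close> vanishes on the lateral sides.\<close>
    define H where "H p = (1 + snd p) * (\<phi> Jx p * \<psi> J0 p - \<psi> Jx p * \<phi> J0 p)" for p
    have "(LINT p|M. C p) = (LINT t|lebesgue_on {0<..<T}. H (L, t) - H (0, t))"
    proof (rule integral_Omega_dx[where H=H and Hx=C])
      show "continuous_on UNIV C" by (rule cC)
      show "((\<lambda>y. H (y, t)) has_real_derivative C (x, t)) (at x)" for x t
      proof -
        have "((\<lambda>y. \<phi> Jx (y, t) * \<psi> J0 (y, t) - \<psi> Jx (y, t) * \<phi> J0 (y, t)) has_real_derivative
          \<phi> Jxx (x, t) * \<psi> J0 (x, t) - \<psi> Jxx (x, t) * \<phi> J0 (x, t)) (at x)"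
          by (rule DERIV_cong[OF DERIV_diff[OF DERIV_mult[OF niceD(4)[OF D] niceD(3)[OF D']]
              DERIV_mult[OF niceD(4)[OF D'] niceD(3)[OF D]]]]) simp
        from DERIV_cmult[OF this, of "1 + t"] show ?thesis by (simp add: C_def H_def)
      qed
    qed (use L in simp)
    also have "\<dots> = 0" by (simp add: H_def niceD(7,8)[OF D] niceD(7,8)[OF D'])
    finally show "(LINT p|M. C p) = 0" .
  qed
  have I2: "integrable M (\<lambda>p. (\<phi> J0 p)\<^sup>2)" by (rule fubini_continuous(1)[OF c2])
  have I3: "integrable M (\<lambda>p. kinv (fst p) * (\<psi> J0 p)\<^sup>2)" by (rule fubini_fst_mult(1)[OF kinv_integrable c3])
  have pw: "2 * (S1 \<phi> \<psi> p * Y1 \<phi> p) + 2 * (S2 \<phi> \<psi> p * Y2 \<psi> p) =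
    - A p - B p + 2 * C p + (\<phi> J0 p)\<^sup>2 + kinv (fst p) * (\<psi> J0 p)\<^sup>2" for p
  proof -
    \<comment> \<open>The factor \<open>1 / k\<close> in the multiplier removes \<open>k\<close>
      from this term, so the spatial terms form an exact derivative although \<open>k\<close> is not
      differentiable.\<close>
    have "k (fst p) * \<phi> Jxx p * ((1 + snd p) * (kinv (fst p) * \<psi> J0 p)) =
      (k (fst p) * kinv (fst p)) * (\<phi> Jxx p * ((1 + snd p) * \<psi> J0 p))" by (simp only: mult_ac)
    then have "k (fst p) * \<phi> Jxx p * ((1 + snd p) * (kinv (fst p) * \<psi> J0 p)) = \<phi> Jxx p * ((1 + snd p) * \<psi> J0 p)"
      by (simp only: kinv(4) mult_1)
    then show ?thesis
      by (simp add: S1_def S2_def Y1_def Y2_def A_def B_def C_def algebra_simps power2_eq_square)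
  qed
  have "2 * (ip M (S1 \<phi> \<psi>) (Y1 \<phi>) + ip M (S2 \<phi> \<psi>) (Y2 \<psi>)) =
    (LINT p|M. 2 * (S1 \<phi> \<psi> p * Y1 \<phi> p) + 2 * (S2 \<phi> \<psi> p * Y2 \<psi> p))"
    using sqi_inner_integrable[OF sqi_S(1)[OF D D'] sqi_Y(1)[OF D]] sqi_inner_integrable[OF sqi_S(2)[OF D D'] sqi_Y(2)[OF D']]
    by (simp add: ip_def)
  also have "\<dots> = (LINT p|M. - A p - B p + 2 * C p + (\<phi> J0 p)\<^sup>2 + kinv (fst p) * (\<psi> J0 p)\<^sup>2)"
    by (simp only: pw)
  also have "\<dots> = Z \<phi> \<psi>" using A B C I2 I3 by (simp add: Z_def nsq_real)
  finally show ?thesis .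
qed

text \<open>The energy identity gives \<open>Z\<close> as twice the pairing of the adjoint with the
  multiplier, whose norm is at most \<open>(1 + T) sqrt (1 + 1 / k0) sqrt Z\<close>. Cauchy-Schwarz
  and division by \<open>sqrt Z\<close> leave this constant.\<close>

definition C2 :: real where "C2 = 2 * (1 + T) * sqrt (1 + 1 / k0)"

lemma C2_nonneg: "0 \<le> C2" using T k0 by (simp add: C2_def)

lemma coercivity:
  assumes \<phi>: "adm \<phi>" and \<psi>: "adm \<psi>"
  shows "0 \<le> Z \<phi> \<psi>" "sqrt (Z \<phi> \<psi>) \<le> C2 * sqrt (nsq M (\<lambda>p. (S1 \<phi> \<psi> p, S2 \<phi> \<psi> p)))"
proof -
  note D = adm_nice[OF \<phi>] and D' = adm_nice[OF \<psi>]
  note s = sqi_Pair[OF sqi_S[OF D D']] and y = sqi_Pair[OF sqi_Y(1)[OF D] sqi_Y(2)[OF D']]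
  show Z0: "0 \<le> Z \<phi> \<psi>" unfolding Z_def using Z_parts[OF D'] by (simp add: nsq_nonneg add_nonneg_nonneg)
  let ?I = "LINT p|M. kinv (fst p) * (\<psi> J0 p)\<^sup>2"
  have "nsq M (Y1 \<phi>) \<le> (1 + T)\<^sup>2 * nsq M (\<phi> J0)"
    unfolding Y1_def[abs_def] by (rule nsq_mult_bounded[OF nice_sqi[OF D] time_weight])
  moreover have "nsq M (Y2 \<psi>) \<le> (1 + T)\<^sup>2 * (1 / k0 * ?I)"
  proof -
    have "nsq M (Y2 \<psi>) \<le> (1 + T)\<^sup>2 * nsq M (\<lambda>p. kinv (fst p) * \<psi> J0 p)"
      unfolding Y2_def[abs_def] by (rule nsq_mult_bounded[OF sqi_kinv[OF nice_sqi[OF D']] time_weight])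
    moreover have "nsq M (\<lambda>p. kinv (fst p) * \<psi> J0 p) \<le> (LINT p|M. 1 / k0 * (kinv (fst p) * (\<psi> J0 p)\<^sup>2))"
      unfolding nsq_real
    proof (rule integral_mono)
      have s1: "sqi M (\<lambda>p. kinv (fst p) * \<psi> J0 p)" by (rule sqi_kinv[OF nice_sqi[OF D']])
      show "integrable M (\<lambda>p. (kinv (fst p) * \<psi> J0 p)\<^sup>2)"
        using s1 by (simp add: sqi_def power2_eq_square)
      show "integrable M (\<lambda>p. 1 / k0 * (kinv (fst p) * (\<psi> J0 p)\<^sup>2))"
        using sqi_inner_integrable[OF s1 nice_sqi[OF D', of T J0]] by (simp add: power2_eq_square mult.assoc)
      show "(kinv (fst p) * \<psi> J0 p)\<^sup>2 \<le> 1 / k0 * (kinv (fst p) * (\<psi> J0 p)\<^sup>2)" for p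
      proof -
        have nn: "0 \<le> kinv (fst p) * (\<psi> J0 p)\<^sup>2" using kinv(1)[of "fst p"] by simp
        have eq: "(kinv (fst p) * \<psi> J0 p)\<^sup>2 = kinv (fst p) * (kinv (fst p) * (\<psi> J0 p)\<^sup>2)"
          by (simp add: power2_eq_square mult_ac)
        show ?thesis unfolding eq by (rule mult_right_mono[OF kinv(2) nn])
      qed
    qed
    ultimately show ?thesis
      using mult_left_mono[of "nsq M (\<lambda>p. kinv (fst p) * \<psi> J0 p)" "1 / k0 * ?I" "(1 + T)\<^sup>2"] by simp
  qed
  ultimately have "nsq M (\<lambda>p. (Y1 \<phi> p, Y2 \<psi> p)) \<le> (1 + T)\<^sup>2 * (nsq M (\<phi> J0) + 1 / k0 * ?I)"
    unfolding nsq_def ip_Pair[OF sqi_Y(1)[OF D] sqi_Y(2)[OF D'] sqi_Y(1)[OF D] sqi_Y(2)[OF D']]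
    by (simp add: distrib_left)
  also have "\<dots> \<le> (1 + T)\<^sup>2 * ((1 + 1 / k0) * Z \<phi> \<psi>)"
  proof (rule mult_left_mono)
    have a: "nsq M (\<phi> J0) \<le> Z \<phi> \<psi>" "?I \<le> Z \<phi> \<psi>"
      unfolding Z_def using Z_parts[OF D'] nsq_nonneg[of M "\<phi> J0"] nsq_nonneg[of X "\<lambda>x. \<phi> J0 (x, 0)"] by linarith+
    then show "nsq M (\<phi> J0) + 1 / k0 * ?I \<le> (1 + 1 / k0) * Z \<phi> \<psi>"
      using mult_left_mono[OF a(2), of "1 / k0"] k0 by (simp add: distrib_right)
  qed simp
  finally have ny: "sqrt (nsq M (\<lambda>p. (Y1 \<phi> p, Y2 \<psi> p))) \<le> (1 + T) * (sqrt (1 + 1 / k0) * sqrt (Z \<phi> \<psi>))"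
  proof (rule order.trans[OF real_sqrt_le_mono])
    have "0 \<le> 1 + 1 / k0" using k0 by simp
    then show "sqrt ((1 + T)\<^sup>2 * ((1 + 1 / k0) * Z \<phi> \<psi>)) \<le> (1 + T) * (sqrt (1 + 1 / k0) * sqrt (Z \<phi> \<psi>))"
      using T by (simp only: real_sqrt_mult real_sqrt_abs)
  qed
  have "Z \<phi> \<psi> = 2 * ip M (\<lambda>p. (S1 \<phi> \<psi> p, S2 \<phi> \<psi> p)) (\<lambda>p. (Y1 \<phi> p, Y2 \<psi> p))"
    using energy_identity[OF \<phi> \<psi>] ip_Pair[OF sqi_S[OF D D'] sqi_Y(1)[OF D] sqi_Y(2)[OF D']] by simp
  also have "\<dots> \<le> 2 * (sqrt (nsq M (\<lambda>p. (S1 \<phi> \<psi> p, S2 \<phi> \<psi> p))) * sqrt (nsq M (\<lambda>p. (Y1 \<phi> p, Y2 \<psi> p))))"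
    using ip_abs_le[OF s y] by simp
  also have "\<dots> \<le> 2 * (sqrt (nsq M (\<lambda>p. (S1 \<phi> \<psi> p, S2 \<phi> \<psi> p))) * ((1 + T) * (sqrt (1 + 1 / k0) * sqrt (Z \<phi> \<psi>))))"
    by (intro mult_left_mono ny) (auto simp: nsq_nonneg)
  also have "\<dots> = C2 * sqrt (nsq M (\<lambda>p. (S1 \<phi> \<psi> p, S2 \<phi> \<psi> p))) * sqrt (Z \<phi> \<psi>)"
    by (simp add: C2_def)
  finally have "sqrt (Z \<phi> \<psi>) * sqrt (Z \<phi> \<psi>) \<le> C2 * sqrt (nsq M (\<lambda>p. (S1 \<phi> \<psi> p, S2 \<phi> \<psi> p))) * sqrt (Z \<phi> \<psi>)"
    using Z0 by simp
  moreover have "0 \<le> C2 * sqrt (nsq M (\<lambda>p. (S1 \<phi> \<psi> p, S2 \<phi> \<psi> p)))" using C2_nonneg by (simp add: nsq_nonneg)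
  ultimately show "sqrt (Z \<phi> \<psi>) \<le> C2 * sqrt (nsq M (\<lambda>p. (S1 \<phi> \<psi> p, S2 \<phi> \<psi> p)))"
    using Z0 by (cases "Z \<phi> \<psi> = 0") (auto intro: mult_right_le_imp_le[where c="sqrt (Z \<phi> \<psi>)"])
qed

text \<open>The traces and integrals of \<open>\<phi>\<close> are bounded by \<open>sqrt Z\<close>
  directly; the trace of \<open>\<psi>\<close> costs \<open>sqrt K\<close> because \<open>Z\<close>
  contains it with weight \<open>1 / k\<close>.\<close>

definition C1 :: real where "C1 = (1 + sqrt K) * C2"

lemma C1_nonneg: "0 \<le> C1" using C2_nonneg K_pos by (simp add: C1_def)

definition data_norm :: "(real \<times> real \<Rightarrow> real) \<Rightarrow> (real \<Rightarrow> real) \<Rightarrow> (real \<Rightarrow> real) \<Rightarrow> real" where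
  "data_norm F v w2 = sqrt (nsq M F) + sqrt (nsq X v) + sqrt (nsq X w2)"

text \<open>The right side of the tested system: \<open>v\<close> enters as the initial value of
  \<open>p = u\<^sub>t\<close> and \<open>w2\<close> as that of
  \<open>q = u\<^sub>x\<^sub>x\<close>.\<close>

definition load :: "(real \<times> real \<Rightarrow> real) \<Rightarrow> (real \<Rightarrow> real) \<Rightarrow> (real \<Rightarrow> real) \<Rightarrow>
    (jet \<Rightarrow> real \<times> real \<Rightarrow> real) \<Rightarrow> (jet \<Rightarrow> real \<times> real \<Rightarrow> real) \<Rightarrow> real" where
  "load F v w2 \<phi> \<psi> = ip M F (\<phi> J0) + ip X v (\<lambda>x. \<phi> J0 (x, 0)) + ip X w2 (\<lambda>x. \<psi> J0 (x, 0))"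

lemma load_bound:
  assumes \<phi>: "adm \<phi>" and \<psi>: "adm \<psi>" and F: "sqi M F" and v: "sqi X v" and w2: "sqi X w2"
  shows "\<bar>load F v w2 \<phi> \<psi>\<bar> \<le> C1 * data_norm F v w2 * sqrt (nsq M (\<lambda>p. (S1 \<phi> \<psi> p, S2 \<phi> \<psi> p)))"
proof -
  note D = adm_nice[OF \<phi>] and D' = adm_nice[OF \<psi>]
  define z where "z = sqrt (Z \<phi> \<psi>)"
  have z0: "0 \<le> z" using coercivity(1)[OF \<phi> \<psi>] by (simp add: z_def)
  have nn: "0 \<le> nsq M (\<phi> J0)" "0 \<le> nsq X (\<lambda>x. \<phi> J0 (x, 0))" by (rule nsq_nonneg)+
  have "nsq M (\<phi> J0) \<le> Z \<phi> \<psi>" "nsq X (\<lambda>x. \<phi> J0 (x, 0)) \<le> Z \<phi> \<psi>"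
    "(LINT x|X. kinv x * (\<psi> J0 (x, 0))\<^sup>2) \<le> Z \<phi> \<psi>"
    unfolding Z_def using Z_parts[OF D'] nn by linarith+
  then have a: "sqrt (nsq M (\<phi> J0)) \<le> z" "sqrt (nsq X (\<lambda>x. \<phi> J0 (x, 0))) \<le> z"
    "K * (LINT x|X. kinv x * (\<psi> J0 (x, 0))\<^sup>2) \<le> K * Z \<phi> \<psi>"
    using K_pos by (auto simp: z_def)
  have b: "sqrt (nsq X (\<lambda>x. \<psi> J0 (x, 0))) \<le> sqrt K * z"
    unfolding z_def real_sqrt_mult[symmetric] using Z_parts(3)[OF D'] a(3) by simp
  have K1: "1 \<le> 1 + sqrt K" "sqrt K \<le> 1 + sqrt K" using K_pos by auto
  have "\<bar>load F v w2 \<phi> \<psi>\<bar> \<le> sqrt (nsq M F) * sqrt (nsq M (\<phi> J0)) +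
    sqrt (nsq X v) * sqrt (nsq X (\<lambda>x. \<phi> J0 (x, 0))) + sqrt (nsq X w2) * sqrt (nsq X (\<lambda>x. \<psi> J0 (x, 0)))"
    using ip_abs_le[OF F nice_sqi[OF D], of J0] ip_abs_le[OF v trace_sqi[OF D]] ip_abs_le[OF w2 trace_sqi[OF D']]
    unfolding load_def by linarith
  also have "\<dots> \<le> sqrt (nsq M F) * ((1 + sqrt K) * z) + sqrt (nsq X v) * ((1 + sqrt K) * z) + sqrt (nsq X w2) * ((1 + sqrt K) * z)"
  proof (intro add_mono mult_left_mono)
    have zz: "z \<le> (1 + sqrt K) * z" "sqrt K * z \<le> (1 + sqrt K) * z"
      using mult_right_mono[OF K1(1) z0] mult_right_mono[OF K1(2) z0] by simp_all
    show "sqrt (nsq M (\<phi> J0)) \<le> (1 + sqrt K) * z" "sqrt (nsq X (\<lambda>x. \<phi> J0 (x, 0))) \<le> (1 + sqrt K) * z"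
      "sqrt (nsq X (\<lambda>x. \<psi> J0 (x, 0))) \<le> (1 + sqrt K) * z"
      using a(1,2) b zz by linarith+
  qed (auto simp: nsq_nonneg)
  also have "\<dots> = data_norm F v w2 * (1 + sqrt K) * z"
    by (simp add: data_norm_def algebra_simps)
  also have "\<dots> \<le> data_norm F v w2 * (1 + sqrt K) * (C2 * sqrt (nsq M (\<lambda>p. (S1 \<phi> \<psi> p, S2 \<phi> \<psi> p))))"
    unfolding z_def using K_pos
    by (intro mult_left_mono coercivity \<phi> \<psi>) (auto simp: data_norm_def nsq_nonneg intro!: mult_nonneg_nonneg add_nonneg_nonneg)
  finally show ?thesis by (simp add: C1_def mult_ac)
qed

lemma first_order_system:
  assumes F: "sqi M F" and v: "sqi X v" and w2: "sqi X w2"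
  obtains p q where "sqi M p" "sqi M q" "nsq M p + nsq M q \<le> (C1 * data_norm F v w2)\<^sup>2"
    "\<And>\<phi> \<psi>. adm \<phi> \<Longrightarrow> adm \<psi> \<Longrightarrow> ip M p (S1 \<phi> \<psi>) + ip M q (S2 \<phi> \<psi>) = load F v w2 \<phi> \<psi>"
proof -
  \<comment> \<open>The functional lives on the range of the adjoint. Coercivity, through
    \<open>load_bound\<close>, makes it well defined there and gives its norm.\<close>
  define R where "R = {((\<lambda>p. (S1 \<phi> \<psi> p, S2 \<phi> \<psi> p)), load F v w2 \<phi> \<psi>) | \<phi> \<psi>. adm \<phi> \<and> adm \<psi>}"
  have dn: "0 \<le> C1 * data_norm F v w2"
    using C1_nonneg by (auto simp: data_norm_def nsq_nonneg intro!: mult_nonneg_nonneg add_nonneg_nonneg)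
  obtain U where U: "sqi M U" "\<And>f a. (f, a) \<in> R \<Longrightarrow> ip M U f = a" "nsq M U \<le> (C1 * data_norm F v w2)\<^sup>2"
  proof (rule L2_Riesz[OF finite_M, where R=R and C="C1 * data_norm F v w2"])
    show "sqi M f" if "(f, a) \<in> R" for f a
      using that by (auto simp: R_def intro!: sqi_Pair sqi_S adm_nice)
    show "R \<noteq> {}" using adm_zero by (auto simp: R_def)
    show "((\<lambda>x. f x + c *\<^sub>R g x), a + c * b) \<in> R" if fa: "(f, a) \<in> R" and gb: "(g, b) \<in> R" for f a g b c
    proof -
      obtain \<phi> \<psi> where 1: "f = (\<lambda>p. (S1 \<phi> \<psi> p, S2 \<phi> \<psi> p))" "a = load F v w2 \<phi> \<psi>" "adm \<phi>" "adm \<psi>"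
        using fa by (auto simp: R_def)
      obtain \<phi>' \<psi>' where 2: "g = (\<lambda>p. (S1 \<phi>' \<psi>' p, S2 \<phi>' \<psi>' p))" "b = load F v w2 \<phi>' \<psi>'" "adm \<phi>'" "adm \<psi>'"
        using gb by (auto simp: R_def)
      let ?\<phi> = "\<lambda>i p. \<phi> i p + c * \<phi>' i p" and ?\<psi> = "\<lambda>i p. \<psi> i p + c * \<psi>' i p"
      have ad: "adm ?\<phi>" "adm ?\<psi>" using 1 2 by (auto intro: adm_lincomb)
      have "(\<lambda>x. f x + c *\<^sub>R g x) = (\<lambda>p. (S1 ?\<phi> ?\<psi> p, S2 ?\<phi> ?\<psi> p))"
        by (rule ext) (simp add: 1 2 S1_def S2_def algebra_simps)
      moreover have "a + c * b = load F v w2 ?\<phi> ?\<psi>"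
        using 1 2 F v w2
        by (simp add: load_def ip_add_right ip_cmult_right sqi_cmult nice_sqi trace_sqi adm_nice algebra_simps)
      ultimately show ?thesis using ad unfolding R_def by blast
    qed
    show "\<bar>a\<bar> \<le> C1 * data_norm F v w2 * sqrt (nsq M f)" if "(f, a) \<in> R" for f a
      using that by (auto simp: R_def intro!: load_bound F v w2)
    show "0 \<le> C1 * data_norm F v w2" by (rule dn)
  qed blast
  define p q where "p x = fst (U x)" and "q x = snd (U x)" for x
  have s: "sqi M p" "sqi M q" using sqi_fst_snd[OF U(1)] by (simp_all add: p_def[abs_def] q_def[abs_def])
  have Upq: "U = (\<lambda>x. (p x, q x))" by (simp add: p_def q_def)
  have "nsq M p + nsq M q \<le> (C1 * data_norm F v w2)\<^sup>2"
    using U(3) ip_Pair[OF s s] unfolding Upq nsq_def by simp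
  moreover have "ip M p (S1 \<phi> \<psi>) + ip M q (S2 \<phi> \<psi>) = load F v w2 \<phi> \<psi>" if "adm \<phi>" "adm \<psi>" for \<phi> \<psi>
  proof -
    have "((\<lambda>p. (S1 \<phi> \<psi> p, S2 \<phi> \<psi> p)), load F v w2 \<phi> \<psi>) \<in> R" using that by (auto simp: R_def)
    from U(2)[OF this] show ?thesis
      unfolding Upq using ip_Pair[OF s sqi_S[OF adm_nice[OF that(1)] adm_nice[OF that(2)]]] by simp
  qed
  ultimately show ?thesis using that s by blast
qed

end

section \<open>Existence, uniqueness and the energy estimate\<close>

lemma L2conv_unique:
  assumes "L2conv M f g" "L2conv M f h" "\<And>n. sqi M (f n)" "sqi M g" "sqi M h"
  shows "AE x in M. g x = h x"
proof -
  have "nsq M (\<lambda>x. g x - h x) \<le> 0"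
  proof (rule LIMSEQ_le_const)
    have "(\<lambda>n. 2 * nsq M (\<lambda>x. f n x - g x) + 2 * nsq M (\<lambda>x. f n x - h x)) \<longlonglongrightarrow> 2 * 0 + 2 * 0"
      using assms(1,2) unfolding L2conv_def by (intro tendsto_intros)
    then show "(\<lambda>n. 2 * nsq M (\<lambda>x. f n x - g x) + 2 * nsq M (\<lambda>x. f n x - h x)) \<longlonglongrightarrow> 0" by simp
    show "\<exists>N. \<forall>n\<ge>N. nsq M (\<lambda>x. g x - h x) \<le> 2 * nsq M (\<lambda>x. f n x - g x) + 2 * nsq M (\<lambda>x. f n x - h x)"
    proof (intro exI allI impI)
      fix n
      show "nsq M (\<lambda>x. g x - h x) \<le> 2 * nsq M (\<lambda>x. f n x - g x) + 2 * nsq M (\<lambda>x. f n x - h x)"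
        using nsq_triangle[OF assms(4) assms(3)[of n] assms(5)] nsq_diff_commute[of M g "f n"] by simp
    qed
  qed
  then have "nsq M (\<lambda>x. g x - h x) = 0" using nsq_nonneg by (metis order.antisym)
  from nsq_eq_0_AE[OF sqi_diff[OF assms(4,5)] this] show ?thesis by auto
qed

context rectangle
begin

text \<open>The coefficient enters only under the integral, so it may be replaced by a truncation
  whose bounds hold everywhere.\<close>

lemma weak_solution_cong:
  assumes "k \<in> borel_measurable (lebesgue_on {0<..<L})" "k' \<in> borel_measurable (lebesgue_on {0<..<L})"
    and ae: "AE x in lebesgue_on {0<..<L}. k x = k' x"
  shows "weak_solution L T k w v F u \<longleftrightarrow> weak_solution L T k' w v F u"
proof -
  have eq: "(LINT p|M. - (Dt L T u p * Dt L T \<eta> p) + k (fst p) * Dxx L T u p * Dxx L T \<eta> p) =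
    (LINT p|M. - (Dt L T u p * Dt L T \<eta> p) + k' (fst p) * Dxx L T u p * Dxx L T \<eta> p)"
    if u: "u \<in> H21hat L T" and \<eta>: "\<eta> \<in> H21hat L T" for \<eta>
  proof (rule integral_cong_AE)
    have [measurable]: "Dt L T u \<in> borel_measurable M" "Dt L T \<eta> \<in> borel_measurable M"
      "Dxx L T u \<in> borel_measurable M" "Dxx L T \<eta> \<in> borel_measurable M"
      using H21hat_weak[OF u] H21hat_weak[OF \<eta>] by (auto simp: weak_t_def weak_x_def sqi_def)
    have [measurable]: "(\<lambda>p. k (fst p)) \<in> borel_measurable M" "(\<lambda>p. k' (fst p)) \<in> borel_measurable M"
      by (intro measurable_fst_Omega assms)+
    show "(\<lambda>p. - (Dt L T u p * Dt L T \<eta> p) + k (fst p) * Dxx L T u p * Dxx L T \<eta> p) \<in> borel_measurable M"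
      "(\<lambda>p. - (Dt L T u p * Dt L T \<eta> p) + k' (fst p) * Dxx L T u p * Dxx L T \<eta> p) \<in> borel_measurable M"
      by measurable
    show "AE p in M. - (Dt L T u p * Dt L T \<eta> p) + k (fst p) * Dxx L T u p * Dxx L T \<eta> p =
      - (Dt L T u p * Dt L T \<eta> p) + k' (fst p) * Dxx L T u p * Dxx L T \<eta> p"
      using AE_fst[OF ae, of T] by eventually_elim simp
  qed
  show ?thesis unfolding weak_solution_def using eq by auto
qed

lemma H21_norm_eq:
  assumes "f \<in> H21hat L T"
  shows "H21_norm L T f = sqrt (nsq M f + nsq M (Dt L T f) + nsq M (Dx L T f) + nsq M (Dxx L T f))"
proof -
  have s: "sqi M f" "sqi M (Dt L T f)" "sqi M (Dx L T f)" "sqi M (Dxx L T f)"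
    using H21hat_weak[OF assms] H21hat_sqi[OF assms] by (auto simp: weak_t_def weak_x_def)
  then have "integrable M (\<lambda>p. (f p)\<^sup>2)" "integrable M (\<lambda>p. (Dt L T f p)\<^sup>2)"
    "integrable M (\<lambda>p. (Dx L T f p)\<^sup>2)" "integrable M (\<lambda>p. (Dxx L T f p)\<^sup>2)"
    by (auto simp: sqi_def power2_eq_square)
  then show ?thesis by (simp add: H21_norm_def nsq_real)
qed

text \<open>The Poincare inequalities add \<open>L^4\<close> and \<open>L^2\<close> to the
  coefficient 1 of the second derivative.\<close>

lemma H21_norm_le:
  assumes f: "f \<in> H21hat L T" and le: "nsq M (Dt L T f) + nsq M (Dxx L T f) \<le> B\<^sup>2" and B: "0 \<le> B"
  shows "H21_norm L T f \<le> sqrt (1 + L\<^sup>2 + L ^ 4) * B"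
proof -
  define a d where "a = nsq M (Dt L T f)" and "d = nsq M (Dxx L T f)"
  have nn: "0 \<le> a" "0 \<le> d" by (simp_all add: a_def d_def nsq_nonneg)
  have "nsq M f + a + nsq M (Dx L T f) + d \<le> L ^ 4 * d + a + L\<^sup>2 * d + d"
    using H21hat_Poincare[OF f] by (simp add: d_def)
  also have "\<dots> \<le> (1 + L\<^sup>2 + L ^ 4) * (a + d)"
    using nn by (simp add: algebra_simps)
  also have "\<dots> \<le> (1 + L\<^sup>2 + L ^ 4) * B\<^sup>2"
    using le by (intro mult_left_mono) (auto simp: a_def d_def)
  finally have "sqrt (nsq M f + a + nsq M (Dx L T f) + d) \<le> sqrt ((1 + L\<^sup>2 + L ^ 4) * B\<^sup>2)" by simp
  then show ?thesis using B by (simp add: H21_norm_eq[OF f] a_def d_def real_sqrt_mult)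
qed

text \<open>Members of \<open>H21hat\<close> are functions on the whole plane: two solutions that
  agree on the closed rectangle can still be different functions.\<close>

lemma weak_cong_left:
  assumes u: "u \<in> H21hat L T" and u': "u' \<in> H21hat L T" and eq: "\<And>p. p \<in> cbox (0,0) (L,T) \<Longrightarrow> u p = u' p"
  shows "AE p in M. Dt L T u p = Dt L T u' p" "AE p in M. Dxx L T u p = Dxx L T u' p"
proof -
  have eqO: "u p = u' p" if "p \<in> space M" for p
    using that by (intro eq) (auto simp: space_restrict_space Omega_def cbox_Pair_eq)
  have c: "has_weak_deriv (Omega L T) b u g \<longleftrightarrow> has_weak_deriv (Omega L T) b u' g" for b g
  proof -
    have "(LINT p|M. u p * frechet_derivative \<phi> (at p) b) = (LINT p|M. u' p * frechet_derivative \<phi> (at p) b)" for \<phi>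
      by (intro Bochner_Integration.integral_cong) (simp_all add: eqO)
    then show ?thesis by (simp add: has_weak_deriv_def)
  qed
  show "AE p in M. Dt L T u p = Dt L T u' p"
    using H21hat_weak(1)[OF u] H21hat_weak(1)[OF u'] by (intro weak_t_unique[of u]) (auto simp: weak_t_def c)
  show "AE p in M. Dxx L T u p = Dxx L T u' p"
    by (rule weak_x_unique(2)[OF H21hat_weak(2)[OF u], where gx="Dx L T u'"])
      (use H21hat_weak(2)[OF u'] in \<open>auto simp: weak_x_def c\<close>)
qed

end

context beam
begin

lemma trace_continuous:
  fixes f :: "real \<times> real \<Rightarrow> real"
  assumes "continuous_on (cbox (0,0) (L,T)) f" shows "sqi X (\<lambda>x. f (x, 0))"
proof -
  have "continuous_on (cbox 0 L) (\<lambda>x. f (x, 0))"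
    by (rule continuous_on_compose2[OF assms]) (use T in \<open>auto intro!: continuous_intros simp: cbox_Pair_eq\<close>)
  then show ?thesis unfolding interval_eq_box by (rule sqi_continuous)
qed

text \<open>Mean-square convergence on the rectangle does not see the line \<open>t = 0\<close>;
  uniform convergence up to that line does.\<close>

lemma trace_limit:
  fixes u :: "real \<times> real \<Rightarrow> real"
  assumes u: "uniform_limit (cbox (0,0) (L,T)) f u sequentially"
    and c: "\<And>N. continuous_on (cbox (0,0) (L,T)) (f N)" and v: "sqi X v"
  shows "(\<lambda>N. ip X v (\<lambda>x. f N (x, 0))) \<longlonglongrightarrow> ip X v (\<lambda>x. u (x, 0))"
proof -
  have cu: "continuous_on (cbox (0,0) (L,T)) u"
    by (rule uniform_limit_theorem[OF _ u]) (simp_all add: c)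
  have one: "sqi X (\<lambda>_. 1::real)" "nsq X (\<lambda>_. 1::real) = L"
  proof -
    show "sqi X (\<lambda>_. 1::real)" unfolding interval_eq_box by (intro sqi_continuous continuous_intros)
    have "(LINT y|X. 1) = L - 0" by (rule lebesgue_ftc) (use L in \<open>auto intro!: derivative_eq_intros\<close>)
    then show "nsq X (\<lambda>_. 1::real) = L" by (simp add: nsq_real)
  qed
  have "L2conv X (\<lambda>N x. f N (x, 0)) (\<lambda>x. u (x, 0))"
    unfolding L2conv_def
  proof (rule LIMSEQ_I)
    fix r :: real assume r: "r > 0"
    define e where "e = sqrt (r / (2 * L))"
    have e: "e > 0" "e\<^sup>2 * L = r / 2" using r L by (auto simp: e_def)
    have "\<forall>\<^sub>F N in sequentially. \<forall>p\<in>cbox (0,0) (L,T). dist (f N p) (u p) < e" by (rule uniform_limitD[OF u e(1)])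
    then have "\<forall>\<^sub>F N in sequentially. norm (nsq X (\<lambda>x. f N (x, 0) - u (x, 0)) - 0) < r"
    proof eventually_elim
      case (elim N)
      have "nsq X (\<lambda>x. (f N (x, 0) - u (x, 0)) * 1) \<le> e\<^sup>2 * nsq X (\<lambda>_. 1::real)"
      proof (rule nsq_mult_bounded[OF one(1)])
        show "(\<lambda>x. f N (x, 0) - u (x, 0)) \<in> borel_measurable X"
          using sqi_diff[OF trace_continuous[OF c] trace_continuous[OF cu]] by (rule sqi_measurable)
        show "AE x in X. \<bar>f N (x, 0) - u (x, 0)\<bar> \<le> e"
        proof (rule AE_I2)
          fix x assume "x \<in> space X"
          then have "(x, 0) \<in> cbox (0,0) (L,T)" using T by (simp add: space_restrict_space cbox_Pair_eq)
          then show "\<bar>f N (x, 0) - u (x, 0)\<bar> \<le> e" using elim by (force simp: dist_real_def)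
        qed
      qed
      then show ?case using e r one(2) nsq_nonneg[of X "\<lambda>x. f N (x, 0) - u (x, 0)"] by simp
    qed
    then show "\<exists>no. \<forall>N\<ge>no. norm (nsq X (\<lambda>x. f N (x, 0) - u (x, 0)) - 0) < r" by (simp add: eventually_sequentially)
  qed
  from L2conv_ip[OF this trace_continuous[OF c] trace_continuous[OF cu] v]
  show ?thesis by (simp add: ip_commute)
qed

text \<open>The weak formulation prescribes values on the open interval; the lateral condition
  supplies the two corners.\<close>

lemma trace_zero:
  assumes f: "f \<in> H21hat L T" and t: "t = 0 \<or> t = T" and z: "\<forall>x\<in>{0<..<L}. f (x, t) = 0"
    and x: "0 \<le> x" "x \<le> L"
  shows "f (x, t) = 0"
proof -
  have "f (0, t) = 0 \<and> f (L, t) = 0" using t T by (intro H21hat_boundary[OF f]) auto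
  moreover have "x = 0 \<or> x = L \<or> x \<in> {0<..<L}" using x by auto
  ultimately show ?thesis using z by auto
qed

text \<open>The partial sums of \<open>\<eta>\<close> in the family \<open>jC\<close> are
  admissible, and each term of the equation converges along them.\<close>

lemma test_extension:
  assumes p: "sqi M p" and q: "sqi M q" and F: "sqi M F" and v: "sqi X v"
    and sys: "\<And>\<phi>. adm \<phi> \<Longrightarrow> - ip M p (\<phi> Jt) + ip M q (\<phi> Jxx) = ip M F (\<phi> J0) + ip X v (\<lambda>x. \<phi> J0 (x, 0))"
    and \<eta>: "\<eta> \<in> H21hat L T" and z: "\<forall>x\<in>{0<..<L}. \<eta> (x, T) = 0"
  shows "- ip M p (Dt L T \<eta>) + ip M q (Dxx L T \<eta>) = ip M F \<eta> + ip X v (\<lambda>x. \<eta> (x, 0))"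
proof -
  note w = H21hat_weak[OF \<eta>]
  have s: "sqi M (Dt L T \<eta>)" "sqi M (Dxx L T \<eta>)" "sqi M \<eta>"
    using w H21hat_sqi[OF \<eta>] by (auto simp: weak_t_def weak_x_def)
  define D where "D = SC (cC \<eta>)"
  have nD: "nice L (D N)" for N by (simp add: D_def nice_SC)
  have zT: "D N J0 (x, T) = 0" for N x by (simp add: D_def SC_def jC_T)
  have ad: "adm (D N)" for N using nD zT by (simp add: adm_def)
  have Jt: "L2conv M (\<lambda>N. D N Jt) (Dt L T \<eta>)"
    unfolding D_def by (rule SC_Jt_conv[OF s(1) cZ_Dt[OF \<eta> w(1)]]) (use trace_zero[OF \<eta> _ z] in auto)
  have Jxx: "L2conv M (\<lambda>N. D N Jxx) (Dxx L T \<eta>)"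
    unfolding D_def by (rule SC_Jxx_conv[OF s(2) cC_Dxx[OF \<eta> w(2)]])
  have J0: "L2conv M (\<lambda>N. D N J0) \<eta>" unfolding D_def by (rule expansion_C[OF s(3)])
  \<comment> \<open>The uniform limit is at first another function; it has the same mean-square
    limit as \<open>\<eta>\<close>, and continuity makes the two equal pointwise.\<close>
  obtain \<eta>' where \<eta>': "\<eta>' \<in> H21hat L T" "uniform_limit (cbox (0,0) (L,T)) (\<lambda>N. D N J0) \<eta>' sequentially"
    "L2conv M (\<lambda>N. D N J0) \<eta>'"
    by (rule t_closure[where D=D, OF nD Jt s(1) Jxx s(2)]) (use zT in blast, rule that)
  have "AE x in M. \<eta>' x = \<eta> x"
    by (rule L2conv_unique[OF \<eta>'(3) J0 nice_sqi[OF nD] H21hat_sqi[OF \<eta>'(1)] s(3)])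
  then have eq: "\<eta>' x = \<eta> x" if "x \<in> cbox (0,0) (L,T)" for x
    using continuous_AE_eq[OF H21hat_continuous[OF \<eta>'(1)] H21hat_continuous[OF \<eta>] _ that] by blast
  have "(\<lambda>N. ip X v (\<lambda>x. D N J0 (x, 0))) \<longlonglongrightarrow> ip X v (\<lambda>x. \<eta>' (x, 0))"
    by (rule trace_limit[OF \<eta>'(2) niceD(1)[OF nD] v])
  moreover have "ip X v (\<lambda>x. \<eta>' (x, 0)) = ip X v (\<lambda>x. \<eta> (x, 0))"
    unfolding ip_def using T
    by (intro Bochner_Integration.integral_cong) (auto simp: eq space_restrict_space cbox_Pair_eq)
  ultimately have v0: "(\<lambda>N. ip X v (\<lambda>x. D N J0 (x, 0))) \<longlonglongrightarrow> ip X v (\<lambda>x. \<eta> (x, 0))" by simp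
  have lim: "(\<lambda>N. ip M f (D N j)) \<longlonglongrightarrow> ip M f g" if "L2conv M (\<lambda>N. D N j) g" "sqi M g" "sqi M f" for f g j
    using L2conv_ip[OF that(1) nice_sqi[OF nD] that(2,3)] by (simp add: ip_commute)
  have "(\<lambda>N. - ip M p (D N Jt) + ip M q (D N Jxx)) \<longlonglongrightarrow> - ip M p (Dt L T \<eta>) + ip M q (Dxx L T \<eta>)"
    by (intro tendsto_intros lim Jt Jxx s p q)
  moreover have "(\<lambda>N. ip M F (D N J0) + ip X v (\<lambda>x. D N J0 (x, 0))) \<longlonglongrightarrow> ip M F \<eta> + ip X v (\<lambda>x. \<eta> (x, 0))"
    by (intro tendsto_intros lim J0 s F v0)
  ultimately show ?thesis unfolding sys[OF ad] by (rule LIMSEQ_unique)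
qed

text \<open>The solution of the first-order system has to be recognised as a pair of derivatives.
  Test pairs \<open>(0, \<psi>)\<close> give this compatibility, test pairs
  \<open>(\<phi>, 0)\<close> give the beam equation.\<close>

theorem existence:
  assumes w: "w \<in> H2 L" "w 0 = 0" "w L = 0" and v: "sqi X v" and F: "sqi M F"
  obtains u where "weak_solution L T k w v F u"
    "nsq M (Dt L T u) + nsq M (Dxx L T u) \<le> (C1 * data_norm F v (dd L w))\<^sup>2"
proof -
  define w2 where "w2 = dd L w"
  have w2: "sqi X w2" using H2_derivs[OF w(1)] unfolding w2_def by blast
  obtain w1 where wH: "(\<lambda>p. w (fst p)) \<in> H21hat L T" "weak_t (\<lambda>p. w (fst p)) (\<lambda>p. 0)"
    "weak_x (\<lambda>p. w (fst p)) (\<lambda>p. w1 (fst p)) (\<lambda>p. w2 (fst p))"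
    using H21hat_fst[OF w] unfolding w2_def by blast
  obtain p q where p: "sqi M p" and q: "sqi M q" and bnd: "nsq M p + nsq M q \<le> (C1 * data_norm F v w2)\<^sup>2"
    and sys: "\<And>\<phi> \<psi>. adm \<phi> \<Longrightarrow> adm \<psi> \<Longrightarrow> ip M p (S1 \<phi> \<psi>) + ip M q (S2 \<phi> \<psi>) = load F v w2 \<phi> \<psi>"
    using first_order_system[OF F v w2] by blast
  have w2M: "sqi M (\<lambda>p. w2 (fst p))" by (rule sqi_fst[OF w2])
  \<comment> \<open>Subtracting \<open>w''\<close> removes the initial value of \<open>q\<close>, as
    befits a function expanded in sines in time.\<close>
  define r where "r p = q p - w2 (fst p)" for p
  have r: "sqi M r" unfolding r_def by (rule sqi_diff[OF q w2M])
  \<comment> \<open>Coefficients of \<open>u - w\<close> in the family \<open>jZ\<close>: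
    differentiation in time multiplies by \<open>mu\<close>, so the differentiated series is the
    expansion of \<open>p\<close>.\<close>
  define c where "c i = cC p i / mu (fst i)" for i
  have coeff: "cZ r i = - (lam (snd i))\<^sup>2 * c i" for i
  proof -
    have "S1 (\<lambda>i p. 0) (jC i) = (\<lambda>p. (lam (snd i))\<^sup>2 * jC i J0 p)"
      "S2 (\<lambda>i p. 0) (jC i) = (\<lambda>p. - jC i Jt p)"
      by (auto simp: S1_def S2_def jC_Jxx)
    with sys[OF adm_zero adm_jC, of i]
    have 1: "(lam (snd i))\<^sup>2 * ip M p (jC i J0) - ip M q (jC i Jt) = ip X w2 (\<lambda>x. jC i J0 (x, 0))"
      using ip_minus_left[of M "jC i Jt" q]
      by (simp add: load_def ip_cmult_right ip_commute[of M q]) (simp add: ip_def)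
    \<comment> \<open>Integrating the constant extension of \<open>w''\<close> in time reproduces
      the initial term of the system, which therefore cancels in \<open>r\<close>.\<close>
    have "(LINT p|M. w2 (fst p) * jC i Jt p) = (LINT x|X. w2 x * (jC i J0 (x, T) - jC i J0 (x, 0)))"
      by (rule integral_Omega_dt[OF sqi_integrable[OF finite_X w2] _ niceD(2)[OF nice_jC] niceD(1)[OF nice_jC]])
        (use T in simp)
    then have "ip M (\<lambda>p. w2 (fst p)) (jC i Jt) = - ip X w2 (\<lambda>x. jC i J0 (x, 0))"
      by (simp add: ip_def jC_T)
    then have 2: "ip M r (jC i Jt) = (lam (snd i))\<^sup>2 * ip M p (jC i J0)"
      using 1 ip_diff_left[OF q w2M sqi_jC, of i Jt] by (simp add: r_def[abs_def])
    have "jC i Jt = (\<lambda>p. - mu (fst i) * jZ i J0 p)" by (rule ext) (rule jC_Jt)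
    then have "ip M r (jC i Jt) = - mu (fst i) * ip M r (jZ i J0)" by (simp only: ip_cmult_right)
    with 2 have "ip M r (jZ i J0) = - (lam (snd i))\<^sup>2 * (ip M p (jC i J0) / mu (fst i))"
      using mu_pos[of "fst i"] by (simp add: field_simps)
    then show ?thesis by (simp add: cZ_def cC_def c_def mult_ac)
  qed
  define D where "D = SZ c"
  have nD: "nice L (D N)" for N by (simp add: D_def nice_SZ)
  have z0: "D N J0 (x, 0) = 0" for N x by (simp add: D_def SZ_def jZ_0)
  have Jt: "L2conv M (\<lambda>N. D N Jt) p"
    unfolding D_def by (rule SZ_Jt_conv[OF p]) (use mu_pos in \<open>simp add: c_def less_imp_neq[symmetric]\<close>)
  have Jxx: "L2conv M (\<lambda>N. D N Jxx) r"
    unfolding D_def by (rule SZ_Jxx_conv[OF r coeff])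
  obtain u0 where u0: "u0 \<in> H21hat L T" "uniform_limit (cbox (0,0) (L,T)) (\<lambda>N. D N J0) u0 sequentially"
    "weak_t u0 p" "\<And>fx fxx. weak_x u0 fx fxx \<Longrightarrow> AE x in M. fxx x = r x"
    by (rule t_closure[where D=D, OF nD Jt p Jxx r]) (use z0 in blast, rule that)
  define u where "u p = u0 p + 1 * w (fst p)" for p
  have uH: "u \<in> H21hat L T" unfolding u_def by (rule H21hat_lincomb[OF u0(1) wH(1)])
  have "weak_t u (\<lambda>x. p x + 1 * 0)"
    unfolding u_def by (rule weak_t_lincomb[OF u0(3) wH(2) H21hat_sqi[OF u0(1)] H21hat_sqi[OF wH(1)]])
  from weak_t_unique[OF H21hat_weak(1)[OF uH] this] have ut: "AE x in M. Dt L T u x = p x" by simp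
  have "weak_x u (\<lambda>x. Dx L T u0 x + 1 * w1 (fst x)) (\<lambda>x. Dxx L T u0 x + 1 * w2 (fst x))"
    unfolding u_def by (rule weak_x_lincomb[OF H21hat_weak(2)[OF u0(1)] wH(3) H21hat_sqi[OF u0(1)] H21hat_sqi[OF wH(1)]])
  from weak_x_unique(2)[OF H21hat_weak(2)[OF uH] this] u0(4)[OF H21hat_weak(2)[OF u0(1)]]
  have uxx: "AE x in M. Dxx L T u x = q x" by eventually_elim (simp add: r_def)
  have s: "sqi M (Dt L T u)" "sqi M (Dxx L T u)"
    using H21hat_weak[OF uH] by (auto simp: weak_t_def weak_x_def)
  have tr: "u (x, 0) = w x" if "x \<in> {0<..<L}" for x
  proof -
    have "(x, 0) \<in> cbox (0,0) (L,T)" using that T by (simp add: cbox_Pair_eq)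
    from tendsto_uniform_limitI[OF u0(2) this] have "u0 (x, 0) = 0" by (simp add: z0 LIMSEQ_const_iff)
    then show ?thesis by (simp add: u_def)
  qed
  have kk: "sqi M (\<lambda>x. k (fst x) * q x)" by (rule sqi_k[OF q])
  have sys1: "- ip M p (\<phi> Jt) + ip M (\<lambda>x. k (fst x) * q x) (\<phi> Jxx) = ip M F (\<phi> J0) + ip X v (\<lambda>x. \<phi> J0 (x, 0))"
    if ad: "adm \<phi>" for \<phi>
  proof -
    have "S1 \<phi> (\<lambda>i p. 0) = (\<lambda>p. - \<phi> Jt p)" "S2 \<phi> (\<lambda>i p. 0) = (\<lambda>p. k (fst p) * \<phi> Jxx p)"
      by (auto simp: S1_def S2_def)
    with sys[OF ad adm_zero] show ?thesis
      using ip_minus_left[of M "\<phi> Jt" p] by (simp add: load_def ip_commute[of M p]) (simp add: ip_def mult_ac)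
  qed
  have "weak_solution L T k w v F u"
    unfolding weak_solution_iff
  proof (intro conjI ballI impI uH tr)
    fix \<eta> assume \<eta>: "\<eta> \<in> H21hat L T" and z: "\<forall>x\<in>{0<..<L}. \<eta> (x, T) = 0"
    have s': "sqi M (Dt L T \<eta>)" "sqi M (Dxx L T \<eta>)"
      using H21hat_weak[OF \<eta>] by (auto simp: weak_t_def weak_x_def)
    have "ip M (Dt L T u) (Dt L T \<eta>) = ip M p (Dt L T \<eta>)"
      by (rule ip_cong_AE[OF ut]) (use s s' p in \<open>auto simp: sqi_def\<close>)
    moreover have "ip M (\<lambda>x. k (fst x) * Dxx L T u x) (Dxx L T \<eta>) = ip M (\<lambda>x. k (fst x) * q x) (Dxx L T \<eta>)"
    proof (rule ip_cong_AE)
      show "AE x in M. k (fst x) * Dxx L T u x = k (fst x) * q x" using uxx by eventually_elim simp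
    qed (use sqi_k[OF s(2)] kk s' in \<open>auto simp: sqi_def\<close>)
    ultimately show "- ip M (Dt L T u) (Dt L T \<eta>) + ip M (\<lambda>p. k (fst p) * Dxx L T u p) (Dxx L T \<eta>) =
      ip M \<eta> F + ip X v (\<lambda>x. \<eta> (x, 0))"
      using test_extension[OF p kk F v sys1 \<eta> z] by (simp add: ip_commute[of M \<eta> F])
  qed
  moreover have "nsq M (Dt L T u) = nsq M p" "nsq M (Dxx L T u) = nsq M q"
    unfolding nsq_def using s p q by (intro ip_cong_AE ut uxx; simp add: sqi_def)+
  ultimately show ?thesis using that bnd unfolding w2_def by simp
qed

text \<open>The weak form is symmetric, so the difference of two solutions can be tested with a
  time-reversed solution whose load is that difference.\<close>

theorem uniqueness:
  assumes u: "weak_solution L T k w v F u" and u': "weak_solution L T k w v F u'"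
    and x: "x \<in> cbox (0,0) (L,T)"
  shows "u x = u' x"
proof -
  note A = u[unfolded weak_solution_iff] and B = u'[unfolded weak_solution_iff]
  define d where "d p = u p + (- 1) * u' p" for p
  have dH: "d \<in> H21hat L T" unfolding d_def by (rule H21hat_lincomb) (use A B in auto)
  have uH: "u \<in> H21hat L T" "u' \<in> H21hat L T" using A B by auto
  have sq: "sqi M (Dt L T f)" "sqi M (Dxx L T f)" if "f \<in> H21hat L T" for f
    using H21hat_weak[OF that] by (auto simp: weak_t_def weak_x_def)
  have d0: "d (x, 0) = 0" if "x \<in> {0<..<L}" for x using A B that by (simp add: d_def)
  have dt: "AE p in M. Dt L T d p = Dt L T u p + (- 1) * Dt L T u' p"
  proof (rule weak_t_unique[OF H21hat_weak(1)[OF dH]])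
    show "weak_t d (\<lambda>p. Dt L T u p + (- 1) * Dt L T u' p)"
      unfolding d_def by (intro weak_t_lincomb H21hat_weak H21hat_sqi uH)
  qed
  have dxx: "AE p in M. Dxx L T d p = Dxx L T u p + (- 1) * Dxx L T u' p"
  proof (rule weak_x_unique(2)[OF H21hat_weak(2)[OF dH]])
    show "weak_x d (\<lambda>p. Dx L T u p + (- 1) * Dx L T u' p) (\<lambda>p. Dxx L T u p + (- 1) * Dxx L T u' p)"
      unfolding d_def by (intro weak_x_lincomb H21hat_weak H21hat_sqi uH)
  qed
  have hom: "- ip M (Dt L T d) (Dt L T \<eta>) + ip M (\<lambda>p. k (fst p) * Dxx L T d p) (Dxx L T \<eta>) = 0"
    if \<eta>: "\<eta> \<in> H21hat L T" "\<forall>x\<in>{0<..<L}. \<eta> (x, T) = 0" for \<eta>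
  proof -
    have "ip M (Dt L T d) (Dt L T \<eta>) = ip M (\<lambda>p. Dt L T u p + (- 1) * Dt L T u' p) (Dt L T \<eta>)"
      by (rule ip_cong_AE[OF dt])
        (use sq[OF dH] sq[OF \<eta>(1)] sqi_add[OF sq(1)[OF uH(1)] sqi_cmult[OF sq(1)[OF uH(2)], of "- 1"]] in \<open>auto simp: sqi_def\<close>)
    also have "\<dots> = ip M (Dt L T u) (Dt L T \<eta>) + (- 1) * ip M (Dt L T u') (Dt L T \<eta>)"
      by (simp only: ip_add_left[OF sq(1)[OF uH(1)] sqi_cmult[OF sq(1)[OF uH(2)]] sq(1)[OF \<eta>(1)]] ip_cmult_left)
    finally have 1: "ip M (Dt L T d) (Dt L T \<eta>) = ip M (Dt L T u) (Dt L T \<eta>) + (- 1) * ip M (Dt L T u') (Dt L T \<eta>)" .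
    have ks: "sqi M (\<lambda>p. k (fst p) * Dxx L T u p)" "sqi M (\<lambda>p. k (fst p) * Dxx L T u' p)"
      "sqi M (\<lambda>p. k (fst p) * Dxx L T d p)"
      by (intro sqi_k sq uH dH)+
    have "ip M (\<lambda>p. k (fst p) * Dxx L T d p) (Dxx L T \<eta>) =
      ip M (\<lambda>p. k (fst p) * Dxx L T u p + (- 1) * (k (fst p) * Dxx L T u' p)) (Dxx L T \<eta>)"
    proof (rule ip_cong_AE)
      show "AE p in M. k (fst p) * Dxx L T d p = k (fst p) * Dxx L T u p + (- 1) * (k (fst p) * Dxx L T u' p)"
        using dxx by eventually_elim (simp only: distrib_left mult.left_commute)
    qed (use ks sq[OF \<eta>(1)] sqi_add[OF ks(1) sqi_cmult[OF ks(2), of "- 1"]] in \<open>auto simp: sqi_def\<close>)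
    also have "\<dots> = ip M (\<lambda>p. k (fst p) * Dxx L T u p) (Dxx L T \<eta>) + (- 1) * ip M (\<lambda>p. k (fst p) * Dxx L T u' p) (Dxx L T \<eta>)"
      by (simp only: ip_add_left[OF ks(1) sqi_cmult[OF ks(2)] sq(2)[OF \<eta>(1)]] ip_cmult_left)
    finally have 2: "ip M (\<lambda>p. k (fst p) * Dxx L T d p) (Dxx L T \<eta>) =
      ip M (\<lambda>p. k (fst p) * Dxx L T u p) (Dxx L T \<eta>) + (- 1) * ip M (\<lambda>p. k (fst p) * Dxx L T u' p) (Dxx L T \<eta>)" .
    have "- ip M (Dt L T u) (Dt L T \<eta>) + ip M (\<lambda>p. k (fst p) * Dxx L T u p) (Dxx L T \<eta>) =
      - ip M (Dt L T u') (Dt L T \<eta>) + ip M (\<lambda>p. k (fst p) * Dxx L T u' p) (Dxx L T \<eta>)"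
      using A[THEN conjunct2, THEN conjunct2, THEN bspec, OF \<eta>(1), THEN mp, OF \<eta>(2)]
        B[THEN conjunct2, THEN conjunct2, THEN bspec, OF \<eta>(1), THEN mp, OF \<eta>(2)] by simp
    then show ?thesis unfolding 1 2 by linarith
  qed
  have ds: "sqi M d" by (rule H21hat_sqi[OF dH])
  have zero: "(\<lambda>_. 0) \<in> H2 L" 
  proof -
    have "sqi X (\<lambda>_. 0::real)" by (rule sqi_zero)
    then show ?thesis
      by (auto simp: H2_def L2_iff_sqi has_weak_deriv_def intro!: bexI[of _ "\<lambda>_. 0"])
  qed
  \<comment> \<open>Zero initial data are compatible with the lateral conditions, so existence
    applies with the time-reversed difference as load.\<close>
  obtain z where z: "weak_solution L T k (\<lambda>_. 0) (\<lambda>_. 0) (\<lambda>p. d (reflect p)) z"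
    using existence[OF zero _ _ sqi_zero sqi_reflect[OF ds]] by auto
  note Z = z[unfolded weak_solution_iff]
  have zH: "z \<in> H21hat L T" using Z by simp
  define e where "e p = d (reflect p)" for p
  define \<eta> where "\<eta> p = z (reflect p)" for p
  have eH: "e \<in> H21hat L T" "weak_t e (\<lambda>p. - Dt L T d (reflect p))" "weak_x e (\<lambda>p. Dx L T d (reflect p)) (\<lambda>p. Dxx L T d (reflect p))"
    unfolding e_def by (rule H21hat_reflect[OF dH])+
  have \<eta>H: "\<eta> \<in> H21hat L T" "weak_t \<eta> (\<lambda>p. - Dt L T z (reflect p))" "weak_x \<eta> (\<lambda>p. Dx L T z (reflect p)) (\<lambda>p. Dxx L T z (reflect p))"
    unfolding \<eta>_def by (rule H21hat_reflect[OF zH])+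
  have et: "AE p in M. Dt L T e p = - Dt L T d (reflect p)" by (rule weak_t_unique[OF H21hat_weak(1)[OF eH(1)] eH(2)])
  have exx: "AE p in M. Dxx L T e p = Dxx L T d (reflect p)" by (rule weak_x_unique(2)[OF H21hat_weak(2)[OF eH(1)] eH(3)])
  have \<eta>t: "AE p in M. Dt L T \<eta> p = - Dt L T z (reflect p)" by (rule weak_t_unique[OF H21hat_weak(1)[OF \<eta>H(1)] \<eta>H(2)])
  have \<eta>xx: "AE p in M. Dxx L T \<eta> p = Dxx L T z (reflect p)" by (rule weak_x_unique(2)[OF H21hat_weak(2)[OF \<eta>H(1)] \<eta>H(3)])
  \<comment> \<open>Reversal turns the zero initial values of \<open>z\<close> and \<open>d\<close>
    into the zero terminal values required of the test functions \<open>\<eta>\<close> and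
    \<open>e\<close>.\<close>
  have "\<forall>x\<in>{0<..<L}. \<eta> (x, T) = 0" using Z by (simp add: \<eta>_def reflect_def)
  from hom[OF \<eta>H(1) this]
  have h1: "- ip M (Dt L T d) (Dt L T \<eta>) + ip M (\<lambda>p. k (fst p) * Dxx L T d p) (Dxx L T \<eta>) = 0" .
  have "\<forall>x\<in>{0<..<L}. e (x, T) = 0" using d0 by (simp add: e_def reflect_def)
  then have h2: "- ip M (Dt L T z) (Dt L T e) + ip M (\<lambda>p. k (fst p) * Dxx L T z p) (Dxx L T e) = ip M e (\<lambda>p. d (reflect p))"
    using Z eH(1) by (auto simp: ip_def)
  have m: "f \<in> borel_measurable M" if "sqi M f" for f :: "real \<times> real \<Rightarrow> real" using that by (rule sqi_measurable)
  have "ip M (Dt L T z) (Dt L T e) = ip M (Dt L T z) (\<lambda>p. - Dt L T d (reflect p))"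
    by (rule ip_cong_AE[OF _ et]) (auto intro!: m sq zH eH(1) sqi_minus sqi_reflect dH)
  also have "\<dots> = ip M (\<lambda>p. Dt L T z (reflect p)) (\<lambda>p. - Dt L T d p)"
    by (rule ip_reflect[symmetric]) (auto intro!: m sq zH sqi_minus dH)
  also have "\<dots> = ip M (Dt L T d) (\<lambda>p. - Dt L T z (reflect p))"
    by (simp add: ip_def mult.commute)
  also have "\<dots> = ip M (Dt L T d) (Dt L T \<eta>)"
    by (rule ip_cong_AE[OF AE_I2]) (use \<eta>t in \<open>auto intro!: m sq zH \<eta>H(1) sqi_minus sqi_reflect dH elim!: eventually_mono\<close>)
  finally have e1: "ip M (Dt L T z) (Dt L T e) = ip M (Dt L T d) (Dt L T \<eta>)" .
  have "ip M (\<lambda>p. k (fst p) * Dxx L T z p) (Dxx L T e) = ip M (\<lambda>p. k (fst p) * Dxx L T z p) (\<lambda>p. Dxx L T d (reflect p))"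
    by (rule ip_cong_AE[OF _ exx]) (auto intro!: m sq zH eH(1) sqi_k sqi_reflect dH)
  also have "\<dots> = ip M (\<lambda>p. k (fst (reflect p)) * Dxx L T z (reflect p)) (Dxx L T d)"
    by (rule ip_reflect[symmetric, where f="\<lambda>p. k (fst p) * Dxx L T z p"]) (auto intro!: m sq zH sqi_k dH)
  also have "\<dots> = ip M (\<lambda>p. k (fst p) * Dxx L T d p) (\<lambda>p. Dxx L T z (reflect p))"
    by (simp add: ip_def mult_ac)
  also have "\<dots> = ip M (\<lambda>p. k (fst p) * Dxx L T d p) (Dxx L T \<eta>)"
    by (rule ip_cong_AE[OF AE_I2]) (use \<eta>xx in \<open>auto intro!: m sq zH \<eta>H(1) sqi_k sqi_reflect dH elim!: eventually_mono\<close>)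
  finally have e2: "ip M (\<lambda>p. k (fst p) * Dxx L T z p) (Dxx L T e) = ip M (\<lambda>p. k (fst p) * Dxx L T d p) (Dxx L T \<eta>)" .
  \<comment> \<open>By symmetry the form at \<open>(d, \<eta>)\<close> equals the form at
    \<open>(z, e)\<close>: the first is zero, the second is the squared norm of
    \<open>e\<close>.\<close>
  have "nsq M (\<lambda>p. d (reflect p)) = 0" using h1 h2 unfolding e1 e2 by (simp add: nsq_def e_def[abs_def])
  from nsq_eq_0_AE[OF sqi_reflect[OF ds] this] have "AE p in M. d (reflect p) = 0" .
  from AE_reflect[OF this] have "AE p in M. u p = u' p" by (simp add: d_def)
  from continuous_AE_eq[OF H21hat_continuous[OF uH(1)] H21hat_continuous[OF uH(2)] this x] show ?thesis .
qed

text \<open>The initial trace of a solution is continuous up to the endpoints, equals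
  \<open>w\<close> in between, and vanishes at the corners by the lateral condition. So
  \<open>existence\<close> applies whenever a solution is given.\<close>

lemma initial_boundary:
  assumes "weak_solution L T k w v F u" "w \<in> H2 L"
  shows "w 0 = 0" "w L = 0"
proof -
  have A: "u \<in> H21hat L T" "\<forall>x\<in>{0<..<L}. u (x, 0) = w x"
    using assms(1) by (simp_all add: weak_solution_def)
  have cw: "continuous_on {0..L} w" using assms(2) by (simp add: H2_def)
  have cu: "continuous_on {0..L} (\<lambda>x. u (x, 0))"
    by (rule continuous_on_compose2[OF H21hat_continuous[of u]])
      (use A T in \<open>auto intro!: continuous_intros simp: cbox_Pair_eq\<close>)
  have cl: "closure {0<..<L} = {0..L}" using L by simp
  have "w x - u (x, 0) = 0" if "x \<in> {0..L}" for x
    by (rule continuous_constant_on_closure[of "{0<..<L}"]) (use A that cl in \<open>auto intro!: continuous_intros cw cu\<close>)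
  from this[of 0] this[of L] H21hat_boundary[of u 0] A L T show "w 0 = 0" "w L = 0" by auto
qed

text \<open>The bound is known for the constructed solution, and uniqueness carries it to the given
  one.\<close>

theorem energy_estimate:
  assumes w: "w \<in> H2 L" and v: "sqi X v" and F: "sqi M F" and u: "weak_solution L T k w v F u"
  shows "H21_norm L T u \<le> sqrt (1 + L\<^sup>2 + L ^ 4) * C1 * data_norm F v (dd L w)"
proof -
  obtain u' where u': "weak_solution L T k w v F u'"
    "nsq M (Dt L T u') + nsq M (Dxx L T u') \<le> (C1 * data_norm F v (dd L w))\<^sup>2"
    using existence[OF w initial_boundary[OF u w] v F] by blast
  have H: "u \<in> H21hat L T" "u' \<in> H21hat L T" using u u'(1) by (auto simp: weak_solution_def)
  note ae = weak_cong_left[OF H uniqueness[OF u u'(1)]]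
  have "nsq M (Dt L T u) = nsq M (Dt L T u')" "nsq M (Dxx L T u) = nsq M (Dxx L T u')"
    unfolding nsq_def using H21hat_weak[OF H(1)] H21hat_weak[OF H(2)]
    by (intro ip_cong_AE ae; simp add: weak_t_def weak_x_def sqi_def)+
  then have "H21_norm L T u \<le> sqrt (1 + L\<^sup>2 + L ^ 4) * (C1 * data_norm F v (dd L w))"
    using u'(2) C1_nonneg
    by (intro H21_norm_le[OF H(1)]) (auto simp: data_norm_def nsq_nonneg intro!: mult_nonneg_nonneg add_nonneg_nonneg)
  then show ?thesis by (simp add: mult.assoc)
qed

end

text \<open>Existence is claimed for \<open>w\<close> vanishing at both ends, a condition that any
  solution forces by \<open>initial_boundary\<close>. Positivity of \<open>k\<close> takes the form
  of a uniform lower bound, since the constants contain \<open>1 / k0\<close>. \<open>C0\<close> is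
  quantified before the data.\<close>

theorem lemma1:
  fixes L T vc :: real and k :: "real \<Rightarrow> real"
  assumes "L > 0" and "T > 0"
    and "k \<in> Linf {0<..<L}"
    and "\<exists>k0 > 0. AE x in lebesgue_on {0<..<L}. k0 \<le> k x"
  shows
    "(\<forall>w v F. w \<in> H2 L \<and> v \<in> Vad L vc \<and> F \<in> L2 (Omega L T) \<longrightarrow>
        (w 0 = 0 \<and> w L = 0 \<longrightarrow> (\<exists>u. weak_solution L T k w v F u)) \<and>
        (\<forall>u u'. weak_solution L T k w v F u \<and> weak_solution L T k w v F u' \<longrightarrow>
           (\<forall>p \<in> {0..L} \<times> {0..T}. u p = u' p))) \<and>
     (\<exists>C0. \<forall>w v F u. w \<in> H2 L \<and> v \<in> Vad L vc \<and> F \<in> L2 (Omega L T) \<and>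
        weak_solution L T k w v F u \<longrightarrow>
        H21_norm L T u \<le>
          C0 * (L2_norm {0<..<L} (dd L w) + L2_norm {0<..<L} v + L2_norm (Omega L T) F))"
proof -
  interpret rectangle L T by unfold_locales fact+
  let ?X = "lebesgue_on {0<..<L}"
  obtain k0 where k0: "k0 > 0" "AE x in ?X. k0 \<le> k x" using assms(4) by blast
  obtain C where C: "AE x in ?X. \<bar>k x\<bar> \<le> C" using assms(3) by (auto simp: Linf_def)
  have km: "k \<in> borel_measurable ?X" using assms(3) by (simp add: Linf_def)
  \<comment> \<open>Truncation to the interval from \<open>k0\<close> to \<open>max C k0\<close>
    changes \<open>k\<close> on a null set of \<open>(0, L)\<close> only and makes both bounds hold
    everywhere; the maximum keeps the interval nonempty.\<close>
  define \<kappa> where "\<kappa> x = max k0 (min (max C k0) (k x))" for x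
  have \<kappa>m: "\<kappa> \<in> borel_measurable ?X" unfolding \<kappa>_def using km by measurable
  have ae: "AE x in ?X. k x = \<kappa> x"
    using k0(2) C by eventually_elim (auto simp: \<kappa>_def)
  interpret beam L T \<kappa> k0 "max C k0"
    by unfold_locales (use \<kappa>m k0 in \<open>auto simp: \<kappa>_def\<close>)
  have tr: "weak_solution L T k w v F u \<longleftrightarrow> weak_solution L T \<kappa> w v F u" for w v F u
    by (rule weak_solution_cong[OF km \<kappa>m ae])
  have v: "sqi ?X v" if "v \<in> Vad L vc" for v using that by (simp add: Vad_def L2_iff_sqi)
  have box: "{0..L} \<times> {0..T} = cbox (0,0) (L,T)" by (auto simp: cbox_Pair_eq)
  show ?thesis
  proof (intro conjI allI impI ballI)
    fix w v F assume "w \<in> H2 L \<and> v \<in> Vad L vc \<and> F \<in> L2 (Omega L T)" "w 0 = 0 \<and> w L = 0"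
    then show "\<exists>u. weak_solution L T k w v F u"
      using existence[of w v F] v by (auto simp: tr L2_iff_sqi)
  next
    fix w v F u u' p
    assume "weak_solution L T k w v F u \<and> weak_solution L T k w v F u'" "p \<in> {0..L} \<times> {0..T}"
    then show "u p = u' p" using uniqueness[of w v F u u' p] by (simp add: tr box)
  next
    show "\<exists>C0. \<forall>w v F u. w \<in> H2 L \<and> v \<in> Vad L vc \<and> F \<in> L2 (Omega L T) \<and>
        weak_solution L T k w v F u \<longrightarrow>
        H21_norm L T u \<le>
          C0 * (L2_norm {0<..<L} (dd L w) + L2_norm {0<..<L} v + L2_norm (Omega L T) F)"
    proof (intro exI[of _ "sqrt (1 + L\<^sup>2 + L ^ 4) * C1"] allI impI)
      fix w v F u
      assume "w \<in> H2 L \<and> v \<in> Vad L vc \<and> F \<in> L2 (Omega L T) \<and> weak_solution L T k w v F u"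
      then have "H21_norm L T u \<le> sqrt (1 + L\<^sup>2 + L ^ 4) * C1 * data_norm F v (dd L w)"
        using v by (intro energy_estimate) (auto simp: tr L2_iff_sqi)
      then show "H21_norm L T u \<le> sqrt (1 + L\<^sup>2 + L ^ 4) * C1 *
        (L2_norm {0<..<L} (dd L w) + L2_norm {0<..<L} v + L2_norm (Omega L T) F)"
        by (simp add: L2_norm_eq data_norm_def add_ac)
    qed
  qed
qed

end
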